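(* Let $F_{1,2}(\mathbb{C}^3)=SU(3)/U(1)^2$ be the manifold of full flags in $\mathbb{C}^3$, equipped with its homogeneous nearly Kähler structure $(g,J)$. Every connected totally geodesic Lagrangian submanifold of $(F_{1,2}(\mathbb{C}^3),g,J)$ is congruent to an open subset of one of the two homogeneous Lagrangian submanifolds $F_{1,2}(\mathbb{R}^3)=SO(3)\cdot f_{\mathrm{st}}$ or $S^3=SU(2)\cdot f_{\mathrm{st}}$ of $F_{1,2}(\mathbb{C}^3)$, where $f_{\mathrm{st}}$ is the standard flag, $SO(3)\subset SU(3)$ is the standard subgroup of real matrices, and $SU(2)\subset SU(3)$ is the connected subgroup with Lie algebra $\mathrm{span}\{m_1+m_2,\,-m_4+m_5,\,m_6-\sqrt{3}\,h_2\}$.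
   Context: Basis of $\mathfrak{su}(3)$. Let $E_{jk}$ denote the elementary $3\times 3$ matrices and $I=\sqrt{-1}$. Put $h_1=\mathrm{diag}(-I,0,I)$, $h_2=\tfrac{1}{\sqrt3}\mathrm{diag}(I,-2I,I)$, $m_1=E_{21}-E_{12}$, $m_2=E_{32}-E_{23}$, $m_3=E_{31}-E_{13}$, $m_4=I(E_{12}+E_{21})$, $m_5=I(E_{23}+E_{32})$, $m_6=I(E_{13}+E_{31})$. This basis of $\mathfrak{su}(3)$ is orthonormal for $-\tfrac{1}{12}B$, where $B$ is the Killing form of $\mathfrak{su}(3)$. Let $\mathfrak{h}=\mathrm{span}\{h_1,h_2\}$, the Lie algebra of the subgroup $H=U(1)^2\subset SU(3)$ of diagonal matrices, and $\mathfrak{m}=\mathrm{span}\{m_1,\dots,m_6\}$, so $\mathfrak{su}(3)=\mathfrak{h}\oplus\mathfrak{m}$ is a reductive decomposition. Let $m^1,\dots,m^6$ be the dual basis of $m_1,\dots,m_6$. The flag manifold. $F_{1,2}(\mathbb{C}^3)$ is the space of pairs (line, plane) in $\mathbb{C}^3$ with the line contained in the plane. $SU(3)$ acts transitively on it, and $H$ is the stabilizer of the standard flag $f_{\mathrm{st}}=(\mathbb{C}\times\{0\}\times\{0\},\ \mathbb{C}\times\mathbb{C}\times\{0\})$, so $F_{1,2}(\mathbb{C}^3)=SU(3)/H$ with $T_{eH}(SU(3)/H)\cong\mathfrak{m}$ via $X\mapsto \frac{d}{dt}\big|_{t=0}e^{tX}H$. Nearly Kähler structure. $g$ is the $SU(3)$-invariant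 Riemannian metric for which $m_1,\dots,m_6$ is an orthonormal basis of $\mathfrak{m}$. $\omega_J$ is the $SU(3)$-invariant $2$-form given on $\mathfrak{m}$ by $\omega_J=m^1\wedge m^4+m^2\wedge m^5-m^3\wedge m^6$, and $J$ is the $SU(3)$-invariant almost complex structure defined by $g(Jx,y)=\omega_J(x,y)$. Lagrangian. A submanifold $\iota:L\to F_{1,2}(\mathbb{C}^3)$ of (real) dimension $3$ is Lagrangian if $\iota^*\omega_J=0$. Totally geodesic means totally geodesic with respect to the Levi-Civita connection of $g$. Congruence. Two submanifolds of $F_{1,2}(\mathbb{C}^3)$ are congruent if one is mapped onto the other by an isometry of $(F_{1,2}(\mathbb{C}^3),g)$ which also preserves $J$. *)

theory Defs
  imports "HOL-Analysis.Analysis"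
begin

section \<open>Smooth manifolds with a Riemannian metric\<close>

subsection \<open>Smooth maps between open subsets of Euclidean spaces\<close>

text \<open>Only meant for open \<open>S\<close>, where the Frechet derivative at a point of \<open>S\<close> depends on the values
  of \<open>f\<close> on \<open>S\<close> alone.\<close>

primrec Ck_on :: "nat \<Rightarrow> 'a::euclidean_space set \<Rightarrow> ('a \<Rightarrow> 'b::euclidean_space) \<Rightarrow> bool" where
  "Ck_on 0 S f \<longleftrightarrow> continuous_on S f"
| "Ck_on (Suc k) S f \<longleftrightarrow>
     (\<forall>x\<in>S. f differentiable (at x)) \<and> (\<forall>v. Ck_on k S (\<lambda>x. frechet_derivative f (at x) v))"

definition smooth_on :: "'a::euclidean_space set \<Rightarrow> ('a \<Rightarrow> 'b::euclidean_space) \<Rightarrow> bool" where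
  "smooth_on S f \<longleftrightarrow> (\<forall>k. Ck_on k S f)"

subsection \<open>Charts, manifolds and smooth maps\<close>

type_synonym ('a, 'e) chart = "'a set \<times> ('a \<Rightarrow> 'e)"

definition chart_image :: "('a, 'e) chart \<Rightarrow> 'e set" where
  "chart_image c = snd c ` fst c"

definition chart_inv :: "('a, 'e) chart \<Rightarrow> 'e \<Rightarrow> 'a" where
  "chart_inv c = inv_into (fst c) (snd c)"

definition is_chart :: "'a topology \<Rightarrow> ('a, 'e::euclidean_space) chart \<Rightarrow> bool" where
  "is_chart M c \<longleftrightarrow> openin M (fst c) \<and> open (chart_image c) \<and>
     homeomorphic_map (subtopology M (fst c)) (top_of_set (chart_image c)) (snd c)"

definition smooth_manifold :: "'a topology \<Rightarrow> ('a, 'e::euclidean_space) chart set \<Rightarrow> bool" where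
  "smooth_manifold M \<A> \<longleftrightarrow> Hausdorff_space M \<and> second_countable M \<and>
     (\<forall>c\<in>\<A>. is_chart M c) \<and> (\<Union>c\<in>\<A>. fst c) = topspace M \<and>
     (\<forall>c\<in>\<A>. \<forall>d\<in>\<A>. smooth_on (snd c ` (fst c \<inter> fst d)) (snd d \<circ> chart_inv c))"

text \<open>The coordinate expression of a map \<open>f\<close> in the charts \<open>c\<close> (source) and \<open>d\<close> (target),
  and the set on which it is defined.\<close>

definition local_map :: "('a, 'e) chart \<Rightarrow> ('b, 'f) chart \<Rightarrow> ('a \<Rightarrow> 'b) \<Rightarrow> 'e \<Rightarrow> 'f" where
  "local_map c d f = snd d \<circ> f \<circ> chart_inv c"

definition local_dom :: "('a, 'e) chart \<Rightarrow> ('b, 'f) chart \<Rightarrow> ('a \<Rightarrow> 'b) \<Rightarrow> 'e set" where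
  "local_dom c d f = {x \<in> chart_image c. f (chart_inv c x) \<in> fst d}"

definition smooth_map :: "'a topology \<Rightarrow> ('a, 'e::euclidean_space) chart set \<Rightarrow>
    'b topology \<Rightarrow> ('b, 'f::euclidean_space) chart set \<Rightarrow> ('a \<Rightarrow> 'b) \<Rightarrow> bool" where
  "smooth_map M \<A> N \<B> f \<longleftrightarrow> continuous_map M N f \<and>
     (\<forall>c\<in>\<A>. \<forall>d\<in>\<B>. smooth_on (local_dom c d f) (local_map c d f))"

definition immersion :: "'a topology \<Rightarrow> ('a, 'e::euclidean_space) chart set \<Rightarrow>
    'b topology \<Rightarrow> ('b, 'f::euclidean_space) chart set \<Rightarrow> ('a \<Rightarrow> 'b) \<Rightarrow> bool" where
  "immersion M \<A> N \<B> f \<longleftrightarrow> smooth_map M \<A> N \<B> f \<and>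
     (\<forall>c\<in>\<A>. \<forall>d\<in>\<B>. \<forall>x\<in>local_dom c d f. inj (frechet_derivative (local_map c d f) (at x)))"

definition diffeomorphism :: "'a topology \<Rightarrow> ('a, 'e::euclidean_space) chart set \<Rightarrow>
    'b topology \<Rightarrow> ('b, 'f::euclidean_space) chart set \<Rightarrow> ('a \<Rightarrow> 'b) \<Rightarrow> bool" where
  "diffeomorphism M \<A> N \<B> f \<longleftrightarrow> bij_betw f (topspace M) (topspace N) \<and>
     smooth_map M \<A> N \<B> f \<and> smooth_map N \<B> M \<A> (inv_into (topspace M) f)"

subsection \<open>Tensor fields, the Levi-Civita connection, totally geodesic maps\<close>

text \<open>A covariant 2-tensor field is given by its coordinate expressions: \<open>T c x u v\<close> is its value at
  the point with coordinates \<open>x\<close> in the chart \<open>c\<close>, on the two tangent vectors whose components in \<open>c\<close>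
  are \<open>u\<close> and \<open>v\<close>. An endomorphism field is given in the same way.\<close>

type_synonym ('a, 'e) tensor2 = "('a, 'e) chart \<Rightarrow> 'e \<Rightarrow> 'e \<Rightarrow> 'e \<Rightarrow> real"
type_synonym ('a, 'e) endo_field = "('a, 'e) chart \<Rightarrow> 'e \<Rightarrow> 'e \<Rightarrow> 'e"

text \<open>The Christoffel symbols \<open>\<Gamma> x u v = (\<nabla>\<^sub>u v)(x)\<close> (for vector fields \<open>u\<close>, \<open>v\<close> with constant
  components) of the Levi-Civita connection of a metric \<open>g\<close> on an open subset of a Euclidean space,
  determined by the Koszul formula.\<close>

definition christoffel :: "('e::euclidean_space \<Rightarrow> 'e \<Rightarrow> 'e \<Rightarrow> real) \<Rightarrow> 'e \<Rightarrow> 'e \<Rightarrow> 'e \<Rightarrow> 'e" where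
  "christoffel g x u v = (THE w. \<forall>z. 2 * g x w z =
       frechet_derivative (\<lambda>y. g y v z) (at x) u
     + frechet_derivative (\<lambda>y. g y u z) (at x) v
     - frechet_derivative (\<lambda>y. g y u v) (at x) z)"

text \<open>\<open>covariant_hessian g F x u v\<close> is the covariant derivative, in the direction \<open>dF(u)\<close> and with
  respect to the Levi-Civita connection of \<open>g\<close>, of the vector field \<open>dF(v)\<close> along \<open>F\<close>. Its component
  normal to the image of \<open>dF\<close> is the second fundamental form of \<open>F\<close>, so an immersion is totally
  geodesic iff all these derivatives are tangent to it.\<close>

definition covariant_hessian :: "('f::euclidean_space \<Rightarrow> 'f \<Rightarrow> 'f \<Rightarrow> real) \<Rightarrow>
    ('e::euclidean_space \<Rightarrow> 'f) \<Rightarrow> 'e \<Rightarrow> 'e \<Rightarrow> 'e \<Rightarrow> 'f" where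
  "covariant_hessian g F x u v =
     frechet_derivative (\<lambda>y. frechet_derivative F (at y) v) (at x) u
     + christoffel g (F x) (frechet_derivative F (at x) u) (frechet_derivative F (at x) v)"

definition totally_geodesic :: "('a, 'e::euclidean_space) chart set \<Rightarrow>
    ('b, 'f::euclidean_space) chart set \<Rightarrow> ('b, 'f) tensor2 \<Rightarrow> ('a \<Rightarrow> 'b) \<Rightarrow> bool" where
  "totally_geodesic \<A> \<B> g f \<longleftrightarrow>
     (\<forall>c\<in>\<A>. \<forall>d\<in>\<B>. \<forall>x\<in>local_dom c d f. \<forall>u v.
        covariant_hessian (g d) (local_map c d f) x u v
          \<in> range (frechet_derivative (local_map c d f) (at x)))"

definition pullback_vanishes :: "('a, 'e::euclidean_space) chart set \<Rightarrow>
    ('b, 'f::euclidean_space) chart set \<Rightarrow> ('b, 'f) tensor2 \<Rightarrow> ('a \<Rightarrow> 'b) \<Rightarrow> bool" where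
  "pullback_vanishes \<A> \<B> \<omega> f \<longleftrightarrow>
     (\<forall>c\<in>\<A>. \<forall>d\<in>\<B>. \<forall>x\<in>local_dom c d f. \<forall>u v.
        \<omega> d (local_map c d f x) (frechet_derivative (local_map c d f) (at x) u)
          (frechet_derivative (local_map c d f) (at x) v) = 0)"

definition isometry :: "'a topology \<Rightarrow> ('a, 'e::euclidean_space) chart set \<Rightarrow> ('a, 'e) tensor2 \<Rightarrow>
    ('a \<Rightarrow> 'a) \<Rightarrow> bool" where
  "isometry M \<A> g f \<longleftrightarrow> diffeomorphism M \<A> M \<A> f \<and>
     (\<forall>c\<in>\<A>. \<forall>d\<in>\<A>. \<forall>x\<in>local_dom c d f. \<forall>u v.
        g d (local_map c d f x) (frechet_derivative (local_map c d f) (at x) u)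
          (frechet_derivative (local_map c d f) (at x) v) = g c x u v)"

definition preserves_endo :: "('a, 'e::euclidean_space) chart set \<Rightarrow> ('a, 'e) endo_field \<Rightarrow>
    ('a \<Rightarrow> 'a) \<Rightarrow> bool" where
  "preserves_endo \<A> J f \<longleftrightarrow>
     (\<forall>c\<in>\<A>. \<forall>d\<in>\<A>. \<forall>x\<in>local_dom c d f. \<forall>u.
        frechet_derivative (local_map c d f) (at x) (J c x u)
          = J d (local_map c d f x) (frechet_derivative (local_map c d f) (at x) u))"

section \<open>The flag manifold\<close>

subsection \<open>Matrices\<close>

type_synonym mat3 = "complex^3^3"

definition E :: "3 \<Rightarrow> 3 \<Rightarrow> mat3" where
  "E j k = (\<chi> a b. if a = j \<and> b = k then 1 else 0)"

definition cscale :: "complex \<Rightarrow> mat3 \<Rightarrow> mat3" where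
  "cscale z X = (\<chi> a b. z * X $ a $ b)"

definition diag3 :: "complex \<Rightarrow> complex \<Rightarrow> complex \<Rightarrow> mat3" where
  "diag3 a b c = cscale a (E 1 1) + cscale b (E 2 2) + cscale c (E 3 3)"

definition conj_transpose :: "mat3 \<Rightarrow> mat3" where
  "conj_transpose X = (\<chi> a b. cnj (X $ b $ a))"

definition SU3 :: "mat3 set" where
  "SU3 = {A. conj_transpose A ** A = mat 1 \<and> det A = 1}"

definition SO3 :: "mat3 set" where
  "SO3 = {A \<in> SU3. \<forall>a b. A $ a $ b \<in> \<real>}"

definition mexp :: "mat3 \<Rightarrow> mat3" where
  "mexp X = (\<Sum>n. (1 / fact n) *\<^sub>R ((\<lambda>Y. X ** Y) ^^ n) (mat 1))"

text \<open>The connected Lie subgroup with Lie algebra \<open>\<kk>\<close> consists of the finite products of exponentials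
  of elements of \<open>\<kk>\<close>. Inverses need no clause, since \<open>\<kk>\<close> is closed under negation.\<close>

inductive_set connected_subgroup :: "mat3 set \<Rightarrow> mat3 set" for \<kk> :: "mat3 set" where
  one: "mat 1 \<in> connected_subgroup \<kk>"
| mult: "A \<in> connected_subgroup \<kk> \<Longrightarrow> X \<in> \<kk> \<Longrightarrow> A ** mexp X \<in> connected_subgroup \<kk>"

definition h1 :: mat3 where "h1 = diag3 (- \<i>) 0 \<i>"
definition h2 :: mat3 where "h2 = (1 / sqrt 3) *\<^sub>R diag3 \<i> (- 2 * \<i>) \<i>"
definition m1 :: mat3 where "m1 = E 2 1 - E 1 2"
definition m2 :: mat3 where "m2 = E 3 2 - E 2 3"
definition m3 :: mat3 where "m3 = E 3 1 - E 1 3"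
definition m4 :: mat3 where "m4 = cscale \<i> (E 1 2 + E 2 1)"
definition m5 :: mat3 where "m5 = cscale \<i> (E 2 3 + E 3 2)"
definition m6 :: mat3 where "m6 = cscale \<i> (E 1 3 + E 3 1)"

text \<open>A conjugate of the block-embedded \<open>SU(2)\<close>; the three generators span a copy of \<open>\<ss>\<uu>(2)\<close>.\<close>

definition SU2 :: "mat3 set" where
  "SU2 = connected_subgroup (span {m1 + m2, - m4 + m5, m6 - sqrt 3 *\<^sub>R h2})"

text \<open>The dual basis of \<open>m1, \<dots>, m6\<close>, extended to \<open>\<ss>\<uu>(3)\<close> by zero on \<open>\<hh> = span {h1, h2}\<close>. Here \<open>\<bullet>\<close> is
  the inner product \<open>Re (tr (X Y\<^sup>*))\<close>, for which \<open>h1, h2, m1, \<dots>, m6\<close> are orthogonal with squared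
  norm 2; see the lemmas below.\<close>

definition dual :: "mat3 \<Rightarrow> mat3 \<Rightarrow> real" where
  "dual b X = (b \<bullet> X) / (b \<bullet> b)"

definition wedge :: "('v \<Rightarrow> real) \<Rightarrow> ('v \<Rightarrow> real) \<Rightarrow> 'v \<Rightarrow> 'v \<Rightarrow> real" where
  "wedge \<alpha> \<beta> x y = \<alpha> x * \<beta> y - \<alpha> y * \<beta> x"

definition m_proj :: "mat3 \<Rightarrow> mat3" where
  "m_proj X = (\<Sum>b\<in>{m1, m2, m3, m4, m5, m6}. dual b X *\<^sub>R b)"

definition g_m :: "mat3 \<Rightarrow> mat3 \<Rightarrow> real" where
  "g_m X Y = (\<Sum>b\<in>{m1, m2, m3, m4, m5, m6}. dual b X * dual b Y)"

definition \<omega>_m :: "mat3 \<Rightarrow> mat3 \<Rightarrow> real" where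
  "\<omega>_m X Y = wedge (dual m1) (dual m4) X Y + wedge (dual m2) (dual m5) X Y
     - wedge (dual m3) (dual m6) X Y"

lemma inner_mat3: "(X::mat3) \<bullet> Y =
    X$1$1 \<bullet> Y$1$1 + X$1$2 \<bullet> Y$1$2 + X$1$3 \<bullet> Y$1$3
  + X$2$1 \<bullet> Y$2$1 + X$2$2 \<bullet> Y$2$2 + X$2$3 \<bullet> Y$2$3
  + X$3$1 \<bullet> Y$3$1 + X$3$2 \<bullet> Y$3$2 + X$3$3 \<bullet> Y$3$3"
  by (simp add: inner_vec_def sum_3)

lemmas basis_defs = h1_def h2_def m1_def m2_def m3_def m4_def m5_def m6_def
  diag3_def cscale_def E_def

lemma dual_m:
  "dual m1 m1 = 1" "dual m1 m2 = 0" "dual m1 m3 = 0" "dual m1 m4 = 0" "dual m1 m5 = 0" "dual m1 m6 = 0"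
  "dual m2 m1 = 0" "dual m2 m2 = 1" "dual m2 m3 = 0" "dual m2 m4 = 0" "dual m2 m5 = 0" "dual m2 m6 = 0"
  "dual m3 m1 = 0" "dual m3 m2 = 0" "dual m3 m3 = 1" "dual m3 m4 = 0" "dual m3 m5 = 0" "dual m3 m6 = 0"
  "dual m4 m1 = 0" "dual m4 m2 = 0" "dual m4 m3 = 0" "dual m4 m4 = 1" "dual m4 m5 = 0" "dual m4 m6 = 0"
  "dual m5 m1 = 0" "dual m5 m2 = 0" "dual m5 m3 = 0" "dual m5 m4 = 0" "dual m5 m5 = 1" "dual m5 m6 = 0"
  "dual m6 m1 = 0" "dual m6 m2 = 0" "dual m6 m3 = 0" "dual m6 m4 = 0" "dual m6 m5 = 0" "dual m6 m6 = 1"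
  by (simp_all add: dual_def inner_mat3 basis_defs inner_complex_def)

lemma dual_h:
  "b \<in> {m1, m2, m3, m4, m5, m6} \<Longrightarrow> dual b h1 = 0"
  "b \<in> {m1, m2, m3, m4, m5, m6} \<Longrightarrow> dual b h2 = 0"
  by (auto simp add: dual_def inner_mat3 basis_defs inner_complex_def)

lemma distinct_m: "distinct [m1, m2, m3, m4, m5, m6]"
proof -
  have "b \<noteq> b'" if "dual b b \<noteq> dual b b'" for b b' using that by auto
  then show ?thesis by (auto simp add: dual_m)
qed

subsection \<open>Flags, the action of SU(3), and the quotient topology\<close>

type_synonym flag = "(complex^3) set \<times> (complex^3) set"

text \<open>Pairs (line, plane). The interpretation \<open>vec\<close> is complex linear algebra: its scalar
  multiplication is \<open>*s\<close>.\<close>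

definition flags :: "flag set" where
  "flags = {(l, p). vec.subspace l \<and> vec.dim l = 1 \<and> vec.subspace p \<and> vec.dim p = 2 \<and> l \<subseteq> p}"

definition act :: "mat3 \<Rightarrow> flag \<Rightarrow> flag" where
  "act A f = ((*v) A ` fst f, (*v) A ` snd f)"

definition f_st :: flag where
  "f_st = ({v. v $ 2 = 0 \<and> v $ 3 = 0}, {v. v $ 3 = 0})"

definition orbit :: "mat3 set \<Rightarrow> flag set" where
  "orbit K = (\<lambda>A. act A f_st) ` K"

text \<open>The quotient topology for \<open>SU(3) \<rightarrow> SU(3)/H\<close>, \<open>A \<mapsto> A \<cdot> f_st\<close>.\<close>

definition flag_topology :: "flag topology" where
  "flag_topology = topology (\<lambda>U. U \<subseteq> flags \<and> openin (top_of_set SU3) {A \<in> SU3. act A f_st \<in> U})"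

lemma openin_flag_topology:
  "openin flag_topology U \<longleftrightarrow> U \<subseteq> flags \<and> openin (top_of_set SU3) {A \<in> SU3. act A f_st \<in> U}"
proof -
  have "istopology (\<lambda>U. U \<subseteq> flags \<and> openin (top_of_set SU3) {A \<in> SU3. act A f_st \<in> U})"
    unfolding istopology_def
  proof (intro conjI allI impI)
    fix S T
    assume "S \<subseteq> flags \<and> openin (top_of_set SU3) {A \<in> SU3. act A f_st \<in> S}"
      and "T \<subseteq> flags \<and> openin (top_of_set SU3) {A \<in> SU3. act A f_st \<in> T}"
    moreover have "{A \<in> SU3. act A f_st \<in> S \<inter> T} =
        {A \<in> SU3. act A f_st \<in> S} \<inter> {A \<in> SU3. act A f_st \<in> T}" by auto
    ultimately show "S \<inter> T \<subseteq> flags" "openin (top_of_set SU3) {A \<in> SU3. act A f_st \<in> S \<inter> T}"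
      by auto
  next
    fix \<K> assume *: "\<forall>K\<in>\<K>. K \<subseteq> flags \<and> openin (top_of_set SU3) {A \<in> SU3. act A f_st \<in> K}"
    then show "\<Union>\<K> \<subseteq> flags" by auto
    have "{A \<in> SU3. act A f_st \<in> \<Union>\<K>} = (\<Union>K\<in>\<K>. {A \<in> SU3. act A f_st \<in> K})" by auto
    then show "openin (top_of_set SU3) {A \<in> SU3. act A f_st \<in> \<Union>\<K>}" using * by auto
  qed
  then show ?thesis unfolding flag_topology_def by (simp add: topology_inverse')
qed

subsection \<open>Smooth structure\<close>

text \<open>A local lift of (the inverse of) a chart through the projection \<open>SU(3) \<rightarrow> SU(3)/H\<close>.\<close>

definition flag_lift :: "(flag, real^6) chart \<Rightarrow> (real^6) set \<Rightarrow> (real^6 \<Rightarrow> mat3) \<Rightarrow> bool" where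
  "flag_lift c W A \<longleftrightarrow> open W \<and> W \<subseteq> chart_image c \<and> smooth_on W A \<and>
     (\<forall>y\<in>W. A y \<in> SU3 \<and> act (A y) f_st = chart_inv c y)"

text \<open>Left translation by \<open>A x\<close> identifies the tangent space of the flag manifold at \<open>A x \<cdot> f_st\<close> with
  \<open>\<mm>\<close>, the element \<open>X\<close> of \<open>\<mm>\<close> corresponding to the velocity of \<open>A x \<cdot> exp (t X) \<cdot> f_st\<close> at \<open>t = 0\<close>.
  Under this identification the tangent vector with components \<open>u\<close> becomes the \<open>\<mm>\<close>-part of
  \<open>A\<^sup>-\<^sup>1 dA(u)\<close>; the matrix \<open>A x\<close> is unitary.\<close>

definition flag_coframe :: "(real^6 \<Rightarrow> mat3) \<Rightarrow> real^6 \<Rightarrow> real^6 \<Rightarrow> mat3" where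
  "flag_coframe A x u = m_proj (conj_transpose (A x) ** frechet_derivative A (at x) u)"

text \<open>The smooth structure of the homogeneous space \<open>SU(3)/H\<close> is the one for which the projection from
  \<open>SU(3)\<close> is a smooth submersion. Its charts are the topological charts whose inverses are immersions
  that lift locally to smooth maps into \<open>SU(3)\<close>.\<close>

definition flag_atlas :: "(flag, real^6) chart set" where
  "flag_atlas = {c. is_chart flag_topology c \<and>
     (\<forall>x\<in>chart_image c. \<exists>W A. flag_lift c W A \<and> x \<in> W \<and> inj (flag_coframe A x))}"

subsection \<open>The nearly Kaehler structure\<close>

text \<open>The \<open>SU(3)\<close>-invariant tensor field determined by an \<open>Ad(H)\<close>-invariant bilinear form \<open>B\<close> on \<open>\<mm>\<close>.
  Replacing the lift \<open>A\<close> by another lift \<open>A h\<close>, with \<open>h\<close> a map into \<open>H\<close>, changes the coframe by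
  \<open>Ad(h\<^sup>-\<^sup>1)\<close>, so the value does not depend on the lift.\<close>

definition invariant_tensor :: "(mat3 \<Rightarrow> mat3 \<Rightarrow> real) \<Rightarrow> (flag, real^6) tensor2" where
  "invariant_tensor B c x u v = (THE r. \<forall>W A. flag_lift c W A \<and> x \<in> W \<longrightarrow>
     r = B (flag_coframe A x u) (flag_coframe A x v))"

definition flag_metric :: "(flag, real^6) tensor2" where
  "flag_metric = invariant_tensor g_m"

definition flag_omega :: "(flag, real^6) tensor2" where
  "flag_omega = invariant_tensor \<omega>_m"

definition flag_J :: "(flag, real^6) endo_field" where
  "flag_J c x u = (THE w. \<forall>v. flag_metric c x w v = flag_omega c x u v)"

subsection \<open>Submanifolds\<close>

text \<open>A three-dimensional immersed submanifold \<open>\<iota>: L \<rightarrow> F\<close> of the flag manifold \<open>F\<close>; the manifold \<open>L\<close>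
  is given by its topology and an atlas.\<close>

definition flag_submanifold3 ::
    "'l topology \<Rightarrow> ('l, real^3) chart set \<Rightarrow> ('l \<Rightarrow> flag) \<Rightarrow> bool" where
  "flag_submanifold3 L \<A> \<iota> \<longleftrightarrow> smooth_manifold L \<A> \<and> immersion L \<A> flag_topology flag_atlas \<iota>"

definition Lagrangian ::
    "'l topology \<Rightarrow> ('l, real^3) chart set \<Rightarrow> ('l \<Rightarrow> flag) \<Rightarrow> bool" where
  "Lagrangian L \<A> \<iota> \<longleftrightarrow>
     flag_submanifold3 L \<A> \<iota> \<and> pullback_vanishes \<A> flag_atlas flag_omega \<iota>"

definition congruent_flags :: "flag set \<Rightarrow> flag set \<Rightarrow> bool" where
  "congruent_flags S T \<longleftrightarrow> (\<exists>\<Phi>. isometry flag_topology flag_atlas flag_metric \<Phi> \<and>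
     preserves_endo flag_atlas flag_J \<Phi> \<and> \<Phi> ` S = T)"

end

theory Submission
  imports Defs
begin

text \<open>
  A map into the flag manifold is studied through its local lifts \<open>A\<close> to \<open>SU(3)\<close>. The \<open>\<mm>\<close>-part of
  \<open>A\<^sup>-\<^sup>1 dA\<close> is the differential of the map in a moving frame. In the three complex coordinates
  \<open>X\<^sub>2\<^sub>1, X\<^sub>3\<^sub>2, X\<^sub>1\<^sub>3\<close> of \<open>\<mm>\<close> the metric is the real inner product of \<open>\<complex>\<^sup>3\<close>, the form \<open>\<omega>\<^sub>J\<close> is the imaginary
  part of the Hermitian product, the torus acts by phases, and the \<open>\<mm>\<close>-part of the bracket is the
  complex conjugate of the cross product. As this bracket is totally skew, the Levi-Civita connection
  is the canonical connection of the homogeneous space plus half the bracket (\<open>flag_christoffel\<close>).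

  Let \<open>V\<close> be the tangent space of a totally geodesic Lagrangian submanifold in such a frame.
  Differentiating \<open>\<omega>\<^sub>J = 0\<close> on \<open>V\<close> shows that \<open>[V, V]\<^sub>\<mm>\<close> is contained in \<open>V\<close> (\<open>tgl_ccross\<close>). Hence half the
  bracket can be dropped, and \<open>V\<close> is parallel for the canonical connection (\<open>tgl_canon\<close>) and preserved
  by its curvature: \<open>[[V, V]\<^sub>\<hh>, V]\<close> is contained in \<open>V\<close> (\<open>tgl_curv\<close>). Thus \<open>V\<close> and \<open>[V, V]\<^sub>\<hh>\<close> together span
  a Lie algebra, and the submanifold should be an orbit of the corresponding group. Linear algebra
  leaves few possibilities for \<open>V\<close>: up to the torus it is \<open>\<real>\<^sup>3\<close> (\<open>flat_case\<close>), the tangent space of the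
  orbit of \<open>SO(3)\<close>, or the tangent space of the orbit of \<open>SU(2)\<close> with its coordinates permuted
  cyclically (\<open>curved_case\<close>).

  The phases by which \<open>V\<close> differs from its normal form depend differentiably on the point, so they can
  be removed by changing the lift. Once \<open>V\<close> is constant, its being parallel says that
  \<open>A\<^sup>-\<^sup>1 dA\<close> takes values in the Lie algebra of a fixed group \<open>K\<close>, which consists of the scalar multiples
  of real matrices or is the stabilizer of a complex line; consequently \<open>A\<close> stays in one coset
  \<open>C K\<close> (\<open>adapted_lift\<close>). The normal forms are inequivalent under the torus, and torus elements
  preserving one of them belong to \<open>K\<close> (\<open>model_unique\<close>). Therefore the parts of the submanifold that
  belong to the various cosets are open and either equal or disjoint, and by connectedness there is
  only one (\<open>single_model\<close>).

  The left multiplication by \<open>C\<^sup>-\<^sup>1\<close>, followed by a cyclic permutation of the three orthogonal lines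
  of a flag, is an isometry preserving \<open>J\<close> (\<open>symmetry_isometry\<close>). It moves the submanifold into the
  orbit of \<open>SO(3)\<close> or of \<open>SU(2)\<close> (\<open>orbit_SO3\<close>, \<open>orbit_SU2\<close>). Both orbits are three-dimensional, as they
  are graphs over \<open>\<real>\<^sup>3\<close> in the big cell, so the image is open in the orbit (\<open>orbit_neighbourhood\<close>).

  The big cell and its translates also provide charts of the flag manifold. The other charts of the
  atlas are known only through their lifts; that changes of coordinates are smooth follows from an
  inverse function argument (\<open>smooth_on_lift\<close>).
\<close>

section \<open>Smooth maps between Euclidean spaces\<close>

abbreviation D :: "('a::real_normed_vector \<Rightarrow> 'b::real_normed_vector) \<Rightarrow> 'a \<Rightarrow> 'a \<Rightarrow> 'b" where
  "D f x \<equiv> frechet_derivative f (at x)"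

lemma D_has_derivative: "f differentiable (at x) \<Longrightarrow> (f has_derivative D f x) (at x)"
  by (simp add: frechet_derivative_works)

lemma D_eq: "(f has_derivative f') (at x) \<Longrightarrow> D f x = f'"
  by (metis frechet_derivative_at)

lemma D_cong:
  assumes "open S" "x \<in> S" "\<And>y. y \<in> S \<Longrightarrow> f y = g y"
  shows "D f x = D g x"
proof -
  have "(f has_derivative f') (at x) \<longleftrightarrow> (g has_derivative f') (at x)" for f'
    using has_derivative_transform_within_open[of f f' x UNIV S g]
      has_derivative_transform_within_open[of g f' x UNIV S f] assms by fastforce
  then show ?thesis unfolding frechet_derivative_def by simp
qed

lemma differentiable_cong:
  assumes "open S" "x \<in> S" "\<And>y. y \<in> S \<Longrightarrow> f y = g y"
  shows "f differentiable (at x) \<longleftrightarrow> g differentiable (at x)"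
  unfolding differentiable_def
  using has_derivative_transform_within_open[of f _ x UNIV S g]
      has_derivative_transform_within_open[of g _ x UNIV S f] assms by metis

lemma D_chain:
  assumes "f differentiable (at x)" "g differentiable (at (f x))"
  shows "D (\<lambda>y. g (f y)) x v = D g (f x) (D f x v)"
proof -
  have "((\<lambda>y. g (f y)) has_derivative (\<lambda>v. D g (f x) (D f x v))) (at x)"
    using has_derivative_compose[OF D_has_derivative[OF assms(1)] D_has_derivative[OF assms(2)]] .
  then show ?thesis by (simp add: D_eq)
qed

lemma D_linear: "f differentiable (at x) \<Longrightarrow> linear (D f x)"
  by (rule linear_frechet_derivative)

lemma D_bounded_linear:
  assumes "bounded_linear L" "f differentiable (at x)"
  shows "D (\<lambda>y. L (f y)) x v = L (D f x v)"
  using bounded_linear.has_derivative[OF assms(1) D_has_derivative[OF assms(2)]]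
  by (simp add: D_eq)

lemma D_bilinear:
  assumes "bounded_bilinear p" "f differentiable (at x)" "g differentiable (at x)"
  shows "D (\<lambda>y. p (f y) (g y)) x v = p (f x) (D g x v) + p (D f x v) (g x)"
  using bounded_bilinear.FDERIV[OF assms(1) D_has_derivative[OF assms(2)] D_has_derivative[OF assms(3)]]
  by (simp add: D_eq)

lemma differentiable_bounded_linear:
  assumes "bounded_linear L" "f differentiable F"
  shows "(\<lambda>y. L (f y)) differentiable F"
  using assms bounded_linear.has_derivative unfolding differentiable_def by blast

lemma differentiable_bilinear:
  assumes "bounded_bilinear p" "f differentiable (at x)" "g differentiable (at x)"
  shows "(\<lambda>y. p (f y) (g y)) differentiable (at x)"
  using bounded_bilinear.FDERIV[OF assms(1) D_has_derivative[OF assms(2)] D_has_derivative[OF assms(3)]]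
  unfolding differentiable_def by blast

lemma Ck_on_cong:
  assumes "open S" "\<And>x. x \<in> S \<Longrightarrow> f x = g x"
  shows "Ck_on k S f \<longleftrightarrow> Ck_on k S g"
  using assms(2)
proof (induction k arbitrary: f g)
  case 0
  then show ?case by (auto cong: continuous_on_cong)
next
  case (Suc k)
  have 1: "f differentiable (at x) \<longleftrightarrow> g differentiable (at x)" if "x \<in> S" for x
    using differentiable_cong[OF assms(1) that Suc.prems] .
  have 2: "Ck_on k S (\<lambda>x. D f x v) \<longleftrightarrow> Ck_on k S (\<lambda>x. D g x v)" for v
    by (rule Suc.IH) (use D_cong[OF assms(1) _ Suc.prems] in auto)
  show ?case using 1 2 by auto
qed

lemma Ck_on_subset: "Ck_on k S f \<Longrightarrow> T \<subseteq> S \<Longrightarrow> Ck_on k T f"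
proof (induction k arbitrary: f)
  case 0
  then show ?case by (auto intro: continuous_on_subset)
next
  case (Suc k)
  then show ?case by auto
qed

lemma Ck_on_SucD: "Ck_on (Suc k) S f \<Longrightarrow> Ck_on k S f"
proof (induction k arbitrary: f)
  case 0
  then show ?case
    by (auto intro!: continuous_at_imp_continuous_on differentiable_imp_continuous_within)
next
  case (Suc k)
  then show ?case by auto
qed

lemma Ck_on_local:
  assumes "\<And>x. x \<in> S \<Longrightarrow> \<exists>U. open U \<and> x \<in> U \<and> Ck_on k U f"
  shows "Ck_on k S f"
  using assms
proof (induction k arbitrary: f)
  case 0
  have "isCont f x" if "x \<in> S" for x
    using 0[OF that] by (auto simp: continuous_on_eq_continuous_at)
  then show ?case by (simp add: continuous_at_imp_continuous_on)
next
  case (Suc k)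
  have "f differentiable (at x)" if "x \<in> S" for x
    using Suc.prems[OF that] by auto
  moreover have "Ck_on k S (\<lambda>x. D f x v)" for v
  proof (rule Suc.IH)
    fix x assume "x \<in> S"
    then show "\<exists>U. open U \<and> x \<in> U \<and> Ck_on k U (\<lambda>x. D f x v)"
      using Suc.prems[of x] by auto
  qed
  ultimately show ?case by simp
qed

lemma Ck_on_const: "Ck_on k S (\<lambda>x. c)"
proof (induction k arbitrary: c)
  case (Suc k)
  show ?case by (simp add: Suc.IH)
qed simp

lemma Ck_on_linear:
  assumes "bounded_linear f"
  shows "Ck_on k S f"
proof (cases k)
  case 0
  then show ?thesis by (simp add: linear_continuous_on[OF assms])
next
  case (Suc m)
  have "D f x = f" for x
    using bounded_linear_imp_has_derivative[OF assms] by (rule D_eq)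
  then show ?thesis using Suc bounded_linear_imp_differentiable[OF assms] by (simp add: Ck_on_const)
qed

lemma Ck_on_bounded_linear:
  assumes "open S" "bounded_linear L" "Ck_on k S f"
  shows "Ck_on k S (\<lambda>x. L (f x))"
  using assms(3)
proof (induction k arbitrary: f)
  case 0
  then show ?case using assms(2) by (simp add: bounded_linear.continuous_on)
next
  case (Suc k)
  have d: "f differentiable (at x)" if "x \<in> S" for x using Suc.prems that by simp
  have "Ck_on k S (\<lambda>x. D (\<lambda>x. L (f x)) x v)" for v
  proof -
    have "Ck_on k S (\<lambda>x. L (D f x v))" using Suc by simp
    then show ?thesis
      by (subst Ck_on_cong[OF assms(1), of _ "\<lambda>x. L (D f x v)"])
        (simp_all add: D_bounded_linear[OF assms(2) d])
  qed
  moreover have "(\<lambda>x. L (f x)) differentiable (at x)" if "x \<in> S" for x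
    using differentiable_bounded_linear[OF assms(2) d[OF that]] .
  ultimately show ?case by simp
qed

lemma Ck_on_add:
  assumes "open S" "Ck_on k S f" "Ck_on k S g"
  shows "Ck_on k S (\<lambda>x. f x + g x)"
  using assms(2,3)
proof (induction k arbitrary: f g)
  case 0
  then show ?case by (simp add: continuous_on_add)
next
  case (Suc k)
  have "Ck_on k S (\<lambda>x. D (\<lambda>x. f x + g x) x v)" for v
  proof -
    have "Ck_on k S (\<lambda>x. D f x v + D g x v)" using Suc by simp
    moreover have "D (\<lambda>x. f x + g x) x v = D f x v + D g x v" if "x \<in> S" for x
      using has_derivative_add[OF D_has_derivative[of f x] D_has_derivative[of g x]] Suc.prems that
      by (simp add: D_eq)
    ultimately show ?thesis
      by (subst Ck_on_cong[OF assms(1), of _ "\<lambda>x. D f x v + D g x v"]) simp_all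
  qed
  then show ?case using Suc.prems by simp
qed

lemma Ck_on_sum:
  assumes "open S" "finite I" "\<And>i. i \<in> I \<Longrightarrow> Ck_on k S (f i)"
  shows "Ck_on k S (\<lambda>x. \<Sum>i\<in>I. f i x)"
  using assms(2,3) by (induction I) (auto simp: Ck_on_const Ck_on_add[OF assms(1)])

lemma Ck_on_bilinear:
  assumes "open S" "bounded_bilinear p" "Ck_on k S f" "Ck_on k S g"
  shows "Ck_on k S (\<lambda>x. p (f x) (g x))"
  using assms(3,4)
proof (induction k arbitrary: f g)
  case 0
  then show ?case by (simp add: bounded_bilinear.continuous_on[OF assms(2)])
next
  case (Suc k)
  have d: "f differentiable (at x)" "g differentiable (at x)" if "x \<in> S" for x
    using Suc.prems that by simp_all
  have "Ck_on k S (\<lambda>x. D (\<lambda>x. p (f x) (g x)) x v)" for v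
  proof -
    have "Ck_on k S (\<lambda>x. p (f x) (D g x v) + p (D f x v) (g x))"
      using Suc.prems Ck_on_SucD[OF Suc.prems(1)] Ck_on_SucD[OF Suc.prems(2)]
      by (intro Ck_on_add assms(1) Suc.IH) simp_all
    then show ?thesis
      by (subst Ck_on_cong[OF assms(1), of _ "\<lambda>x. p (f x) (D g x v) + p (D f x v) (g x)"])
        (simp_all add: D_bilinear[OF assms(2) d])
  qed
  moreover have "(\<lambda>x. p (f x) (g x)) differentiable (at x)" if "x \<in> S" for x
    using differentiable_bilinear[OF assms(2) d[OF that]] .
  ultimately show ?case by simp
qed

text \<open>Expanding the chain rule in a basis writes the derivative as a sum of products to which the
  induction hypothesis applies.\<close>

lemma Ck_on_compose:
  fixes f :: "'a::euclidean_space \<Rightarrow> 'b::euclidean_space" and g :: "'b \<Rightarrow> 'c::euclidean_space"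
  assumes "open S" "open T" "f ` S \<subseteq> T" "Ck_on k S f" "Ck_on k T g"
  shows "Ck_on k S (\<lambda>x. g (f x))"
  using assms(4,5)
proof (induction k arbitrary: g)
  case 0
  then show ?case using assms(3) continuous_on_compose2[of T g S f] by auto
next
  case (Suc k)
  have d: "f differentiable (at x)" "g differentiable (at (f x))" if "x \<in> S" for x
    using Suc.prems that assms(3) by auto
  have "Ck_on k S (\<lambda>x. D (\<lambda>x. g (f x)) x v)" for v
  proof -
    have 1: "Ck_on k S (\<lambda>x. \<Sum>b\<in>Basis. (D f x v \<bullet> b) *\<^sub>R D g (f x) b)"
    proof (intro Ck_on_sum[OF assms(1)] finite_Basis Ck_on_bilinear[OF assms(1) bounded_bilinear_scaleR])
      fix b :: 'b assume "b \<in> Basis"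
      show "Ck_on k S (\<lambda>x. D f x v \<bullet> b)"
        using Suc.prems by (intro Ck_on_bounded_linear[OF assms(1) bounded_linear_inner_left]) simp
      show "Ck_on k S (\<lambda>x. D g (f x) b)"
        using Suc.prems by (intro Suc.IH Ck_on_SucD[of k S f]) simp_all
    qed
    have 2: "D (\<lambda>x. g (f x)) x v = (\<Sum>b\<in>Basis. (D f x v \<bullet> b) *\<^sub>R D g (f x) b)" if "x \<in> S" for x
    proof -
      have "D (\<lambda>x. g (f x)) x v = D g (f x) (D f x v)"
        by (rule D_chain[OF d[OF that]])
      also have "\<dots> = D g (f x) (\<Sum>b\<in>Basis. (D f x v \<bullet> b) *\<^sub>R b)"
        by (simp add: euclidean_representation)
      also have "\<dots> = (\<Sum>b\<in>Basis. (D f x v \<bullet> b) *\<^sub>R D g (f x) b)"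
        by (simp add: linear_sum[OF D_linear[OF d(2)[OF that]]] linear_scale[OF D_linear[OF d(2)[OF that]]])
      finally show ?thesis .
    qed
    show ?thesis using 1 by (subst Ck_on_cong[OF assms(1) 2])
  qed
  moreover have "(\<lambda>x. g (f x)) differentiable (at x)" if "x \<in> S" for x
    using differentiable_chain_at[OF d[OF that]] by (simp add: o_def)
  ultimately show ?case by simp
qed

lemma Ck_on_inverse: "Ck_on k (- {0}) (inverse :: real \<Rightarrow> real)"
proof (induction k)
  case 0
  show ?case by (auto intro: continuous_intros)
next
  case (Suc k)
  have o: "open (- {0::real})" by auto
  have h: "(inverse has_derivative (\<lambda>v. - (inverse x * v * inverse x))) (at x)" if "x \<noteq> 0" for x :: real
    by (rule has_derivative_inverse'[OF that])
  have 1: "Ck_on k (-{0}) (\<lambda>x. (inverse x *\<^sub>R (- v) * inverse x :: real))" for v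
    using Suc by (intro Ck_on_bilinear[OF o bounded_bilinear_mult]
        Ck_on_bilinear[OF o bounded_bilinear_scaleR] Ck_on_const)
  have "Ck_on k (-{0}) (\<lambda>x. D inverse x v)" for v :: real
    by (subst Ck_on_cong[OF o, of _ "\<lambda>x. inverse x *\<^sub>R (- v) * inverse x"]) (use D_eq[OF h] 1 in auto)
  moreover have "inverse differentiable (at x)" if "x \<noteq> 0" for x :: real
    using h[OF that] by (auto simp: differentiable_def)
  ultimately show ?case by simp
qed

lemma Ck_on_sqrt: "Ck_on k {0<..} sqrt"
proof (induction k)
  case 0
  show ?case by (auto intro: continuous_intros)
next
  case (Suc k)
  have o: "open {0::real<..}" by auto
  have h: "(sqrt has_derivative (\<lambda>v. v * (inverse (sqrt x) / 2))) (at x)" if "x > 0" for x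
    proof -
    have "(*) (inverse (sqrt x) / 2) = (\<lambda>v. v * (inverse (sqrt x) / 2))" by auto
    then show ?thesis using DERIV_real_sqrt[OF that] by (simp add: has_field_derivative_def)
  qed
  have 1: "Ck_on k {0<..} (\<lambda>x. (v / 2) *\<^sub>R (inverse (sqrt x)) :: real)" for v
    using Suc by (intro Ck_on_bilinear[OF o bounded_bilinear_scaleR] Ck_on_const
        Ck_on_compose[OF o _ _ _ Ck_on_inverse]) auto
  have "Ck_on k {0<..} (\<lambda>x. D sqrt x v)" for v :: real
    by (subst Ck_on_cong[OF o, of _ "\<lambda>x. (v / 2) *\<^sub>R inverse (sqrt x)"]) (use D_eq[OF h] 1 in auto)
  moreover have "sqrt differentiable (at x)" if "x > 0" for x :: real
    using h[OF that] by (auto simp: differentiable_def)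
  ultimately show ?case by simp
qed

lemma Ck_on_components:
  fixes f :: "'a::euclidean_space \<Rightarrow> 'b::euclidean_space"
  assumes "open S" "\<And>b. b \<in> Basis \<Longrightarrow> Ck_on k S (\<lambda>x. f x \<bullet> b)"
  shows "Ck_on k S f"
proof -
  have "Ck_on k S (\<lambda>x. \<Sum>b\<in>Basis. (f x \<bullet> b) *\<^sub>R b)"
    using assms by (intro Ck_on_sum Ck_on_bilinear[OF _ bounded_bilinear_scaleR] Ck_on_const) auto
  then show ?thesis by (simp add: euclidean_representation)
qed

subsection \<open>Linear systems and inverse functions\<close>

lemma Ck_on_prod:
  fixes f :: "'i \<Rightarrow> 'a::euclidean_space \<Rightarrow> real"
  assumes "open S" "finite I" "\<And>i. i \<in> I \<Longrightarrow> Ck_on k S (f i)"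
  shows "Ck_on k S (\<lambda>x. \<Prod>i\<in>I. f i x)"
  using assms(2,3)
  by (induction I) (auto simp: Ck_on_const Ck_on_bilinear[OF assms(1) bounded_bilinear_mult])

lemma Ck_on_det:
  fixes M :: "'a::euclidean_space \<Rightarrow> real^'n^'n"
  assumes "open S" "\<And>i j. Ck_on k S (\<lambda>x. M x $ i $ j)"
  shows "Ck_on k S (\<lambda>x. det (M x))"
  unfolding det_def
  by (intro Ck_on_sum Ck_on_bilinear[OF _ bounded_bilinear_mult] Ck_on_prod Ck_on_const assms) auto

lemma Ck_on_nth:
  fixes f :: "'a::euclidean_space \<Rightarrow> real^'n"
  assumes "open S" "Ck_on k S f"
  shows "Ck_on k S (\<lambda>x. f x $ i)"
  using Ck_on_bounded_linear[OF assms(1) bounded_linear_vec_nth assms(2)] .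

text \<open>Cramer's rule expresses the solution by rational operations in the data.\<close>

lemma Ck_on_solve_linear:
  fixes M :: "'a::euclidean_space \<Rightarrow> real^'n \<Rightarrow> real^'n"
  assumes "open S" and lin: "\<And>x. x \<in> S \<Longrightarrow> linear (M x)" and inj: "\<And>x. x \<in> S \<Longrightarrow> inj (M x)"
    and M: "\<And>b. Ck_on k S (\<lambda>x. M x b)" and v: "Ck_on k S v"
    and eq: "\<And>x. x \<in> S \<Longrightarrow> M x (w x) = v x"
  shows "Ck_on k S w"
proof (rule Ck_on_components[OF assms(1)])
  fix b :: "real^'n" assume "b \<in> Basis"
  then obtain j where b: "b = axis j 1" by (auto simp: Basis_vec_def)
  let ?N = "\<lambda>x. \<chi> i l. if l = j then v x $ i else matrix (M x) $ i $ l"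
  have nz: "det (matrix (M x)) \<noteq> 0" if "x \<in> S" for x
    using det_nz_iff_inj[OF lin[OF that]] inj[OF that] by simp
  have w: "w x \<bullet> b = det (?N x) * inverse (det (matrix (M x)))" if "x \<in> S" for x
  proof -
    have "matrix (M x) *v w x = v x" using eq[OF that] by (simp add: lin that)
    then have *: "w x = (\<chi> k. det (\<chi> i l. if l = k then v x $ i else matrix (M x) $ i $ l) / det (matrix (M x)))"
      using cramer[OF nz[OF that]] by blast
    show ?thesis by (subst *) (simp add: b inner_axis divide_inverse)
  qed
  have m: "Ck_on k S (\<lambda>x. matrix (M x) $ i $ l)" for i l
    unfolding matrix_def by (simp add: Ck_on_nth[OF assms(1) M])
  have 1: "Ck_on k S (\<lambda>x. det (?N x))"
  proof (rule Ck_on_det[OF assms(1)])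
    show "Ck_on k S (\<lambda>x. ?N x $ i $ l)" for i l
      by (cases "l = j") (simp_all add: m Ck_on_nth[OF assms(1) v])
  qed
  have 2: "Ck_on k S (\<lambda>x. inverse (det (matrix (M x))))"
    by (rule Ck_on_compose[OF assms(1) _ _ _ Ck_on_inverse]) (auto simp: nz Ck_on_det[OF assms(1) m])
  show "Ck_on k S (\<lambda>x. w x \<bullet> b)"
    by (subst Ck_on_cong[OF assms(1) w]) (auto intro: Ck_on_bilinear[OF assms(1) bounded_bilinear_mult 1 2])
qed

text \<open>A left inverse of \<open>f'\<close> reduces the claim to the case \<open>f' = id\<close>. Then \<open>f\<close> does not shrink distances
  near \<open>h x\<close> by more than a factor of two, so the increments of \<open>h\<close> are bounded by those of \<open>f \<circ> h\<close>,
  and the first order expansion of \<open>f \<circ> h\<close> becomes one of \<open>h\<close>.\<close>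

lemma has_derivative_lift:
  fixes f :: "'a::real_normed_vector \<Rightarrow> 'b::real_normed_vector"
    and h :: "'c::real_normed_vector \<Rightarrow> 'a"
  assumes f: "(f has_derivative f') (at (h x))" and g': "bounded_linear g'" "\<And>v. g' (f' v) = v"
    and h: "isCont h x" and k: "((\<lambda>z. f (h z)) has_derivative k') (at x)"
  shows "(h has_derivative (\<lambda>v. g' (k' v))) (at x)"
proof -
  have p: "((\<lambda>z. g' (f z)) has_derivative (\<lambda>v. v)) (at (h x))"
    using bounded_linear.has_derivative[OF g'(1) f] by (simp add: g'(2))
  have q: "((\<lambda>z. g' (f (h z))) has_derivative (\<lambda>v. g' (k' v))) (at x)"
    using bounded_linear.has_derivative[OF g'(1) k] .
  have bl: "bounded_linear (\<lambda>v. g' (k' v))" using q by (rule has_derivative_bounded_linear)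
  obtain C where C: "C > 0" "\<And>v. norm (g' (k' v)) \<le> norm v * C"
    using bounded_linear.pos_bounded[OF bl] by auto
  show ?thesis unfolding has_derivative_at_alt
  proof (intro conjI bl allI impI)
    fix e :: real assume e: "e > 0"
    \<comment> \<open>The increments of \<open>h\<close> will be at most \<open>2 (C + 1)\<close> times those of its argument.\<close>
    define a where "a = min (1/2) (e / (4 * (C + 1)))"
    define c where "c = min 1 (e / 2)"
    have a: "a > 0" "a \<le> 1/2" "a * (2 * (C + 1)) \<le> e / 2"
    proof -
      show "a > 0" using e C by (simp add: a_def)
      show "a \<le> 1/2" unfolding a_def by (rule min.cobounded1)
      have "a * (2 * (C + 1)) \<le> e / (4 * (C + 1)) * (2 * (C + 1))"
        using C by (intro mult_right_mono) (auto simp: a_def)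
      also have "\<dots> = e / 2" using C by (simp add: field_simps)
      finally show "a * (2 * (C + 1)) \<le> e / 2" .
    qed
    have c: "c > 0" "c \<le> 1" "c \<le> e / 2" using e by (auto simp: c_def)
    obtain d1 where d1: "d1 > 0"
      "\<And>y. norm (y - h x) < d1 \<Longrightarrow> norm (g' (f y) - g' (f (h x)) - (y - h x)) \<le> a * norm (y - h x)"
      using p a(1) unfolding has_derivative_at_alt by blast
    obtain d2 where d2: "d2 > 0"
      "\<And>y. norm (y - x) < d2 \<Longrightarrow> norm (g' (f (h y)) - g' (f (h x)) - g' (k' (y - x))) \<le> c * norm (y - x)"
      using q c(1) unfolding has_derivative_at_alt by blast
    obtain d3 where d3: "d3 > 0" "\<And>y. norm (y - x) < d3 \<Longrightarrow> norm (h y - h x) < d1"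
      using h[unfolded continuous_at_eps_delta, rule_format, OF d1(1)] by (auto simp: dist_norm)
    show "\<exists>d>0. \<forall>y. norm (y - x) < d \<longrightarrow> norm (h y - h x - g' (k' (y - x))) \<le> e * norm (y - x)"
    proof (intro exI[of _ "min d2 d3"] conjI allI impI)
      show "min d2 d3 > 0" using d2 d3 by simp
      fix y assume y: "norm (y - x) < min d2 d3"
      let ?H = "h y - h x" and ?P = "g' (f (h y)) - g' (f (h x))" and ?K = "g' (k' (y - x))"
      have 1: "norm (?P - ?H) \<le> a * norm ?H" using d1(2)[of "h y"] d3(2)[of y] y by auto
      have 2: "norm (?P - ?K) \<le> c * norm (y - x)" using d2(2)[of y] y by auto
      have "norm ?H \<le> norm ?P + norm (?P - ?H)" by (metis norm_triangle_sub norm_minus_commute)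
      moreover have "a * norm ?H \<le> 1/2 * norm ?H" using a by (intro mult_right_mono) auto
      ultimately have 3: "norm ?H \<le> 2 * norm ?P" using 1 by simp
      have "norm ?P \<le> norm ?K + norm (?P - ?K)" by (metis norm_triangle_sub)
      also have "\<dots> \<le> norm (y - x) * C + 1 * norm (y - x)"
        using C(2)[of "y - x"] 2 c(2) mult_right_mono[OF c(2), of "norm (y - x)"] by (intro add_mono) auto
      finally have 4: "norm ?H \<le> 2 * (C + 1) * norm (y - x)" using 3 by (simp add: algebra_simps)
      have "norm (?H - ?K) \<le> norm (?P - ?K) + norm (?P - ?H)"
        using norm_triangle_ineq4[of "?P - ?K" "?P - ?H"] by (simp add: algebra_simps)
      also have "\<dots> \<le> c * norm (y - x) + a * (2 * (C + 1) * norm (y - x))"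
        using 1 2 mult_left_mono[OF 4, of a] a(1) by linarith
      also have "\<dots> \<le> e / 2 * norm (y - x) + e / 2 * norm (y - x)"
        using mult_right_mono[OF c(3), of "norm (y - x)"] mult_right_mono[OF a(3), of "norm (y - x)"]
        by (simp add: mult.assoc)
      finally show "norm (?H - ?K) \<le> e * norm (y - x)" by simp
    qed
  qed
qed

text \<open>By the chain rule, \<open>D h\<close> solves a linear system with matrix \<open>D f (h x)\<close>, so \<open>h\<close> gains one
  derivative over the coefficients; induction on the order.\<close>

lemma smooth_on_lift:
  fixes f :: "real^'n \<Rightarrow> real^'n" and h :: "'a::euclidean_space \<Rightarrow> real^'n"
  assumes "open S" "open T" and f: "smooth_on S f" and inj: "\<And>y. y \<in> S \<Longrightarrow> inj (D f y)"
    and h: "continuous_on T h" "h ` T \<subseteq> S" and k: "smooth_on T (\<lambda>x. f (h x))"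
  shows "smooth_on T h"
proof -
  have df: "f differentiable (at y)" if "y \<in> S" for y
    using f that unfolding smooth_on_def by (metis Ck_on.simps(2))
  have dk: "(\<lambda>x. f (h x)) differentiable (at x)" if "x \<in> T" for x
    using k that unfolding smooth_on_def by (metis Ck_on.simps(2))
  have dh: "h differentiable (at x)" if "x \<in> T" for x
  proof -
    have y: "h x \<in> S" using h that by auto
    obtain g' where g': "linear g'" "g' \<circ> D f (h x) = id"
      using linear_injective_left_inverse[OF D_linear[OF df[OF y]] inj[OF y]] by auto
    have "(h has_derivative (\<lambda>v. g' (D (\<lambda>x. f (h x)) x v))) (at x)"
    proof (rule has_derivative_lift[OF D_has_derivative[OF df[OF y]] _ _ _ D_has_derivative[OF dk[OF that]]])
      show "bounded_linear g'" "\<And>v. g' (D f (h x) v) = v"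
        using g' by (auto simp: linear_conv_bounded_linear fun_eq_iff)
      show "isCont h x" using h(1) that continuous_on_eq_continuous_at[OF assms(2)] by blast
    qed
    then show ?thesis by (auto simp: differentiable_def)
  qed
  have "Ck_on k T h" for k
  proof (induction k)
    case 0
    then show ?case using h by simp
  next
    case (Suc n)
    have "Ck_on n T (\<lambda>x. D h x v)" for v
    proof (rule Ck_on_solve_linear[OF assms(2), where M = "\<lambda>x. D f (h x)" and v = "\<lambda>x. D (\<lambda>x. f (h x)) x v"])
      fix x assume x: "x \<in> T"
      then have y: "h x \<in> S" using h by auto
      show "linear (D f (h x))" "inj (D f (h x))" using D_linear df inj y by auto
      show "D f (h x) (D h x v) = D (\<lambda>x. f (h x)) x v"
        by (simp add: D_chain[OF dh[OF x] df[OF y]])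
    next
      fix b
      have "Ck_on (Suc n) S f" using f by (simp add: smooth_on_def)
      then show "Ck_on n T (\<lambda>x. D f (h x) b)"
        using Ck_on_compose[OF assms(2,1) h(2) Suc, of "\<lambda>y. D f y b"] by simp
      show "Ck_on n T (\<lambda>x. D (\<lambda>x. f (h x)) x v)" using k unfolding smooth_on_def by (metis Ck_on.simps(2))
    qed
    then show ?case using dh by simp
  qed
  then show ?thesis by (simp add: smooth_on_def)
qed

subsection \<open>Symmetry of the second derivative\<close>

text \<open>The mean value theorem, first in the direction \<open>u\<close> and then in the direction \<open>v\<close>.\<close>

lemma second_difference:
  fixes f :: "'a::euclidean_space \<Rightarrow> real"
  assumes "h > 0" and S: "\<And>s t. 0 \<le> s \<Longrightarrow> s \<le> h \<Longrightarrow> 0 \<le> t \<Longrightarrow> t \<le> h \<Longrightarrow> x + s *\<^sub>R u + t *\<^sub>R v \<in> S"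
    and f: "\<And>y. y \<in> S \<Longrightarrow> f differentiable (at y)"
    and f2: "\<And>y. y \<in> S \<Longrightarrow> (\<lambda>y. D f y u) differentiable (at y)"
  obtains s t where "0 < s" "s < h" "0 < t" "t < h"
    "f (x + h *\<^sub>R u + h *\<^sub>R v) - f (x + h *\<^sub>R u) - f (x + h *\<^sub>R v) + f x
      = h * h * D (\<lambda>y. D f y u) (x + s *\<^sub>R u + t *\<^sub>R v) v"
proof -
  define g where "g s = f (x + s *\<^sub>R u + h *\<^sub>R v) - f (x + s *\<^sub>R u)" for s
  have lin: "((\<lambda>s. x + s *\<^sub>R u + t *\<^sub>R v) has_derivative (\<lambda>r. r *\<^sub>R u)) (at s)"
    "((\<lambda>t. x + s *\<^sub>R u + t *\<^sub>R v) has_derivative (\<lambda>r. r *\<^sub>R v)) (at t)" for s t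
    by (auto intro!: derivative_eq_intros)
  have g: "(g has_derivative (\<lambda>r. r * (D f (x + s *\<^sub>R u + h *\<^sub>R v) u - D f (x + s *\<^sub>R u) u))) (at s)"
    if "0 \<le> s" "s \<le> h" for s
  proof -
    have p: "x + s *\<^sub>R u + h *\<^sub>R v \<in> S" "x + s *\<^sub>R u \<in> S"
      using S[of s h] S[of s 0] that assms(1) by auto
    have "(g has_derivative (\<lambda>r. D f (x + s *\<^sub>R u + h *\<^sub>R v) (r *\<^sub>R u) - D f (x + s *\<^sub>R u) (r *\<^sub>R u))) (at s)"
      unfolding g_def using lin(1)[of h s] lin(1)[of 0 s]
      by (intro has_derivative_diff) (auto intro!: has_derivative_compose[OF _ D_has_derivative[OF f]] p)
    then show ?thesis
      by (simp add: linear_scale[OF D_linear[OF f[OF p(1)]]] linear_scale[OF D_linear[OF f[OF p(2)]]] right_diff_distrib)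
  qed
  obtain s where s: "s \<in> {0<..<h}" "g h - g 0 = (h - 0) * (D f (x + s *\<^sub>R u + h *\<^sub>R v) u - D f (x + s *\<^sub>R u) u)"
    using mvt_simple[OF assms(1), of g "\<lambda>s r. r * (D f (x + s *\<^sub>R u + h *\<^sub>R v) u - D f (x + s *\<^sub>R u) u)"]
      has_derivative_at_withinI[OF g] by auto
  define k where "k t = D f (x + s *\<^sub>R u + t *\<^sub>R v) u" for t
  have k: "(k has_derivative (\<lambda>r. r * D (\<lambda>y. D f y u) (x + s *\<^sub>R u + t *\<^sub>R v) v)) (at t)" if "0 \<le> t" "t \<le> h" for t
  proof -
    have p: "x + s *\<^sub>R u + t *\<^sub>R v \<in> S" using S[of s t] that s by auto
    have "(k has_derivative (\<lambda>r. D (\<lambda>y. D f y u) (x + s *\<^sub>R u + t *\<^sub>R v) (r *\<^sub>R v))) (at t)"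
      unfolding k_def using has_derivative_compose[OF lin(2) D_has_derivative[OF f2[OF p]]] .
    then show ?thesis by (simp add: linear_scale[OF D_linear[OF f2[OF p]]])
  qed
  obtain t where t: "t \<in> {0<..<h}" "k h - k 0 = (h - 0) * D (\<lambda>y. D f y u) (x + s *\<^sub>R u + t *\<^sub>R v) v"
    using mvt_simple[OF assms(1), of k "\<lambda>t r. r * D (\<lambda>y. D f y u) (x + s *\<^sub>R u + t *\<^sub>R v) v"]
      has_derivative_at_withinI[OF k] by auto
  show ?thesis using that[of s t] s t by (auto simp: g_def k_def)
qed

text \<open>The second difference is symmetric in \<open>u\<close> and \<open>v\<close>, so the two mixed derivatives agree at points
  arbitrarily close to \<open>x\<close>.\<close>

lemma D_symmetric_real:
  fixes f :: "'a::euclidean_space \<Rightarrow> real"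
  assumes "open S" "x \<in> S" "Ck_on 2 S f"
  shows "D (\<lambda>y. D f y u) x v = D (\<lambda>y. D f y v) x u"
proof -
  have C: "Ck_on (Suc (Suc 0)) S f" using assms(3) by (simp add: numeral_2_eq_2)
  have f: "f differentiable (at y)" if "y \<in> S" for y using C that by simp
  have f2: "(\<lambda>y. D f y w) differentiable (at y)" if "y \<in> S" for y w using C that by simp
  have f3: "continuous_on S (\<lambda>y. D (\<lambda>y. D f y w) y z)" for w z using C by simp
  let ?F = "\<lambda>y. D (\<lambda>y. D f y u) y v" and ?G = "\<lambda>y. D (\<lambda>y. D f y v) y u"
  have "dist (?F x) (?G x) \<le> 0 + e" if "e > 0" for e
  proof -
    have e2: "e / 2 > 0" using that by simp
    have F: "isCont ?F x" "isCont ?G x"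
      using f3 assms(2) continuous_on_eq_continuous_at[OF assms(1)] by blast+
    obtain d1 where d1: "d1 > 0" "\<And>y. dist y x < d1 \<Longrightarrow> dist (?F y) (?F x) < e / 2"
      using F(1)[unfolded continuous_at_eps_delta, rule_format, OF e2] by blast
    obtain d2 where d2: "d2 > 0" "\<And>y. dist y x < d2 \<Longrightarrow> dist (?G y) (?G x) < e / 2"
      using F(2)[unfolded continuous_at_eps_delta, rule_format, OF e2] by blast
    obtain d3 where d3: "d3 > 0" "ball x d3 \<subseteq> S" using assms openE by blast
    define d where "d = min d1 (min d2 d3)"
    define h where "h = d / (2 * (norm u + norm v + 1))"
    have dpos: "d > 0" using d1 d2 d3 by (simp add: d_def)
    have h: "h > 0" using dpos by (simp add: h_def add_nonneg_pos)
    have near: "dist (x + s *\<^sub>R u + t *\<^sub>R v) x < d" if "0 \<le> s" "s \<le> h" "0 \<le> t" "t \<le> h" for s t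
    proof -
      have "dist (x + s *\<^sub>R u + t *\<^sub>R v) x \<le> s * norm u + t * norm v"
        using norm_triangle_ineq[of "s *\<^sub>R u" "t *\<^sub>R v"] that by (simp add: dist_norm add.assoc)
      also have "\<dots> \<le> h * norm u + h * norm v" using that by (intro add_mono mult_right_mono) auto
      also have "\<dots> < h * (2 * (norm u + norm v + 1))" using h by (simp add: algebra_simps add_nonneg_pos)
      also have "\<dots> = d" by (simp add: h_def) (smt (verit) norm_ge_zero)
      finally show ?thesis .
    qed
    have S: "x + s *\<^sub>R u + t *\<^sub>R v \<in> S" if "0 \<le> s" "s \<le> h" "0 \<le> t" "t \<le> h" for s t
      using near[OF that] d3 by (auto simp: d_def dist_commute subset_eq)
    have S': "x + s *\<^sub>R v + t *\<^sub>R u \<in> S" if "0 \<le> s" "s \<le> h" "0 \<le> t" "t \<le> h" for s t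
      using S[OF that(3,4,1,2)] by (simp add: algebra_simps)
    obtain s t where st: "0 < s" "s < h" "0 < t" "t < h"
      "f (x + h *\<^sub>R u + h *\<^sub>R v) - f (x + h *\<^sub>R u) - f (x + h *\<^sub>R v) + f x = h * h * ?F (x + s *\<^sub>R u + t *\<^sub>R v)"
      by (rule second_difference[of h x u v S f, OF h S f f2]) blast+
    obtain s' t' where st': "0 < s'" "s' < h" "0 < t'" "t' < h"
      "f (x + h *\<^sub>R v + h *\<^sub>R u) - f (x + h *\<^sub>R v) - f (x + h *\<^sub>R u) + f x = h * h * ?G (x + s' *\<^sub>R v + t' *\<^sub>R u)"
      by (rule second_difference[of h x v u S f, OF h S' f f2]) blast+
    have "h * h * ?F (x + s *\<^sub>R u + t *\<^sub>R v) = h * h * ?G (x + s' *\<^sub>R v + t' *\<^sub>R u)"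
      using st(5) st'(5) by (simp add: algebra_simps)
    then have eq: "?F (x + s *\<^sub>R u + t *\<^sub>R v) = ?G (x + s' *\<^sub>R v + t' *\<^sub>R u)" using h by simp
    have "dist (x + s *\<^sub>R u + t *\<^sub>R v) x < d" "dist (x + s' *\<^sub>R v + t' *\<^sub>R u) x < d"
      using near[of s t] near[of t' s'] st st' by (auto simp: algebra_simps)
    then have "dist (?F (x + s *\<^sub>R u + t *\<^sub>R v)) (?F x) < e / 2" "dist (?G (x + s' *\<^sub>R v + t' *\<^sub>R u)) (?G x) < e / 2"
      using d1(2) d2(2) by (auto simp: d_def)
    then show ?thesis unfolding eq dist_real_def by linarith
  qed
  then have "dist (?F x) (?G x) \<le> 0" by (rule field_le_epsilon)
  then show ?thesis by simp
qed

lemma D_symmetric: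
  fixes f :: "'a::euclidean_space \<Rightarrow> 'b::euclidean_space"
  assumes "open S" "x \<in> S" "Ck_on 2 S f"
  shows "D (\<lambda>y. D f y u) x v = D (\<lambda>y. D f y v) x u"
proof (rule euclidean_eqI)
  fix b :: 'b assume "b \<in> Basis"
  have C: "Ck_on (Suc (Suc 0)) S f" using assms(3) by (simp add: numeral_2_eq_2)
  have f: "f differentiable (at y)" if "y \<in> S" for y using C that by simp
  have f2: "(\<lambda>y. D f y w) differentiable (at y)" if "y \<in> S" for y w using C that by simp
  have *: "D (\<lambda>y. D f y w) x z \<bullet> b = D (\<lambda>y. D (\<lambda>y. f y \<bullet> b) y w) x z" for w z
  proof -
    have "D (\<lambda>y. D (\<lambda>y. f y \<bullet> b) y w) x z = D (\<lambda>y. D f y w \<bullet> b) x z"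
      by (rule D_cong[OF assms(1,2), THEN fun_cong])
        (simp add: D_bounded_linear[OF bounded_linear_inner_left f])
    also have "\<dots> = D (\<lambda>y. D f y w) x z \<bullet> b"
      by (rule D_bounded_linear[OF bounded_linear_inner_left f2[OF assms(2)]])
    finally show ?thesis by simp
  qed
  show "D (\<lambda>y. D f y u) x v \<bullet> b = D (\<lambda>y. D f y v) x u \<bullet> b"
    unfolding * by (rule D_symmetric_real[OF assms(1,2)])
      (rule Ck_on_bounded_linear[OF assms(1) bounded_linear_inner_left assms(3)])
qed

subsection \<open>Smooth maps\<close>

lemma smooth_on_cong: "open S \<Longrightarrow> (\<And>x. x \<in> S \<Longrightarrow> f x = g x) \<Longrightarrow> smooth_on S f \<longleftrightarrow> smooth_on S g"
  unfolding smooth_on_def using Ck_on_cong by blast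

lemma smooth_on_subset: "smooth_on S f \<Longrightarrow> T \<subseteq> S \<Longrightarrow> smooth_on T f"
  unfolding smooth_on_def using Ck_on_subset by blast

lemma smooth_on_local: "(\<And>x. x \<in> S \<Longrightarrow> \<exists>U. open U \<and> x \<in> U \<and> smooth_on U f) \<Longrightarrow> smooth_on S f"
  unfolding smooth_on_def using Ck_on_local by metis

lemma smooth_on_const: "smooth_on S (\<lambda>x. c)"
  unfolding smooth_on_def using Ck_on_const by blast

lemma smooth_on_linear: "bounded_linear f \<Longrightarrow> smooth_on S f"
  unfolding smooth_on_def using Ck_on_linear by blast

lemma smooth_on_bounded_linear: "open S \<Longrightarrow> bounded_linear L \<Longrightarrow> smooth_on S f \<Longrightarrow> smooth_on S (\<lambda>x. L (f x))"
  unfolding smooth_on_def using Ck_on_bounded_linear by blast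

lemma smooth_on_add: "open S \<Longrightarrow> smooth_on S f \<Longrightarrow> smooth_on S g \<Longrightarrow> smooth_on S (\<lambda>x. f x + g x)"
  unfolding smooth_on_def using Ck_on_add by blast

lemma smooth_on_bilinear:
  "open S \<Longrightarrow> bounded_bilinear p \<Longrightarrow> smooth_on S f \<Longrightarrow> smooth_on S g \<Longrightarrow> smooth_on S (\<lambda>x. p (f x) (g x))"
  unfolding smooth_on_def using Ck_on_bilinear by blast

lemma smooth_on_compose:
  "open S \<Longrightarrow> open T \<Longrightarrow> f ` S \<subseteq> T \<Longrightarrow> smooth_on S f \<Longrightarrow> smooth_on T g \<Longrightarrow> smooth_on S (\<lambda>x. g (f x))"
  unfolding smooth_on_def using Ck_on_compose by blast

lemma smooth_on_inverse: "smooth_on (- {0}) (inverse :: real \<Rightarrow> real)"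
  unfolding smooth_on_def using Ck_on_inverse by blast

lemma smooth_on_sqrt: "smooth_on {0<..} sqrt"
  unfolding smooth_on_def using Ck_on_sqrt by blast

lemma smooth_on_components:
  fixes f :: "'a::euclidean_space \<Rightarrow> 'b::euclidean_space"
  shows "open S \<Longrightarrow> (\<And>b. b \<in> Basis \<Longrightarrow> smooth_on S (\<lambda>x. f x \<bullet> b)) \<Longrightarrow> smooth_on S f"
  unfolding smooth_on_def using Ck_on_components by blast

lemma smooth_on_D: "smooth_on S f \<Longrightarrow> smooth_on S (\<lambda>x. D f x v)"
  unfolding smooth_on_def by (metis Ck_on.simps(2))

lemma smooth_on_differentiable: "smooth_on S f \<Longrightarrow> x \<in> S \<Longrightarrow> f differentiable (at x)"
  unfolding smooth_on_def by (metis Ck_on.simps(2))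

lemma smooth_on_continuous: "smooth_on S f \<Longrightarrow> continuous_on S f"
  unfolding smooth_on_def by (metis Ck_on.simps(1))

lemma smooth_on_D_symmetric:
  "open S \<Longrightarrow> smooth_on S f \<Longrightarrow> x \<in> S \<Longrightarrow> D (\<lambda>y. D f y u) x v = D (\<lambda>y. D f y v) x u"
  unfolding smooth_on_def using D_symmetric by blast

section \<open>Maps into SU(3)\<close>

subsection \<open>Matrices\<close>

lemma mm_nth: "((A::mat3) ** B) $ i $ j = A$i$1 * B$1$j + A$i$2 * B$2$j + A$i$3 * B$3$j"
  by (simp add: matrix_matrix_mult_def sum_3)

lemma mv_nth: "((A::mat3) *v x) $ i = A$i$1 * x$1 + A$i$2 * x$2 + A$i$3 * x$3"
  by (simp add: matrix_vector_mult_def sum_3)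

lemma ct_nth [simp]: "conj_transpose A $ i $ j = cnj (A $ j $ i)"
  by (simp add: conj_transpose_def)

lemma mat1_nth: "(mat 1 :: mat3) $ i $ j = (if i = j then 1 else 0)"
  by (simp add: mat_def)

lemma mat3_eq_iff: "(A::mat3) = B \<longleftrightarrow> (\<forall>i j. A $ i $ j = B $ i $ j)"
  by (simp add: vec_eq_iff)

lemma ct_mult: "conj_transpose (A ** B) = conj_transpose B ** conj_transpose A"
  by (simp add: mat3_eq_iff mm_nth mult.commute)

lemma ct_ct [simp]: "conj_transpose (conj_transpose A) = A"
  by (simp add: mat3_eq_iff)

lemma ct_mat1 [simp]: "conj_transpose (mat 1) = mat 1"
  by (simp add: mat3_eq_iff mat1_nth)

lemma bounded_bilinear_mm: "bounded_bilinear ((**) :: mat3 \<Rightarrow> mat3 \<Rightarrow> mat3)"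
  unfolding bilinear_conv_bounded_bilinear[symmetric] bilinear_def
  by (auto intro!: linearI simp: mat3_eq_iff mm_nth algebra_simps)

lemma bounded_bilinear_mv: "bounded_bilinear ((*v) :: mat3 \<Rightarrow> complex^3 \<Rightarrow> complex^3)"
  unfolding bilinear_conv_bounded_bilinear[symmetric] bilinear_def
  by (auto intro!: linearI simp: vec_eq_iff mv_nth algebra_simps)

lemma bounded_linear_ct: "bounded_linear conj_transpose"
  unfolding linear_conv_bounded_linear[symmetric]
  by (auto intro!: linearI simp: mat3_eq_iff)

lemma bounded_linear_entry: "bounded_linear (\<lambda>A::mat3. A $ i $ j)"
  using bounded_linear_compose[OF bounded_linear_vec_nth bounded_linear_vec_nth] .

lemmas mm_minus = bounded_bilinear.minus_left[OF bounded_bilinear_mm]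
  bounded_bilinear.minus_right[OF bounded_bilinear_mm]
lemmas mm_add = bounded_bilinear.add_left[OF bounded_bilinear_mm]
  bounded_bilinear.add_right[OF bounded_bilinear_mm]
lemmas mm_diff = bounded_bilinear.diff_left[OF bounded_bilinear_mm]
  bounded_bilinear.diff_right[OF bounded_bilinear_mm]
lemmas mm_zero = bounded_bilinear.zero_left[OF bounded_bilinear_mm]
  bounded_bilinear.zero_right[OF bounded_bilinear_mm]

lemma SU3_1: "mat 1 \<in> SU3"
  by (simp add: SU3_def)

lemma SU3_left: "A \<in> SU3 \<Longrightarrow> conj_transpose A ** A = mat 1"
  by (simp add: SU3_def)

lemma SU3_right: "A \<in> SU3 \<Longrightarrow> A ** conj_transpose A = mat 1"
  using SU3_left matrix_left_right_inverse by blast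

lemma SU3_mult: "A \<in> SU3 \<Longrightarrow> B \<in> SU3 \<Longrightarrow> A ** B \<in> SU3"
  by (simp add: SU3_def ct_mult det_mul)
    (metis matrix_mul_assoc matrix_mul_lid)

lemma det_ct: "det (conj_transpose A) = cnj (det A)"
  by (simp add: det_3)

lemma SU3_ct: "A \<in> SU3 \<Longrightarrow> conj_transpose A \<in> SU3"
  using SU3_right[of A] by (simp add: SU3_def det_ct)

lemma SU3_cancel:
  assumes "A \<in> SU3"
  shows "conj_transpose A ** (A ** X) = X" "A ** (conj_transpose A ** X) = X"
    "X ** A ** conj_transpose A = X" "X ** conj_transpose A ** A = X"
  using SU3_left[OF assms] SU3_right[OF assms] by (metis matrix_mul_assoc matrix_mul_lid matrix_mul_rid)+

subsection \<open>Coordinates on su(3)\<close>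

text \<open>An element of \<open>\<mm>\<close> is determined by three complex entries. Taking them in cyclic order makes the
  complex structure \<open>J\<close> the multiplication by \<open>\<i>\<close>, the form \<open>\<omega>\<^sub>J\<close> the form \<open>kaehler\<close>, and the \<open>\<mm>\<close>-part of
  the bracket the conjugate \<open>ccross\<close> of the complex cross product.\<close>

definition coords :: "mat3 \<Rightarrow> complex^3" where
  "coords X = vector [X$2$1, X$3$2, X$1$3]"

text \<open>The action of the diagonal part of \<open>X\<close> on \<open>\<mm>\<close> by the bracket is the componentwise product
  with this vector.\<close>

definition weights :: "mat3 \<Rightarrow> complex^3" where
  "weights X = vector [X$2$2 - X$1$1, X$3$3 - X$2$2, X$1$1 - X$3$3]"

definition skew :: "mat3 \<Rightarrow> bool" where
  "skew X \<longleftrightarrow> conj_transpose X = - X"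

definition ccross :: "complex^3 \<Rightarrow> complex^3 \<Rightarrow> complex^3" where
  "ccross X Y = vector [cnj (X$2 * Y$3 - X$3 * Y$2), cnj (X$3 * Y$1 - X$1 * Y$3), cnj (X$1 * Y$2 - X$2 * Y$1)]"

definition kaehler :: "complex^3 \<Rightarrow> complex^3 \<Rightarrow> real" where
  "kaehler X Y = Im (cnj (X$1) * Y$1) + Im (cnj (X$2) * Y$2) + Im (cnj (X$3) * Y$3)"

lemma c3_eq_iff: "(X::complex^3) = Y \<longleftrightarrow> X$1 = Y$1 \<and> X$2 = Y$2 \<and> X$3 = Y$3"
  by (simp add: vec_eq_iff forall_3)

lemma coords_nth [simp]: "coords X $ 1 = X$2$1" "coords X $ 2 = X$3$2" "coords X $ 3 = X$1$3"
  by (simp_all add: coords_def)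

lemma weights_nth [simp]: "weights X $ 1 = X$2$2 - X$1$1" "weights X $ 2 = X$3$3 - X$2$2"
  "weights X $ 3 = X$1$1 - X$3$3"
  by (simp_all add: weights_def)

lemma ccross_nth [simp]: "ccross X Y $ 1 = cnj (X$2 * Y$3 - X$3 * Y$2)"
  "ccross X Y $ 2 = cnj (X$3 * Y$1 - X$1 * Y$3)" "ccross X Y $ 3 = cnj (X$1 * Y$2 - X$2 * Y$1)"
  by (simp_all add: ccross_def)

lemma inner_c3: "(X::complex^3) \<bullet> Y = Re (cnj (X$1) * Y$1) + Re (cnj (X$2) * Y$2) + Re (cnj (X$3) * Y$3)"
  by (simp add: inner_vec_def sum_3 inner_complex_def)

lemma bounded_linear_coords: "bounded_linear coords"
  unfolding linear_conv_bounded_linear[symmetric] by (auto intro!: linearI simp: c3_eq_iff)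

lemma bounded_linear_weights: "bounded_linear weights"
  unfolding linear_conv_bounded_linear[symmetric]
  by (auto intro!: linearI simp: c3_eq_iff algebra_simps)

lemma bounded_bilinear_kaehler: "bounded_bilinear kaehler"
  unfolding bilinear_conv_bounded_bilinear[symmetric] bilinear_def
  by (auto intro!: linearI simp: kaehler_def algebra_simps)

lemma bounded_bilinear_vmult: "bounded_bilinear ((*) :: complex^3 \<Rightarrow> complex^3 \<Rightarrow> complex^3)"
  unfolding bilinear_conv_bounded_bilinear[symmetric] bilinear_def
  by (auto intro!: linearI simp: c3_eq_iff algebra_simps)

lemma kaehler_sym: "kaehler Y X = - kaehler X Y"
  by (simp add: kaehler_def)

lemma kaehler_inner: "kaehler X Y = (\<chi> i. \<i> * X $ i) \<bullet> Y"
  by (simp add: kaehler_def inner_c3)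

lemma skew_nth:
  assumes "skew X"
  shows "X$1$2 = - cnj (X$2$1)" "X$2$3 = - cnj (X$3$2)" "X$3$1 = - cnj (X$1$3)"
    "Re (X$1$1) = 0" "Re (X$2$2) = 0" "Re (X$3$3) = 0"
proof -
  have *: "cnj (X$j$i) = - X$i$j" for i j
    using assms unfolding skew_def mat3_eq_iff by (metis ct_nth vector_uminus_component)
  show "X$1$2 = - cnj (X$2$1)" "X$2$3 = - cnj (X$3$2)" "X$3$1 = - cnj (X$1$3)"
    by (simp_all add: *)
  show "Re (X$1$1) = 0" "Re (X$2$2) = 0" "Re (X$3$3) = 0"
    using *[of 1 1] *[of 2 2] *[of 3 3] by (simp_all add: complex_eq_iff)
qed

lemma Re_weights: "skew X \<Longrightarrow> Re (weights X $ i) = 0"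
  using skew_nth[of X] exhaust_3[of i] by auto

lemma coords_bracket:
  assumes "skew X" "skew Y"
  shows "coords (X ** Y - Y ** X) = ccross (coords X) (coords Y) + weights X * coords Y - weights Y * coords X"
  using skew_nth(1-3)[OF assms(1)] skew_nth(1-3)[OF assms(2)]
  by (simp add: c3_eq_iff mm_nth algebra_simps)

text \<open>If \<open>w\<^sub>i\<close> is the imaginary part of \<open>cnj (coords X $ i) * coords Y $ i\<close>, the diagonal of the bracket is
  \<open>2 \<i> (w\<^sub>3 - w\<^sub>1, w\<^sub>1 - w\<^sub>2, w\<^sub>2 - w\<^sub>3)\<close>; its differences collapse because \<open>w\<^sub>1 + w\<^sub>2 + w\<^sub>3 = 0\<close>.\<close>

lemma weights_bracket:
  assumes "skew X" "skew Y" "kaehler (coords X) (coords Y) = 0"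
  shows "weights (X ** Y - Y ** X) $ i = 6 * \<i> * Im (cnj (coords X $ i) * coords Y $ i)"
proof -
  have "weights (X ** Y - Y ** X) $ 1 = 6 * \<i> * Im (cnj (coords X $ 1) * coords Y $ 1)
    \<and> weights (X ** Y - Y ** X) $ 2 = 6 * \<i> * Im (cnj (coords X $ 2) * coords Y $ 2)
    \<and> weights (X ** Y - Y ** X) $ 3 = 6 * \<i> * Im (cnj (coords X $ 3) * coords Y $ 3)"
    using skew_nth(1-3)[OF assms(1)] skew_nth(1-3)[OF assms(2)] assms(3)
    by (simp add: complex_eq_iff mm_nth kaehler_def algebra_simps)
  then show ?thesis using exhaust_3[of i] by auto
qed

lemma dual_skew:
  assumes "skew X"
  shows "dual m1 X = Re (X$2$1)" "dual m4 X = Im (X$2$1)"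
    "dual m2 X = Re (X$3$2)" "dual m5 X = Im (X$3$2)"
    "dual m3 X = - Re (X$1$3)" "dual m6 X = Im (X$1$3)"
  using skew_nth(1-3)[OF assms] by (simp_all add: dual_def inner_mat3 basis_defs inner_complex_def)

lemma sum_m: "(\<Sum>b\<in>{m1, m2, m3, m4, m5, m6}. f b) = f m1 + f m2 + f m3 + f m4 + f m5 + (f m6 :: 'a::comm_monoid_add)"
  using distinct_m by (simp add: add.assoc)

lemma dual_linear: "linear (dual b)"
  by (auto intro!: linearI simp: dual_def inner_add_right add_divide_distrib)

lemma dual_m_proj: "b \<in> {m1, m2, m3, m4, m5, m6} \<Longrightarrow> dual b (m_proj X) = dual b X"
  unfolding m_proj_def sum_m
  by (auto simp: linear_add[OF dual_linear] linear_scale[OF dual_linear] dual_m)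

lemma g_m_m_proj: "skew X \<Longrightarrow> skew Y \<Longrightarrow> g_m (m_proj X) (m_proj Y) = coords X \<bullet> coords Y"
  unfolding g_m_def sum_m by (simp add: dual_m_proj dual_skew inner_c3)

lemma \<omega>_m_m_proj: "skew X \<Longrightarrow> skew Y \<Longrightarrow> \<omega>_m (m_proj X) (m_proj Y) = kaehler (coords X) (coords Y)"
  unfolding \<omega>_m_def wedge_def by (simp add: dual_m_proj dual_skew kaehler_def algebra_simps)

lemma m_proj_eq_0_iff: "skew X \<Longrightarrow> m_proj X = 0 \<longleftrightarrow> coords X = 0"
proof
  assume X: "skew X" and "m_proj X = 0"
  then have "coords X \<bullet> coords X = 0"
    using g_m_m_proj[OF X X] by (simp add: g_m_def linear_0[OF dual_linear])
  then show "coords X = 0" by simp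
next
  assume X: "skew X" and "coords X = 0"
  then have "X$2$1 = 0" "X$3$2 = 0" "X$1$3 = 0" by (simp_all add: c3_eq_iff)
  then show "m_proj X = 0"
    unfolding m_proj_def sum_m using X by (simp add: dual_skew)
qed

lemma linear_m_proj: "linear m_proj"
  unfolding m_proj_def sum_m
  by (auto intro!: linearI simp: linear_add[OF dual_linear] linear_scale[OF dual_linear] algebra_simps)

lemma weights_skew_inner:
  assumes "\<And>i. Re (h $ i) = 0"
  shows "(h * X) \<bullet> Y + X \<bullet> (h * Y) = 0" "kaehler (h * X) Y + kaehler X (h * Y) = 0"
proof -
  have c: "z = \<i> * of_real (Im z)" if "Re z = 0" for z using that by (simp add: complex_eq_iff)
  obtain a b c where h: "h$1 = \<i> * of_real a" "h$2 = \<i> * of_real b" "h$3 = \<i> * of_real c"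
    using that[OF c[OF assms[of 1]] c[OF assms[of 2]] c[OF assms[of 3]]] .
  show "(h * X) \<bullet> Y + X \<bullet> (h * Y) = 0" "kaehler (h * X) Y + kaehler X (h * Y) = 0"
    unfolding inner_c3 kaehler_def vector_mult_component h by (simp_all add: algebra_simps)
qed

lemma unit_mult_inner:
  assumes "\<And>i. norm (t $ i) = 1"
  shows "(t * X) \<bullet> (t * Y) = X \<bullet> Y" "kaehler (t * X) (t * Y) = kaehler X Y"
proof -
  have *: "cnj (t$i * x) * (t$i * y) = cnj x * y" for i x y
  proof -
    have "cnj (t$i) * t$i = 1" using complex_norm_square[of "t$i"] assms[of i] by (metis mult.commute of_real_1 one_power2)
    then have "(cnj (t$i) * t$i) * (cnj x * y) = cnj x * y" by simp
    then show ?thesis by (simp add: mult_ac)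
  qed
  show "(t * X) \<bullet> (t * Y) = X \<bullet> Y" "kaehler (t * X) (t * Y) = kaehler X Y"
    unfolding inner_c3 kaehler_def vector_mult_component * by simp_all
qed

subsection \<open>The Maurer-Cartan form\<close>

text \<open>Second derivatives are needed of the lifts one starts with, but the lifts obtained from them by
  torus-valued functions are used only through their first derivatives.\<close>

definition SU3_map :: "'a::euclidean_space set \<Rightarrow> ('a \<Rightarrow> mat3) \<Rightarrow> bool" where
  "SU3_map W A \<longleftrightarrow> open W \<and> smooth_on W A \<and> (\<forall>y\<in>W. A y \<in> SU3)"

definition mc :: "('a::euclidean_space \<Rightarrow> mat3) \<Rightarrow> 'a \<Rightarrow> 'a \<Rightarrow> mat3" where
  "mc A x u = conj_transpose (A x) ** D A x u"

text \<open>The differential of the map \<open>x \<mapsto> A x \<cdot> f_st\<close>, in the frame of the tangent space that is the translate by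
  \<open>A x\<close> of the frame of \<open>\<mm>\<close>.\<close>

definition xi :: "('a::euclidean_space \<Rightarrow> mat3) \<Rightarrow> 'a \<Rightarrow> 'a \<Rightarrow> complex^3" where
  "xi A x u = coords (mc A x u)"

definition SU3_diff :: "'a::euclidean_space set \<Rightarrow> ('a \<Rightarrow> mat3) \<Rightarrow> bool" where
  "SU3_diff W A \<longleftrightarrow> open W \<and> (\<forall>y\<in>W. A differentiable (at y) \<and> A y \<in> SU3)"

lemma SU3_diff_D:
  assumes "SU3_diff W A"
  shows "open W" "y \<in> W \<Longrightarrow> A y \<in> SU3" "y \<in> W \<Longrightarrow> A differentiable (at y)"
  using assms unfolding SU3_diff_def by blast+

lemma SU3_diff_subset: "SU3_diff W A \<Longrightarrow> open V \<Longrightarrow> V \<subseteq> W \<Longrightarrow> SU3_diff V A"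
  unfolding SU3_diff_def by blast

lemma SU3_diffI: "SU3_map W A \<Longrightarrow> SU3_diff W A"
  unfolding SU3_diff_def SU3_map_def using smooth_on_differentiable by blast

lemma SU3_map_D:
  assumes "SU3_map W A"
  shows "open W" "smooth_on W A" "y \<in> W \<Longrightarrow> A y \<in> SU3" "y \<in> W \<Longrightarrow> A differentiable (at y)"
    "y \<in> W \<Longrightarrow> (\<lambda>x. D A x v) differentiable (at y)"
  using assms smooth_on_differentiable smooth_on_D unfolding SU3_map_def by blast+

lemma SU3_map_subset: "SU3_map W A \<Longrightarrow> open V \<Longrightarrow> V \<subseteq> W \<Longrightarrow> SU3_map V A"
  unfolding SU3_map_def using smooth_on_subset by blast

lemma D_mc:
  assumes "SU3_diff W A" "x \<in> W"
  shows "D A x u = A x ** mc A x u"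
  unfolding mc_def by (simp add: SU3_cancel[OF SU3_diff_D(2)[OF assms]])

lemma linear_mc:
  assumes "SU3_diff W A" "x \<in> W"
  shows "linear (mc A x)"
  unfolding mc_def
  using linear_compose[OF D_linear[OF SU3_diff_D(3)[OF assms]]
      bounded_linear.linear[OF bounded_bilinear.bounded_linear_right[OF bounded_bilinear_mm]]]
  by (simp add: o_def)

lemma linear_xi:
  assumes "SU3_diff W A" "x \<in> W"
  shows "linear (xi A x)"
  unfolding xi_def using linear_compose[OF linear_mc[OF assms] bounded_linear.linear[OF bounded_linear_coords]]
  by (simp add: o_def)

lemma skew_mc:
  assumes "SU3_diff W A" "x \<in> W"
  shows "skew (mc A x u)"
proof -
  note d = SU3_diff_D(3)[OF assms]
  have dc: "(\<lambda>y. conj_transpose (A y)) differentiable (at x)"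
    by (rule differentiable_bounded_linear[OF bounded_linear_ct d])
  have "D (\<lambda>y. conj_transpose (A y) ** A y) x u = D (\<lambda>y. mat 1) x u"
    using D_cong[OF SU3_diff_D(1)[OF assms(1)] assms(2), of "\<lambda>y. conj_transpose (A y) ** A y" "\<lambda>y. mat 1"]
      SU3_left SU3_diff_D(2)[OF assms(1)] by simp
  then have "conj_transpose (A x) ** D A x u + conj_transpose (D A x u) ** A x = 0"
    by (simp add: D_bilinear[OF bounded_bilinear_mm dc d] D_bounded_linear[OF bounded_linear_ct d])
  then have "conj_transpose (D A x u) ** A x = - (conj_transpose (A x) ** D A x u)"
    by (simp add: eq_neg_iff_add_eq_0 add.commute)
  then show ?thesis unfolding skew_def mc_def by (simp add: ct_mult)
qed

text \<open>The Jacobi formula: the derivative of \<open>det\<close> at the identity is the trace.\<close>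

lemma trace_mc:
  assumes "SU3_diff W A" "x \<in> W"
  shows "mc A x u $ 1 $ 1 + mc A x u $ 2 $ 2 + mc A x u $ 3 $ 3 = 0"
proof -
  define M where "M y = conj_transpose (A x) ** A y" for y
  note d = SU3_diff_D(3)[OF assms]
  have dM: "(M has_derivative mc A x) (at x)"
    unfolding M_def mc_def
    using bounded_linear.has_derivative[OF bounded_bilinear.bounded_linear_right[OF bounded_bilinear_mm]
        D_has_derivative[OF d]] .
  have M1: "M x = mat 1" unfolding M_def using SU3_left SU3_diff_D(2)[OF assms] by blast
  have e: "((\<lambda>y. M y $ i $ j) has_derivative (\<lambda>u. mc A x u $ i $ j)) (at x)" for i j
    using bounded_linear.has_derivative[OF bounded_linear_entry dM] .
  have "((\<lambda>y. det (M y)) has_derivative (\<lambda>u. mc A x u $ 1 $ 1 + mc A x u $ 2 $ 2 + mc A x u $ 3 $ 3)) (at x)"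
    unfolding det_3
    by (rule derivative_eq_intros e | simp add: M1 mat1_nth)+ (simp add: fun_eq_iff)
  moreover have "((\<lambda>y. det (M y)) has_derivative (\<lambda>u. 0)) (at x)"
  proof (rule has_derivative_transform_within_open[OF has_derivative_const SU3_diff_D(1)[OF assms(1)] assms(2)])
    show "1 = det (M y)" if "y \<in> W" for y
    proof -
      have "M y \<in> SU3" unfolding M_def
        by (rule SU3_mult[OF SU3_ct[OF SU3_diff_D(2)[OF assms]] SU3_diff_D(2)[OF assms(1) that]])
      then show ?thesis unfolding SU3_def by simp
    qed
  qed
  ultimately have "(\<lambda>u. mc A x u $ 1 $ 1 + mc A x u $ 2 $ 2 + mc A x u $ 3 $ 3) = (\<lambda>u. 0)"
    by (rule has_derivative_unique)
  then show ?thesis by (rule fun_cong)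
qed

lemma D_D_mc:
  assumes "SU3_map W A" "x \<in> W"
  shows "D (\<lambda>y. mc A y v) x u = conj_transpose (D A x u) ** D A x v + conj_transpose (A x) ** D (\<lambda>y. D A y v) x u"
    "(\<lambda>y. mc A y v) differentiable (at x)"
proof -
  note d = SU3_map_D(4,5)[OF assms]
  have dc: "(\<lambda>y. conj_transpose (A y)) differentiable (at x)"
    by (rule differentiable_bounded_linear[OF bounded_linear_ct d(1)])
  show "D (\<lambda>y. mc A y v) x u = conj_transpose (D A x u) ** D A x v + conj_transpose (A x) ** D (\<lambda>y. D A y v) x u"
    unfolding mc_def by (simp add: D_bilinear[OF bounded_bilinear_mm dc d(2)] D_bounded_linear[OF bounded_linear_ct d(1)])
  show "(\<lambda>y. mc A y v) differentiable (at x)"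
    unfolding mc_def by (rule differentiable_bilinear[OF bounded_bilinear_mm dc d(2)])
qed

text \<open>The second derivatives of \<open>A\<close> cancel, and what remains comes from differentiating \<open>A\<^sup>-\<^sup>1\<close>.\<close>

lemma maurer_cartan:
  assumes "SU3_map W A" "x \<in> W"
  shows "D (\<lambda>y. mc A y v) x u - D (\<lambda>y. mc A y u) x v = - (mc A x u ** mc A x v - mc A x v ** mc A x u)"
proof -
  have *: "conj_transpose (D A x u) ** D A x v = - (mc A x u ** mc A x v)" for u v
  proof -
    have "conj_transpose (D A x u) ** D A x v = conj_transpose (mc A x u) ** mc A x v"
      by (simp add: D_mc[OF SU3_diffI[OF assms(1)] assms(2)] ct_mult SU3_cancel[OF SU3_map_D(3)[OF assms]]
          flip: matrix_mul_assoc)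
    then show ?thesis using skew_mc[OF SU3_diffI[OF assms(1)] assms(2), of u] by (simp add: skew_def mm_minus)
  qed
  have "D (\<lambda>y. D A y v) x u = D (\<lambda>y. D A y u) x v"
    using smooth_on_D_symmetric SU3_map_D(1,2)[OF assms(1)] assms(2) by blast
  then show ?thesis by (simp add: D_D_mc(1)[OF assms] *)
qed

text \<open>The canonical connection of the reductive homogeneous space, in the frame given by \<open>A\<close>: the
  derivative of the vector field \<open>xi A x v\<close> in the direction \<open>u\<close>.\<close>

definition canon :: "('a::euclidean_space \<Rightarrow> mat3) \<Rightarrow> 'a \<Rightarrow> 'a \<Rightarrow> 'a \<Rightarrow> complex^3" where
  "canon A x u v = D (\<lambda>y. xi A y v) x u + weights (mc A x u) * xi A x v"

lemma xi_differentiable: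
  assumes "SU3_map W A" "x \<in> W"
  shows "(\<lambda>y. xi A y v) differentiable (at x)" "D (\<lambda>y. xi A y v) x u = coords (D (\<lambda>y. mc A y v) x u)"
  unfolding xi_def using D_D_mc(2)[OF assms]
  by (simp_all add: differentiable_bounded_linear[OF bounded_linear_coords] D_bounded_linear[OF bounded_linear_coords])

text \<open>The \<open>\<mm>\<close>-part of the Maurer-Cartan equation; the brackets of \<open>\<hh>\<close> with \<open>\<mm>\<close> are absorbed by the connection.\<close>

lemma canon_torsion:
  assumes "SU3_map W A" "x \<in> W"
  shows "canon A x u v - canon A x v u = - ccross (xi A x u) (xi A x v)"
proof -
  have "D (\<lambda>y. xi A y v) x u - D (\<lambda>y. xi A y u) x v
      = coords (D (\<lambda>y. mc A y v) x u - D (\<lambda>y. mc A y u) x v)"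
    using linear_diff[OF bounded_linear.linear[OF bounded_linear_coords]]
    by (simp add: xi_differentiable(2)[OF assms])
  also have "\<dots> = - coords (mc A x u ** mc A x v - mc A x v ** mc A x u)"
    unfolding maurer_cartan[OF assms] using linear_neg[OF bounded_linear.linear[OF bounded_linear_coords]] by blast
  finally show ?thesis
    by (simp add: canon_def coords_bracket[OF skew_mc[OF SU3_diffI[OF assms(1)] assms(2)] skew_mc[OF SU3_diffI[OF assms(1)] assms(2)]] xi_def algebra_simps)
qed

text \<open>The connection form takes values in \<open>\<hh>\<close>, which acts by skew endomorphisms for both forms.\<close>

lemma canon_metric:
  assumes "SU3_map W A" "x \<in> W"
  shows "D (\<lambda>y. xi A y v \<bullet> xi A y w) x u = canon A x u v \<bullet> xi A x w + xi A x v \<bullet> canon A x u w"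
    "D (\<lambda>y. kaehler (xi A y v) (xi A y w)) x u = kaehler (canon A x u v) (xi A x w) + kaehler (xi A x v) (canon A x u w)"
  using weights_skew_inner[OF Re_weights[OF skew_mc[OF SU3_diffI[OF assms(1)] assms(2)]], of u "xi A x v" "xi A x w"]
    xi_differentiable(1)[OF assms]
  by (simp_all add: canon_def D_bilinear[OF bounded_bilinear_inner] D_bilinear[OF bounded_bilinear_kaehler]
      inner_add_left inner_add_right bounded_bilinear.add_left[OF bounded_bilinear_kaehler]
      bounded_bilinear.add_right[OF bounded_bilinear_kaehler])

lemma smooth_on_xi:
  assumes "SU3_map W A"
  shows "smooth_on W (\<lambda>y. mc A y v)" "smooth_on W (\<lambda>y. xi A y v)" "smooth_on W (\<lambda>y. weights (mc A y v))"
    "smooth_on W (\<lambda>y. canon A y u v)"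
proof -
  note o = SU3_map_D(1)[OF assms] and s = SU3_map_D(2)[OF assms]
  show m: "smooth_on W (\<lambda>y. mc A y v)" for v
    unfolding mc_def
    by (rule smooth_on_bilinear[OF o bounded_bilinear_mm smooth_on_bounded_linear[OF o bounded_linear_ct s] smooth_on_D[OF s]])
  show x: "smooth_on W (\<lambda>y. xi A y v)" for v
    unfolding xi_def by (rule smooth_on_bounded_linear[OF o bounded_linear_coords m])
  show w: "smooth_on W (\<lambda>y. weights (mc A y v))" for v
    by (rule smooth_on_bounded_linear[OF o bounded_linear_weights m])
  show "smooth_on W (\<lambda>y. canon A y u v)"
    unfolding canon_def
    by (rule smooth_on_add[OF o smooth_on_D[OF x] smooth_on_bilinear[OF o bounded_bilinear_vmult w x]])
qed

subsection \<open>Change of lift\<close>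

definition torus :: "mat3 set" where
  "torus = {T \<in> SU3. \<forall>i j. i \<noteq> j \<longrightarrow> T $ i $ j = 0}"

text \<open>The adjoint action of \<open>T\<^sup>-\<^sup>1\<close> on \<open>\<mm>\<close> multiplies the coordinates by these phases.\<close>

definition twist :: "mat3 \<Rightarrow> complex^3" where
  "twist T = vector [cnj (T$2$2) * T$1$1, cnj (T$3$3) * T$2$2, cnj (T$1$1) * T$3$3]"

lemma twist_nth [simp]: "twist T $ 1 = cnj (T$2$2) * T$1$1" "twist T $ 2 = cnj (T$3$3) * T$2$2"
  "twist T $ 3 = cnj (T$1$1) * T$3$3"
  by (simp_all add: twist_def)

lemma torus_norm:
  assumes "T \<in> torus"
  shows "norm (T $ i $ i) = 1"
proof -
  have o: "T $ a $ b = 0" if "a \<noteq> b" for a b using assms that by (simp add: torus_def)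
  have "(conj_transpose T ** T) $ i $ i = 1" using assms SU3_left[of T] by (simp add: torus_def mat1_nth)
  then have "cnj (T$i$i) * T$i$i = 1"
    using exhaust_3[of i] o by (auto simp: mm_nth)
  then have "(norm (T$i$i))^2 = 1" by (metis complex_norm_square mult.commute of_real_eq_1_iff)
  then show ?thesis by (simp add: power2_eq_1_iff) (smt (verit) norm_ge_zero)
qed

lemma twist_norm: "T \<in> torus \<Longrightarrow> norm (twist T $ i) = 1"
  using exhaust_3[of i] torus_norm[of T] by (auto simp: norm_mult)

text \<open>The derivative of the torus factor is diagonal, so it does not contribute to the coframe.\<close>

lemma xi_change:
  assumes A: "SU3_diff W A" and x: "x \<in> W" and T: "\<And>y. y \<in> W \<Longrightarrow> T y \<in> torus"
    and dT: "T differentiable (at x)"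
  shows "xi (\<lambda>y. A y ** T y) x u = twist (T x) * xi A x u"
    "weights (mc (\<lambda>y. A y ** T y) x u) = weights (mc A x u) + weights (conj_transpose (T x) ** D T x u)"
proof -
  have off: "T y $ i $ j = 0" if "y \<in> W" "i \<noteq> j" for y i j using T that by (simp add: torus_def)
  have offD: "D T x u $ i $ j = 0" if "i \<noteq> j" for i j
  proof -
    have "D (\<lambda>y. T y $ i $ j) x u = D (\<lambda>y. 0) x u"
      using D_cong[OF SU3_diff_D(1)[OF A] x, of "\<lambda>y. T y $ i $ j" "\<lambda>y. 0"] off that by simp
    then show ?thesis by (simp add: D_bounded_linear[OF bounded_linear_entry dT])
  qed
  have TS: "T x \<in> SU3" using T x by (simp add: torus_def)
  have eq: "mc (\<lambda>y. A y ** T y) x u = conj_transpose (T x) ** (mc A x u ** T x) + conj_transpose (T x) ** D T x u"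
    unfolding mc_def D_bilinear[OF bounded_bilinear_mm SU3_diff_D(3)[OF A x] dT]
    by (simp add: mm_add ct_mult SU3_cancel[OF SU3_diff_D(2)[OF A x]] add.commute flip: matrix_mul_assoc)
  have "cnj (T x $ i $ i) * T x $ i $ i = 1" for i
    using torus_norm[OF T[OF x], of i] complex_norm_square[of "T x $ i $ i"] by (simp add: mult.commute)
  then have c: "T x $ i $ i * (cnj (T x $ i $ i) * z) = z" for i z
    by (metis mult.assoc mult.commute mult_1)
  show "xi (\<lambda>y. A y ** T y) x u = twist (T x) * xi A x u"
    "weights (mc (\<lambda>y. A y ** T y) x u) = weights (mc A x u) + weights (conj_transpose (T x) ** D T x u)"
    unfolding xi_def eq using off[OF x] offD by (simp_all add: c3_eq_iff mm_nth c mult_ac)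
qed

section \<open>Totally geodesic Lagrangian submanifolds, infinitesimally\<close>

subsection \<open>Lagrangian subspaces\<close>

lemma three_cases: "(i::3) = k \<or> i = k + 1 \<or> i = k + 2"
  using exhaust_3[of i] exhaust_3[of k] by auto

lemma numeral_mod_3: "(4::3) = 1" "(5::3) = 2"
  by simp_all

lemma kaehler_cyclic: "kaehler X Y =
    Im (cnj (X $ k) * Y $ k) + Im (cnj (X $ (k+1)) * Y $ (k+1)) + Im (cnj (X $ (k+2)) * Y $ (k+2))"
  using exhaust_3[of k] by (auto simp: kaehler_def numeral_mod_3)

lemma ccross_cyclic: "ccross X Y $ k = cnj (X $ (k+1) * Y $ (k+2) - X $ (k+2) * Y $ (k+1))"
  using exhaust_3[of k] by (auto simp: numeral_mod_3)

lemma cyclic_distinct: "(k::3) + 1 \<noteq> k" "k + 2 \<noteq> k" "k + 1 \<noteq> k + 2"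
  using exhaust_3[of k] by auto

lemma ccross_anti: "ccross Y X = - ccross X Y"
  by (simp add: c3_eq_iff)

lemma kaehler_ccross_rotate: "kaehler (ccross X Y) Z = kaehler (ccross Y Z) X"
  by (simp add: kaehler_def algebra_simps)

lemma kaehler_minus: "kaehler (- X) Y = - kaehler X Y" "kaehler X (- Y) = - kaehler X Y"
  by (simp_all add: kaehler_def)

text \<open>A Lagrangian subspace is a maximal isotropic one: \<open>J V\<close> is the orthogonal complement of \<open>V\<close>,
  by dimension.\<close>

lemma Lagrangian_maximal:
  assumes V: "subspace V" "dim V = 3" and iso: "\<And>X Y. X \<in> V \<Longrightarrow> Y \<in> V \<Longrightarrow> kaehler X Y = 0"
    and Y: "\<And>X. X \<in> V \<Longrightarrow> kaehler Y X = 0"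
  shows "Y \<in> V"
proof -
  define J where "J X = (\<chi> i. \<i> * X $ i)" for X :: "complex^3"
  have lin: "linear J" by (auto intro!: linearI simp: J_def vec_eq_iff algebra_simps)
  have inj: "inj J" by (auto intro!: injI simp: J_def vec_eq_iff)
  let ?P = "{Z \<in> UNIV. \<forall>X\<in>V. orthogonal X Z}"
  have "dim ?P + dim V = dim (UNIV :: (complex^3) set)"
    by (rule dim_subspace_orthogonal_to_vectors) (auto simp: V)
  then have P: "dim ?P = 3" using V by simp
  have k: "kaehler Z X = J Z \<bullet> X" for Z X by (simp add: kaehler_inner J_def)
  have "J ` V \<subseteq> ?P" using iso by (auto simp: k orthogonal_def inner_commute)
  moreover have "dim (J ` V) = 3"
    using dim_image_eq[OF lin, of V] inj_on_subset[OF inj] V by (simp add: subset_UNIV)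
  moreover have "subspace ?P" "subspace (J ` V)"
    using subspace_orthogonal_to_vectors[of V] linear_subspace_image[OF lin V(1)] by auto
  ultimately have "J ` V = ?P" using P by (intro subspace_dim_equal) auto
  moreover have "J Y \<in> ?P" using Y by (auto simp: k orthogonal_def inner_commute)
  ultimately show ?thesis using inj by (metis (no_types, lifting) image_iff injD)
qed

text \<open>For isotropic arguments the bracket with the \<open>\<hh>\<close>-part of \<open>[X, Y]\<close> acts on \<open>\<mm>\<close> as the multiplication
  by \<open>6 curv X Y\<close>; up to the sign this is the curvature of the canonical connection.\<close>

definition curv :: "complex^3 \<Rightarrow> complex^3 \<Rightarrow> complex^3" where
  "curv X Y = (\<chi> i. \<i> * of_real (Im (cnj (X $ i) * Y $ i)))"

subsection \<open>The equations\<close>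

text \<open>The lifts of totally geodesic Lagrangian immersions: in terms of the canonical connection, the
  covariant derivatives of the tangent fields are tangent.\<close>

definition tgl :: "(real^3) set \<Rightarrow> (real^3 \<Rightarrow> mat3) \<Rightarrow> bool" where
  "tgl W B \<longleftrightarrow> SU3_map W B \<and> (\<forall>x\<in>W. inj (xi B x) \<and> (\<forall>u v. kaehler (xi B x u) (xi B x v) = 0 \<and>
     canon B x u v + (1/2) *\<^sub>R ccross (xi B x u) (xi B x v) \<in> range (xi B x)))"

context
  fixes W B assumes B: "tgl W B"
begin

lemma tgl_map: "SU3_map W B" and tgl_diff: "SU3_diff W B" and
  tgl_iso: "x \<in> W \<Longrightarrow> kaehler (xi B x u) (xi B x v) = 0" and
  tgl_tg: "x \<in> W \<Longrightarrow> canon B x u v + (1/2) *\<^sub>R ccross (xi B x u) (xi B x v) \<in> range (xi B x)"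
  using B SU3_diffI unfolding tgl_def by blast+

lemma tgl_space:
  assumes "x \<in> W"
  shows "linear (xi B x)" "subspace (range (xi B x))" "dim (range (xi B x)) = 3"
proof -
  show l: "linear (xi B x)" by (rule linear_xi[OF tgl_diff assms])
  then show "subspace (range (xi B x))" by (rule linear_subspace_image) simp
  show "dim (range (xi B x)) = 3"
    using dim_image_eq[OF l, of UNIV] B assms by (simp add: tgl_def)
qed

lemma tgl_maximal:
  assumes "x \<in> W" "\<And>u. kaehler Y (xi B x u) = 0"
  shows "Y \<in> range (xi B x)"
  by (rule Lagrangian_maximal[OF tgl_space(2,3)[OF assms(1)]]) (use tgl_iso assms in auto)

text \<open>Differentiating \<open>kaehler (xi v) (xi w) = 0\<close>, the tangential parts of the covariant derivatives drop
  out, and the torsion remains.\<close>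

lemma tgl_ccross:
  assumes "x \<in> W"
  shows "ccross (xi B x u) (xi B x v) \<in> range (xi B x)"
proof (rule tgl_maximal[OF assms])
  fix w
  let ?x = "xi B x"
  have "D (\<lambda>y. kaehler (xi B y v) (xi B y w)) x u = D (\<lambda>y. 0) x u"
    using D_cong[OF SU3_map_D(1)[OF tgl_map] assms, of "\<lambda>y. kaehler (xi B y v) (xi B y w)" "\<lambda>y. 0"]
      tgl_iso by simp
  then have 0: "kaehler (canon B x u v) (?x w) + kaehler (?x v) (canon B x u w) = 0"
    by (simp add: canon_metric[OF tgl_map assms])
  have "kaehler (canon B x u v + (1/2) *\<^sub>R ccross (?x u) (?x v)) (?x w) = 0" for u v w
    using tgl_tg[OF assms, of u v] tgl_iso[OF assms] by auto
  then have e: "kaehler (canon B x u v) (?x w) = - (1/2) * kaehler (ccross (?x u) (?x v)) (?x w)" for u v w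
    by (simp add: bounded_bilinear.add_left[OF bounded_bilinear_kaehler]
        bounded_bilinear.scaleR_left[OF bounded_bilinear_kaehler] add_eq_0_iff)
  have "kaehler (?x v) (canon B x u w) = 1/2 * kaehler (ccross (?x u) (?x w)) (?x v)"
    using e[of u w v] kaehler_sym[of "canon B x u w" "?x v"] by simp
  moreover have "kaehler (ccross (?x u) (?x w)) (?x v) = - kaehler (ccross (?x u) (?x v)) (?x w)"
    by (metis ccross_anti kaehler_ccross_rotate kaehler_minus(1))
  ultimately show "kaehler (ccross (?x u) (?x v)) (?x w) = 0" using 0 e[of u v w] by simp
qed

lemma tgl_canon:
  assumes "x \<in> W"
  shows "canon B x u v \<in> range (xi B x)"
  using subspace_diff[OF tgl_space(2)[OF assms] tgl_tg[OF assms]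
      subspace_scale[OF tgl_space(2)[OF assms] tgl_ccross[OF assms], of "1/2"], of u v u v] by simp

text \<open>The tangent spaces are parallel for the canonical connection, so they are preserved by its
  curvature, which is the bracket with the diagonal part of \<open>[xi u, xi v]\<close>.\<close>

lemma tgl_curv:
  assumes x: "x \<in> W"
  shows "curv (xi B x u) (xi B x v) * xi B x w \<in> range (xi B x)"
proof -
  let ?V = "range (xi B x)" and ?h = "\<lambda>u. weights (mc B x u)"
  note o = SU3_map_D(1)[OF tgl_map]
  have dc: "(\<lambda>y. canon B y v w) differentiable (at x)" for v w
    using smooth_on_differentiable[OF smooth_on_xi(4)[OF tgl_map] x] .
  define R where "R u v w = D (\<lambda>y. canon B y v w) x u + ?h u * canon B x v w" for u v w
  have R: "R u v w \<in> ?V" for u v w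
  proof (rule tgl_maximal[OF x])
    fix z
    have z: "kaehler X Y = 0" if "y \<in> W" "X \<in> range (xi B y)" "Y \<in> range (xi B y)" for y X Y
      using tgl_iso that by auto
    have "D (\<lambda>y. kaehler (canon B y v w) (xi B y z)) x u = D (\<lambda>y. 0) x u"
      using D_cong[OF o x, of "\<lambda>y. kaehler (canon B y v w) (xi B y z)" "\<lambda>y. 0"]
        z[OF _ tgl_canon rangeI] by simp
    then have "kaehler (canon B x v w) (D (\<lambda>y. xi B y z) x u) + kaehler (D (\<lambda>y. canon B y v w) x u) (xi B x z) = 0"
      by (simp add: D_bilinear[OF bounded_bilinear_kaehler dc xi_differentiable(1)[OF tgl_map x]])
    moreover have "kaehler (canon B x v w) (canon B x u z) = 0"
      by (rule z[OF x tgl_canon[OF x] tgl_canon[OF x]])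
    moreover have "kaehler (?h u * canon B x v w) (xi B x z) + kaehler (canon B x v w) (?h u * xi B x z) = 0"
      by (rule weights_skew_inner(2)[OF Re_weights[OF skew_mc[OF tgl_diff x]]])
    ultimately show "kaehler (R u v w) (xi B x z) = 0"
      unfolding R_def canon_def[of B x u z]
      by (simp add: bounded_bilinear.add_left[OF bounded_bilinear_kaehler]
          bounded_bilinear.add_right[OF bounded_bilinear_kaehler])
  qed
  have dxi: "(\<lambda>y. D (\<lambda>y. xi B y w) y v) differentiable (at x)" for v w
    using smooth_on_differentiable[OF smooth_on_D[OF smooth_on_xi(2)[OF tgl_map]] x] .
  have dh: "(\<lambda>y. weights (mc B y v)) differentiable (at x)" for v
    using smooth_on_differentiable[OF smooth_on_xi(3)[OF tgl_map] x] .
  have "D (\<lambda>y. canon B y v w) x u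
      = D (\<lambda>y. D (\<lambda>y. xi B y w) y v) x u + (?h v * D (\<lambda>y. xi B y w) x u + D (\<lambda>y. weights (mc B y v)) x u * xi B x w)"
    for u v w
  proof -
    have "(\<lambda>y. weights (mc B y v) * xi B y w) differentiable (at x)"
      by (rule differentiable_bilinear[OF bounded_bilinear_vmult dh xi_differentiable(1)[OF tgl_map x]])
    note d = has_derivative_add[OF D_has_derivative[OF dxi[of w v]] D_has_derivative[OF this]]
    show ?thesis unfolding canon_def D_eq[OF d]
      by (simp add: D_bilinear[OF bounded_bilinear_vmult dh xi_differentiable(1)[OF tgl_map x]])
  qed
  then have "R u v w - R v u w = (D (\<lambda>y. D (\<lambda>y. xi B y w) y v) x u - D (\<lambda>y. D (\<lambda>y. xi B y w) y u) x v)
      + (D (\<lambda>y. weights (mc B y v)) x u - D (\<lambda>y. weights (mc B y u)) x v) * xi B x w"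
    by (simp add: R_def canon_def algebra_simps)
  also have "D (\<lambda>y. D (\<lambda>y. xi B y w) y v) x u - D (\<lambda>y. D (\<lambda>y. xi B y w) y u) x v = 0"
    using smooth_on_D_symmetric[OF o smooth_on_xi(2)[OF tgl_map] x] by simp
  also have "D (\<lambda>y. weights (mc B y v)) x u - D (\<lambda>y. weights (mc B y u)) x v
      = weights (- (mc B x u ** mc B x v - mc B x v ** mc B x u))"
    unfolding maurer_cartan[OF tgl_map x, symmetric]
    using linear_diff[OF bounded_linear.linear[OF bounded_linear_weights]] D_D_mc(2)[OF tgl_map x]
    by (simp add: D_bounded_linear[OF bounded_linear_weights])
  also have "\<dots> = - weights (mc B x u ** mc B x v - mc B x v ** mc B x u)"
    using linear_neg[OF bounded_linear.linear[OF bounded_linear_weights]] .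
  also have "weights (mc B x u ** mc B x v - mc B x v ** mc B x u) = 6 *\<^sub>R curv (xi B x u) (xi B x v)"
    using weights_bracket[OF skew_mc[OF tgl_diff x] skew_mc[OF tgl_diff x]] tgl_iso[OF x, of u v]
    by (simp add: vec_eq_iff curv_def xi_def scaleR_conv_of_real[where 'a=complex])
  finally have "R u v w - R v u w = (-6) *\<^sub>R (curv (xi B x u) (xi B x v) * xi B x w)"
    by (simp add: vec_eq_iff)
  then have e: "curv (xi B x u) (xi B x v) * xi B x w = (-1/6) *\<^sub>R (R u v w - R v u w)"
    by simp
  show ?thesis unfolding e
    by (rule subspace_scale[OF tgl_space(2)[OF x] subspace_diff[OF tgl_space(2)[OF x] R R]])
qed

end

subsection \<open>Classification of the tangent spaces\<close>

definition real_space :: "(complex^3) set" where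
  "real_space = {X. \<forall>i. Im (X $ i) = 0}"

definition sphere_space :: "3 \<Rightarrow> (complex^3) set" where
  "sphere_space k = {X. X $ (k+2) = cnj (X $ (k+1)) \<and> Re (X $ k) = 0}"

text \<open>What has been found of the tangent spaces, stated for a single subspace: from here on their
  classification is pure algebra.\<close>

locale curvature_invariant =
  fixes V :: "(complex^3) set"
  assumes V: "subspace V" "dim V = 3" and iso: "X \<in> V \<Longrightarrow> Y \<in> V \<Longrightarrow> kaehler X Y = 0"
    and ccross: "X \<in> V \<Longrightarrow> Y \<in> V \<Longrightarrow> ccross X Y \<in> V"
    and curv: "X \<in> V \<Longrightarrow> Y \<in> V \<Longrightarrow> Z \<in> V \<Longrightarrow> curv X Y * Z \<in> V"
begin

lemma det_real: "X \<in> V \<Longrightarrow> Y \<in> V \<Longrightarrow> Z \<in> V \<Longrightarrow> kaehler (ccross X Y) Z = 0"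
  using iso ccross by blast

lemma equal_isotropic: 
  assumes "V \<subseteq> U" "\<And>X Y. X \<in> U \<Longrightarrow> Y \<in> U \<Longrightarrow> kaehler X Y = 0"
  shows "V = U"
  using Lagrangian_maximal[OF V iso] assms by blast

text \<open>If every coordinate of \<open>V\<close> is confined to a real line, then \<open>V\<close> is the sum of the three lines, and the
  product of their phases is real because the complex volume form is real on \<open>V\<close>.\<close>

lemma flat_case:
  assumes "\<And>X Y i. X \<in> V \<Longrightarrow> Y \<in> V \<Longrightarrow> Im (cnj (X $ i) * Y $ i) = 0"
  shows "\<exists>t. (\<forall>i. norm (t $ i) = 1) \<and> Im (t $ 1 * t $ 2 * t $ 3) = 0 \<and>
    V = {X. \<forall>i. Im (cnj (t $ i) * X $ i) = 0}"
proof -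
  have "\<exists>z. norm z = 1 \<and> (\<forall>X\<in>V. Im (cnj z * X $ i) = 0)" for i
  proof (cases "\<forall>X\<in>V. X $ i = 0")
    case True
    then show ?thesis by (intro exI[of _ 1]) auto
  next
    case False
    then obtain Y where Y: "Y \<in> V" "Y $ i \<noteq> 0" by auto
    have "Im (cnj (sgn (Y$i)) * X $ i) = 0" if "X \<in> V" for X
    proof -
      have "cnj (sgn (Y$i)) * X $ i = (cnj (Y$i) * X$i) / of_real (norm (Y$i))" by (simp add: sgn_eq)
      then show ?thesis using assms[OF Y(1) that, of i] by (simp add: Im_divide_of_real)
    qed
    then show ?thesis using Y by (intro exI[of _ "sgn (Y$i)"]) (auto simp: norm_sgn)
  qed
  then obtain t' where t': "norm (t' i) = 1 \<and> (\<forall>X\<in>V. Im (cnj (t' i) * X $ i) = 0)" for i by metis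
  define t :: "complex^3" where "t = (\<chi> i. t' i)"
  let ?U = "{X. \<forall>i. Im (cnj (t $ i) * X $ i) = 0}"
  have n: "norm (t $ i) = 1" for i using t' by (simp add: t_def)
  have V_U: "V = ?U"
  proof (rule equal_isotropic)
    show "V \<subseteq> ?U" using t' by (auto simp: t_def)
    fix X Y assume "X \<in> ?U" "Y \<in> ?U"
    then have r: "Im (cnj (t $ i) * X $ i) = 0" "Im (cnj (t $ i) * Y $ i) = 0" for i by auto
    have "Im (cnj (X $ i) * Y $ i) = 0" for i
    proof -
      have "cnj (X $ i) * Y $ i = (cnj (t$i) * t$i) * (cnj (X $ i) * Y $ i)"
        using n[of i] complex_norm_square[of "t$i"] by (metis mult.commute mult_1 of_real_1 one_power2)
      also have "\<dots> = cnj (cnj (t $ i) * X $ i) * (cnj (t $ i) * Y $ i)" by simp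
      finally have e: "cnj (X $ i) * Y $ i = cnj (cnj (t $ i) * X $ i) * (cnj (t $ i) * Y $ i)" .
      have "Im (cnj a * b) = 0" if "Im a = 0" "Im b = 0" for a b using that by simp
      then show ?thesis unfolding e using r[of i] by blast
    qed
    then show "kaehler X Y = 0" by (simp add: kaehler_def)
  qed
  have "cnj (t$i) * t$i = 1" for i
    using n[of i] complex_norm_square[of "t$i"] by (metis mult.commute of_real_1 one_power2)
  then have e: "axis j (t $ j) \<in> V" for j by (auto simp: V_U axis_def)
  have "Im (t $ 1 * t $ 2 * t $ 3) = 0"
    using det_real[OF e[of 1] e[of 2] e[of 3]] by (simp add: kaehler_def axis_def)
  then show ?thesis using n V_U by blast
qed

text \<open>The complex volume form is real and nonzero on \<open>V\<close>. The diagonal matrix \<open>curv X Y\<close> has imaginary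
  entries and maps \<open>V\<close> to itself, so the product of the entries, by which it multiplies the volume form,
  is imaginary and real at once.\<close>

lemma curv_degenerate:
  assumes "X \<in> V" "Y \<in> V"
  shows "\<exists>i. curv X Y $ i = 0"
proof -
  have "V \<noteq> {0}" using V dim_eq_0[of V] by auto
  then obtain P where P: "P \<in> V" "P \<noteq> 0" using subspace_0[OF V(1)] by auto
  have "dim (span {P}) \<le> 1" using dim_le_card'[of "{P}"] by (simp add: dim_span)
  then have "\<not> V \<subseteq> span {P}" using V(2) dim_subset[of V "span {P}"] by linarith
  then obtain Q where Q: "Q \<in> V" "Q \<notin> span {P}" by auto
  define Z where "Z = ccross P Q"
  have Z: "Z \<in> V" unfolding Z_def by (rule ccross[OF P(1) Q(1)])
  have "Z \<noteq> 0"
  proof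
    assume "Z = 0"
    then have z: "P$2 * Q$3 = P$3 * Q$2" "P$3 * Q$1 = P$1 * Q$3" "P$1 * Q$2 = P$2 * Q$1"
      unfolding Z_def c3_eq_iff ccross_nth complex_cnj_zero_iff zero_index by simp_all
    obtain j where j: "P $ j \<noteq> 0" using P(2) by (auto simp: vec_eq_iff)
    define c where "c = Q $ j / P $ j"
    \<comment> \<open>Complex proportional vectors of an isotropic space are real proportional.\<close>
    have Qc: "Q $ i = c * P $ i" for i
      using z j exhaust_3[of i] exhaust_3[of j] by (auto simp: c_def field_simps)
    have "Im (cnj (P $ i) * Q $ i) = Im c * (norm (P $ i))\<^sup>2" for i
      unfolding Qc cmod_power2 by (simp add: power2_eq_square algebra_simps)
    then have "Im c * ((norm (P$1))\<^sup>2 + (norm (P$2))\<^sup>2 + (norm (P$3))\<^sup>2) = 0"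
      using iso[OF P(1) Q(1)] by (simp add: kaehler_def algebra_simps)
    moreover have "(norm (P$1))\<^sup>2 + (norm (P$2))\<^sup>2 + (norm (P$3))\<^sup>2 > 0"
    proof -
      have "(norm (P$j))\<^sup>2 > 0" using j by simp
      then show ?thesis using exhaust_3[of j] by (auto simp: add_pos_nonneg add_nonneg_pos)
    qed
    ultimately have "Im c = 0" by auto
    then have "Q = Re c *\<^sub>R P" by (simp add: vec_eq_iff Qc complex_eq_iff)
    then show False using Q(2) by (metis span_base span_scale singletonI)
  qed
  define E where "E = curv X Y"
  define w where "w i = Im (cnj (X $ i) * Y $ i)" for i
  have E: "E $ i = \<i> * of_real (w i)" for i by (simp add: E_def curv_def w_def)
  have "kaehler (ccross (E * P) (E * Q)) (E * Z) = 0"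
    using det_real curv assms P(1) Q(1) Z by (simp add: E_def)
  moreover have "kaehler (ccross (E * P) (E * Q)) (E * Z) = - (w 1 * w 2 * w 3) * ((norm (Z$1))\<^sup>2 + (norm (Z$2))\<^sup>2 + (norm (Z$3))\<^sup>2)"
    unfolding kaehler_def vector_mult_component E ccross_nth cmod_power2 Z_def
    by (simp add: power2_eq_square algebra_simps)
  moreover have "(norm (Z$1))\<^sup>2 + (norm (Z$2))\<^sup>2 + (norm (Z$3))\<^sup>2 \<noteq> 0"
    using \<open>Z \<noteq> 0\<close> by (auto simp: c3_eq_iff add_nonneg_eq_0_iff)
  ultimately have "w 1 * w 2 * w 3 = 0" by simp
  then show ?thesis unfolding E_def[symmetric] by (auto simp: E)
qed

text \<open>By \<open>curv_degenerate\<close> and \<open>w\<^sub>1 + w\<^sub>2 + w\<^sub>3 = 0\<close>, the matrix \<open>curv X0 Y0\<close> is a multiple of one, called \<open>E\<close>, with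
  entries \<open>0, \<i>, - \<i>\<close>. Projecting by \<open>- E\<^sup>2\<close> splits \<open>V\<close> into a line in one coordinate axis and a plane in the
  other two. Isotropy of \<open>X\<close> and \<open>E Y\<close> makes the plane the graph of a conjugation \<open>z \<mapsto> a * cnj z\<close>, and the
  reality of the volume form determines the phase of the line.\<close>

lemma curved_case:
  assumes XY: "X0 \<in> V" "Y0 \<in> V" "Im (cnj (X0 $ j) * Y0 $ j) \<noteq> 0"
  shows "\<exists>k a. norm a = 1 \<and> V = {X. X $ (k+2) = a * cnj (X $ (k+1)) \<and> Re (a * X $ k) = 0}"
proof -
  define w where "w i = Im (cnj (X0 $ i) * Y0 $ i)" for i
  have cw: "curv X0 Y0 $ i = \<i> * of_real (w i)" for i by (simp only: curv_def w_def vec_lambda_beta)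
  obtain k where "curv X0 Y0 $ k = 0" using curv_degenerate[OF XY(1,2)] by blast
  then have k: "w k = 0" by (simp add: cw)
  define s where "s = w (k+1)"
  have "w k + w (k+1) + w (k+2) = 0" using iso[OF XY(1,2)] kaehler_cyclic[of X0 Y0 k] by (simp add: w_def)
  then have s: "w (k+1) = s" "w (k+2) = - s" using k by (auto simp: s_def)
  have "s \<noteq> 0" using XY(3) k s three_cases[of j k] by (auto simp: w_def)
  define E where "E = (1/s) *\<^sub>R curv X0 Y0"
  have E: "E $ k = 0" "E $ (k+1) = \<i>" "E $ (k+2) = - \<i>"
  proof -
    have "E $ i = \<i> * of_real (w i / s)" for i
      unfolding E_def vector_scaleR_component cw by (simp add: scaleR_conv_of_real)
    then show "E $ k = 0" "E $ (k+1) = \<i>" "E $ (k+2) = - \<i>" using k s \<open>s \<noteq> 0\<close> by simp_all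
  qed
  have EV: "E * X \<in> V" if "X \<in> V" for X
  proof -
    have "E * X = (1/s) *\<^sub>R (curv X0 Y0 * X)" by (simp add: E_def)
    then show ?thesis using subspace_scale[OF V(1) curv[OF XY(1,2) that]] by simp
  qed
  define P where "P X = - (E * (E * X))" for X
  have PV: "P X \<in> V" "X - P X \<in> V" if "X \<in> V" for X
  proof -
    show "P X \<in> V" unfolding P_def by (rule subspace_neg[OF V(1) EV[OF EV[OF that]]])
    then show "X - P X \<in> V" by (rule subspace_diff[OF V(1) that])
  qed
  have P: "P X $ k = 0" "P X $ (k+1) = X $ (k+1)" "P X $ (k+2) = X $ (k+2)" for X
    by (simp_all add: P_def E)
  have rel: "cnj (X $ (k+1)) * Y $ (k+1) = X $ (k+2) * cnj (Y $ (k+2))" if "X \<in> V" "Y \<in> V" for X Y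
    using iso[OF PV(1)[OF that(1)] PV(1)[OF that(2)]] iso[OF PV(1)[OF that(1)] EV[OF PV(1)[OF that(2)]]]
    unfolding kaehler_cyclic[of _ _ k] vector_mult_component P E
    by (simp add: complex_eq_iff algebra_simps)
  define p where "p = X0 $ (k+1)"
  have p: "p \<noteq> 0" using s \<open>s \<noteq> 0\<close> by (auto simp: w_def p_def)
  define a where "a = X0 $ (k+2) / cnj p"
  have "cnj p * p = X0 $ (k+2) * cnj (X0 $ (k+2))" using rel[OF XY(1) XY(1)] by (simp add: p_def)
  then have "(norm p)\<^sup>2 = (norm (X0 $ (k+2)))\<^sup>2"
    by (metis complex_norm_square mult.commute of_real_eq_iff)
  then have "norm (X0 $ (k+2)) = norm p" by simp
  then have na: "norm a = 1" using p by (simp add: a_def norm_divide)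
  then have aa: "a * cnj a = 1" "cnj a * a = 1" 
    using complex_norm_square[of a] by (simp_all add: mult.commute)
  let ?U = "{X. X $ (k+2) = a * cnj (X $ (k+1)) \<and> Re (a * X $ k) = 0}"
  have 1: "Y $ (k+2) = a * cnj (Y $ (k+1))" if "Y \<in> V" for Y
  proof -
    have "cnj p * Y $ (k+1) = X0 $ (k+2) * cnj (Y $ (k+2))"
      using rel[OF XY(1) that] by (simp add: p_def)
    then have "Y $ (k+1) = a * cnj (Y $ (k+2))" using p by (simp add: a_def field_simps)
    then have "a * cnj (Y $ (k+1)) = (a * cnj a) * Y $ (k+2)" by simp
    then show ?thesis by (simp add: aa)
  qed
  have 2: "Re (a * Y $ k) = 0" if "Y \<in> V" for Y
  proof -
    have q: "X0 $ (k+2) = a * cnj p" using 1[OF XY(1)] by (simp add: p_def)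
    have "kaehler (ccross (P X0) (E * P X0)) (Y - P Y) = 0"
      by (intro det_real EV PV XY that)
    then have "Im (- 2 * \<i> * p * (a * cnj p) * Y $ k) = 0"
      unfolding kaehler_cyclic[of _ _ k] ccross_cyclic vector_mult_component vector_minus_component P E
        q p_def[symmetric] by (simp add: algebra_simps)
    also have "- 2 * \<i> * p * (a * cnj p) * Y $ k = - 2 * \<i> * of_real ((norm p)\<^sup>2) * (a * Y $ k)"
      unfolding complex_norm_square by simp
    finally show ?thesis using p by simp
  qed
  have "V = ?U"
  proof (rule equal_isotropic)
    show "V \<subseteq> ?U" using 1 2 by auto
    fix X Y assume "X \<in> ?U" "Y \<in> ?U"
    then have X: "X $ (k+2) = a * cnj (X $ (k+1))" "Re (a * X $ k) = 0"
      and Y: "Y $ (k+2) = a * cnj (Y $ (k+1))" "Re (a * Y $ k) = 0" by auto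
    have "cnj (X $ k) * Y $ k = (a * cnj a) * (cnj (X $ k) * Y $ k)" by (simp add: aa)
    also have "\<dots> = cnj (a * X $ k) * (a * Y $ k)" by (simp add: mult_ac)
    finally have e: "cnj (X $ k) * Y $ k = cnj (a * X $ k) * (a * Y $ k)" .
    have "Im (cnj b * c) = 0" if "Re b = 0" "Re c = 0" for b c using that by simp
    then have "Im (cnj (X $ k) * Y $ k) = 0" unfolding e using X(2) Y(2) by blast
    moreover have "cnj (X $ (k+2)) * Y $ (k+2) = (a * cnj a) * (X $ (k+1) * cnj (Y $ (k+1)))"
      by (simp add: X Y mult_ac)
    then have "Im (cnj (X $ (k+2)) * Y $ (k+2)) = - Im (cnj (X $ (k+1)) * Y $ (k+1))" by (simp add: aa)
    ultimately show "kaehler X Y = 0" by (simp add: kaehler_cyclic[of _ _ k])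
  qed
  then show ?thesis using na by blast
qed

end

subsection \<open>Adapted lifts\<close>

text \<open>The diagonal matrix whose twist multiplies the three coordinates of \<open>\<mm>\<close> by given phases.\<close>

definition rotation :: "real^3 \<Rightarrow> mat3" where
  "rotation b = diag3 (cis ((b$1 - b$3) / 3)) (cis ((b$2 - b$1) / 3)) (cis ((b$3 - b$2) / 3))"

definition phases :: "real^3 \<Rightarrow> complex^3" where
  "phases b = (\<chi> i. cis (b $ i))"

lemma diag3_nth: "diag3 a b c $ i $ j = (if i = j then if i = 1 then a else if i = 2 then b else c else 0)"
  using exhaust_3[of i] exhaust_3[of j] by (auto simp: diag3_def cscale_def E_def)

lemma rotation_torus: "rotation b \<in> torus"
proof -
  have "det (rotation b) = cis ((b$1 - b$3) / 3) * cis ((b$2 - b$1) / 3) * cis ((b$3 - b$2) / 3)"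
    by (simp add: rotation_def det_3 diag3_nth)
  also have "\<dots> = cis 0" unfolding cis_mult by (rule arg_cong[where f = cis]) (simp add: field_simps)
  finally have "det (rotation b) = 1" by simp
  moreover have "conj_transpose (rotation b) ** rotation b = mat 1"
    by (simp add: rotation_def mat3_eq_iff forall_3 mm_nth diag3_nth mat1_nth cis_cnj cis_mult)
  ultimately show ?thesis by (simp add: torus_def SU3_def rotation_def diag3_nth)
qed

lemma twist_rotation:
  assumes "b$1 + b$2 + b$3 = 0"
  shows "twist (rotation b) = phases b"
proof -
  have *: "b $ 3 = - b$1 - b$2" using assms by simp
  show ?thesis
    by (simp add: c3_eq_iff phases_def rotation_def diag3_nth cis_cnj cis_mult)
      (intro conjI arg_cong[where f = cis]; simp add: * field_simps)
qed

lemma cis_has_derivative: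
  assumes "f differentiable (at x)"
  shows "((\<lambda>y. cis (f y)) has_derivative (\<lambda>u. \<i> * of_real (D f x u) * cis (f x))) (at x)"
  using has_derivative_cis[OF D_has_derivative[OF assms]]
  by (simp add: scaleR_conv_of_real mult_ac)

lemma differentiable_vec_nth: "f differentiable F \<Longrightarrow> (\<lambda>y. f y $ i) differentiable F"
  by (rule differentiable_bounded_linear[OF bounded_linear_vec_nth])

lemma has_derivative_vecI:
  fixes f :: "'a::real_normed_vector \<Rightarrow> 'b::euclidean_space^'n"
  assumes "\<And>i. ((\<lambda>y. f y $ i) has_derivative (\<lambda>u. f' u $ i)) (at x)"
  shows "(f has_derivative f') (at x)"
proof -
  have "((\<lambda>y. \<Sum>i\<in>UNIV. axis i (f y $ i)) has_derivative (\<lambda>u. \<Sum>i\<in>UNIV. axis i (f' u $ i))) (at x)"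
  proof (intro has_derivative_sum)
    fix i
    have "bounded_linear (axis i :: 'b \<Rightarrow> 'b^'n)"
      by (simp add: linear_conv_bounded_linear[symmetric] linear_iff axis_def vec_eq_iff)
    then show "((\<lambda>y. axis i (f y $ i)) has_derivative (\<lambda>u. axis i (f' u $ i))) (at x)"
      by (rule bounded_linear.has_derivative[OF _ assms])
  qed
  moreover have "(\<Sum>i\<in>UNIV. axis i (v $ i)) = v" for v :: "'b^'n"
    by (simp add: vec_eq_iff axis_def if_distrib cong: if_cong)
  ultimately show ?thesis by simp
qed

context
  fixes W B and b :: "real^3 \<Rightarrow> real^3"
  assumes B: "SU3_map W B" and db: "\<And>y. y \<in> W \<Longrightarrow> b differentiable (at y)"
    and sum0: "\<And>y. y \<in> W \<Longrightarrow> b y $ 1 + b y $ 2 + b y $ 3 = 0"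
begin

lemma phases_derivative:
  assumes "x \<in> W"
  shows "((\<lambda>y. phases (b y)) has_derivative (\<lambda>u. \<chi> i. \<i> * of_real (D b x u $ i) * phases (b x) $ i)) (at x)"
proof (rule has_derivative_vecI)
  fix i
  show "((\<lambda>y. phases (b y) $ i) has_derivative (\<lambda>u. (\<chi> i. \<i> * of_real (D b x u $ i) * phases (b x) $ i) $ i)) (at x)"
    using cis_has_derivative[OF differentiable_vec_nth[OF db[OF assms], of i]]
    by (simp add: phases_def D_bounded_linear[OF bounded_linear_vec_nth db[OF assms]])
qed

lemma rotation_derivative:
  assumes "x \<in> W"
  shows "(\<lambda>y. rotation (b y)) differentiable (at x)"
    "weights (conj_transpose (rotation (b x)) ** D (\<lambda>y. rotation (b y)) x u) = - (\<chi> i. \<i> * of_real (D b x u $ i))"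
proof -
  define d where "d u = diag3 (\<i> * of_real ((D b x u $ 1 - D b x u $ 3) / 3)) (\<i> * of_real ((D b x u $ 2 - D b x u $ 1) / 3))
    (\<i> * of_real ((D b x u $ 3 - D b x u $ 2) / 3))" for u
  have c: "((\<lambda>y. cis ((b y $ i - b y $ j) / 3)) has_derivative
      (\<lambda>u. \<i> * of_real ((D b x u $ i - D b x u $ j) / 3) * cis ((b x $ i - b x $ j) / 3))) (at x)" for i j
  proof -
    have f: "((\<lambda>y. (b y $ i - b y $ j) / 3) has_derivative (\<lambda>u. (D b x u $ i - D b x u $ j) / 3)) (at x)"
      using bounded_linear.has_derivative[OF bounded_linear_vec_nth D_has_derivative[OF db[OF assms]]]
      by (auto intro!: derivative_eq_intros)
    show ?thesis using cis_has_derivative[of "\<lambda>y. (b y $ i - b y $ j) / 3" x] f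
      unfolding D_eq[OF f] differentiable_def by blast
  qed
  have "((\<lambda>y. rotation (b y)) has_derivative (\<lambda>u. rotation (b x) ** d u)) (at x)"
  proof (intro has_derivative_vecI)
    fix i j
    show "((\<lambda>y. rotation (b y) $ i $ j) has_derivative (\<lambda>u. (rotation (b x) ** d u) $ i $ j)) (at x)"
      using c[of 1 3] c[of 2 1] c[of 3 2] exhaust_3[of i] exhaust_3[of j]
      unfolding rotation_def d_def mm_nth diag3_nth by (auto simp: mult_ac)
  qed
  then have 1: "(\<lambda>y. rotation (b y)) differentiable (at x)" "D (\<lambda>y. rotation (b y)) x u = rotation (b x) ** d u" for u
    by (auto simp: differentiable_def D_eq)
  show "(\<lambda>y. rotation (b y)) differentiable (at x)" by (rule 1)
  have "rotation (b x) \<in> SU3" using rotation_torus by (simp add: torus_def)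
  then have "conj_transpose (rotation (b x)) ** D (\<lambda>y. rotation (b y)) x u = d u"
    by (simp add: 1 SU3_cancel)
  moreover have "D b x u $ 1 + D b x u $ 2 + D b x u $ 3 = 0"
  proof -
    let ?L = "\<lambda>v::real^3. v$1 + v$2 + v$3"
    have L: "bounded_linear ?L" by (intro bounded_linear_add bounded_linear_vec_nth)
    have "D (\<lambda>y. ?L (b y)) x u = D (\<lambda>y. 0) x u"
      using D_cong[OF SU3_map_D(1)[OF B] assms, of "\<lambda>y. ?L (b y)" "\<lambda>y. 0"] sum0 by simp
    then show ?thesis by (simp add: D_bounded_linear[OF L db[OF assms]])
  qed
  then have "D b x u $ 3 = - D b x u $ 1 - D b x u $ 2" by simp
  ultimately show "weights (conj_transpose (rotation (b x)) ** D (\<lambda>y. rotation (b y)) x u) = - (\<chi> i. \<i> * of_real (D b x u $ i))"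
    by (simp add: c3_eq_iff d_def diag3_nth complex_eq_iff field_simps)
qed

text \<open>The rotation adds the derivatives of the angles to the connection form; they cancel against the
  derivatives of the phases of \<open>xi\<close>.\<close>

lemma gauge:
  assumes "x \<in> W"
  shows "SU3_diff W (\<lambda>y. B y ** rotation (b y))"
    "xi (\<lambda>y. B y ** rotation (b y)) x u = phases (b x) * xi B x u"
    "canon (\<lambda>y. B y ** rotation (b y)) x u v = phases (b x) * canon B x u v"
proof -
  let ?B = "\<lambda>y. B y ** rotation (b y)"
  show "SU3_diff W ?B"
    unfolding SU3_diff_def
    using SU3_map_D[OF B] differentiable_bilinear[OF bounded_bilinear_mm _ rotation_derivative(1)]
      SU3_mult rotation_torus unfolding torus_def by blast
  have xi: "xi ?B y u = phases (b y) * xi B y u" if "y \<in> W" for y u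
    using xi_change(1)[OF SU3_diffI[OF B] that rotation_torus rotation_derivative(1)[OF that], of u]
      twist_rotation[OF sum0[OF that]] by simp
  show "xi ?B x u = phases (b x) * xi B x u" by (rule xi[OF assms])
  note p = phases_derivative[OF assms]
  have "(\<lambda>y. phases (b y)) differentiable (at x)" using p by (auto simp: differentiable_def)
  then have "D (\<lambda>y. phases (b y) * xi B y v) x u = phases (b x) * D (\<lambda>y. xi B y v) x u
      + (\<chi> i. \<i> * of_real (D b x u $ i) * phases (b x) $ i) * xi B x v"
    using D_bilinear[OF bounded_bilinear_vmult _ xi_differentiable(1)[OF B assms]] D_eq[OF p] by simp
  moreover have "D (\<lambda>y. xi ?B y v) x = D (\<lambda>y. phases (b y) * xi B y v) x"
    by (rule D_cong[OF SU3_map_D(1)[OF B] assms xi])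
  ultimately show "canon ?B x u v = phases (b x) * canon B x u v"
    unfolding canon_def xi[OF assms]
      xi_change(2)[OF SU3_diffI[OF B] assms rotation_torus rotation_derivative(1)[OF assms]]
      rotation_derivative(2)[OF assms]
    by (simp add: vec_eq_iff algebra_simps)
qed

end

lemma local_argument:
  fixes f :: "'a::euclidean_space \<Rightarrow> complex"
  assumes "open W" "x \<in> W" "f x \<noteq> 0" and f: "\<And>y. y \<in> W \<Longrightarrow> f differentiable (at y)"
  obtains U a where "open U" "x \<in> U" "U \<subseteq> W" "\<And>y. y \<in> U \<Longrightarrow> a differentiable (at y)"
    "\<And>y. y \<in> U \<Longrightarrow> f y \<noteq> 0 \<and> f y = of_real (norm (f y)) * cis (a y)"
proof -
  define q where "q y = f y / f x" for y
  define U where "U = W \<inter> q -` {z. Re z > 0}"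
  define a where "a y = Im (Ln (q y)) + Arg (f x)" for y
  have dq: "q differentiable (at y)" if "y \<in> W" for y
    unfolding q_def divide_inverse by (intro differentiable_mult f[OF that]) simp
  have "continuous_on W q"
    using dq by (intro continuous_at_imp_continuous_on ballI differentiable_imp_continuous_within)
  then have "open U" unfolding U_def
    using continuous_open_preimage[OF _ assms(1) open_halfspace_Re_gt] by blast
  moreover have "x \<in> U" using assms by (simp add: U_def q_def)
  moreover have "U \<subseteq> W" by (auto simp: U_def)
  moreover have "a differentiable (at y)" if "y \<in> U" for y
  proof -
    have q: "Re (q y) > 0" "y \<in> W" using that by (auto simp: U_def)
    then have nn: "q y \<notin> \<real>\<^sub>\<le>\<^sub>0" by (auto simp: complex_nonpos_Reals_iff)
    have "((\<lambda>y. Ln (q y)) has_derivative (\<lambda>u. (1 / q y) * D q y u)) (at y)"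
      using has_derivative_compose[OF D_has_derivative[OF dq[OF q(2)]], of Ln "(*) (1 / q y)"]
        has_field_derivative_Ln[OF nn] by (simp add: has_field_derivative_def inverse_eq_divide)
    then have "(\<lambda>y. Ln (q y)) differentiable (at y)" by (auto simp: differentiable_def)
    then show ?thesis unfolding a_def
      by (intro differentiable_add differentiable_bounded_linear[OF bounded_linear_Im]) simp_all
  qed
  moreover have "f y \<noteq> 0 \<and> f y = of_real (norm (f y)) * cis (a y)" if "y \<in> U" for y
  proof -
    have "q y \<noteq> 0" using that by (auto simp: U_def)
    then have n: "f y \<noteq> 0" by (auto simp: q_def)
    have "q y = exp (Ln (q y))" using \<open>q y \<noteq> 0\<close> by simp
    also have "\<dots> = of_real (norm (q y)) * cis (Im (Ln (q y)))"
      using \<open>q y \<noteq> 0\<close> by (simp add: exp_eq_polar)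
    finally have 1: "q y = of_real (norm (q y)) * cis (Im (Ln (q y)))" .
    have 2: "f x = of_real (norm (f x)) * cis (Arg (f x))"
      using rcis_cmod_Arg[of "f x"] by (simp add: rcis_def)
    have "f y = q y * f x" using assms by (simp add: q_def)
    also have "\<dots> = (of_real (norm (q y)) * cis (Im (Ln (q y)))) * (of_real (norm (f x)) * cis (Arg (f x)))"
      using 1 2 by metis
    also have "\<dots> = of_real (norm (f y)) * cis (a y)"
      using assms by (simp add: a_def cis_mult[symmetric] q_def norm_divide)
    finally show ?thesis using n by blast
  qed
  ultimately show ?thesis using that by blast
qed

text \<open>The tangent spaces at the standard flag of the two homogeneous examples; the second comes in
  three versions, permuted by the Weyl group.\<close>

definition model :: "3 option \<Rightarrow> (complex^3) set" where
  "model m = (case m of None \<Rightarrow> real_space | Some k \<Rightarrow> sphere_space k)"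

lemma model_isotropic: "X \<in> model m \<Longrightarrow> Y \<in> model m \<Longrightarrow> kaehler X Y = 0"
proof (cases m)
  case None
  then show "X \<in> model m \<Longrightarrow> Y \<in> model m \<Longrightarrow> kaehler X Y = 0"
    by (simp add: model_def real_space_def kaehler_def)
next
  case (Some k)
  then show "X \<in> model m \<Longrightarrow> Y \<in> model m \<Longrightarrow> kaehler X Y = 0"
    by (simp add: model_def sphere_space_def kaehler_cyclic[of _ _ k])
qed

lemma unit_real:
  assumes "norm z = 1" "Im z = 0"
  shows "z = 1 \<or> z = -1"
proof -
  have "\<bar>Re z\<bar> = 1" using assms by (simp add: norm_complex_def)
  then show ?thesis using assms(2) by (auto simp: complex_eq_iff abs_if split: if_splits)
qed

context
  fixes W B assumes B: "tgl W B"
begin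

lemma tgl_curvature_invariant: "x \<in> W \<Longrightarrow> curvature_invariant (range (xi B x))"
  by unfold_locales (use tgl_space[OF B] tgl_iso[OF B] tgl_ccross[OF B] tgl_curv[OF B] in auto)

lemma tgl_xi_differentiable: "y \<in> W \<Longrightarrow> (\<lambda>y. xi B y u $ i) differentiable (at y)"
  by (rule differentiable_vec_nth[OF xi_differentiable(1)[OF tgl_map[OF B]]])

lemma tgl_xi_continuous: "continuous_on W (\<lambda>y. xi B y u $ i)"
  using tgl_xi_differentiable by (intro continuous_at_imp_continuous_on ballI differentiable_imp_continuous_within)

lemma tgl_rotated_range:
  assumes U: "open U" "U \<subseteq> W" "y \<in> U"
    and b: "\<And>y. y \<in> U \<Longrightarrow> b differentiable (at y)" "\<And>y. y \<in> U \<Longrightarrow> b y $ 1 + b y $ 2 + b y $ 3 = 0"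
    and sub: "\<And>X. X \<in> range (xi B y) \<Longrightarrow> phases (b y) * X \<in> model m"
  shows "range (xi (\<lambda>y. B y ** rotation (b y)) y) = model m"
proof -
  let ?B = "\<lambda>y. B y ** rotation (b y)"
  have yW: "y \<in> W" using U by auto
  note g = gauge[OF SU3_map_subset[OF tgl_map[OF B] U(1,2)] b U(3)]
  have r: "range (xi ?B y) = (*) (phases (b y)) ` range (xi B y)" by (auto simp: g(2))
  have l: "linear ((*) (phases (b y)))"
    using bounded_linear.linear[OF bounded_bilinear.bounded_linear_right[OF bounded_bilinear_vmult]] .
  have "inj ((*) (phases (b y)))" by (auto intro!: injI simp: vec_eq_iff phases_def)
  then have "dim (range (xi ?B y)) = 3" "subspace (range (xi ?B y))"
    unfolding r using dim_image_eq[OF l, of "range (xi B y)"] tgl_space[OF B yW] linear_subspace_image[OF l]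
    by (auto intro: inj_on_subset)
  moreover have "range (xi ?B y) \<subseteq> model m" using sub by (auto simp: r)
  ultimately show ?thesis
    using Lagrangian_maximal[of "range (xi ?B y)"] model_isotropic by blast
qed

text \<open>The phases of the three tangent lines are the arguments of the coordinates, near \<open>x\<close>, of three
  tangent fields that start along the axes; the third one is determined by the other two. Nearby tangent
  spaces are flat again, because in the curved normal form two coordinates have the same modulus, which
  is impossible for a vector close to an axis.\<close>

lemma adapt_flat:
  assumes x: "x \<in> W" and flat: "\<And>X Y i. X \<in> range (xi B x) \<Longrightarrow> Y \<in> range (xi B x) \<Longrightarrow> Im (cnj (X $ i) * Y $ i) = 0"
  obtains U b where "open U" "x \<in> U" "U \<subseteq> W" "\<And>y. y \<in> U \<Longrightarrow> b differentiable (at y)"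
    "\<And>y. y \<in> U \<Longrightarrow> b y $ 1 + b y $ 2 + b y $ 3 = 0"
    "\<And>y. y \<in> U \<Longrightarrow> range (xi (\<lambda>y. B y ** rotation (b y)) y) = model None"
proof -
  obtain t where t: "\<And>i. norm (t $ i) = 1" "range (xi B x) = {X. \<forall>i. Im (cnj (t $ i) * X $ i) = 0}"
    using curvature_invariant.flat_case[OF tgl_curvature_invariant[OF x] flat] by auto
  have "cnj (t$i) * t$i = 1" for i
    using t(1)[of i] complex_norm_square[of "t$i"] by (metis mult.commute of_real_1 one_power2)
  then have "axis j (t $ j) \<in> range (xi B x)" for j by (auto simp: t(2) axis_def)
  then have "\<exists>u. xi B x u = axis j (t $ j)" for j by (metis rangeE)
  then obtain u where u: "xi B x (u j) = axis j (t $ j)" for j by metis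
  define W1 where "W1 = {y \<in> W. \<forall>j i. if i = j then norm (xi B y (u j) $ j) > 1/2 else norm (xi B y (u j) $ i) < 1/2}"
  have "W1 = (\<Inter>j. \<Inter>i. {y \<in> W. if i = j then norm (xi B y (u j) $ j) > 1/2 else norm (xi B y (u j) $ i) < 1/2})"
    by (auto simp: W1_def)
  moreover have op: "open {y \<in> W. if i = j then norm (xi B y (u j) $ j) > 1/2 else norm (xi B y (u j) $ i) < 1/2}" for i j
  proof -
    have c: "continuous_on W (\<lambda>y. norm (xi B y (u j) $ i))" for i
      by (intro continuous_on_norm tgl_xi_continuous)
    note o = SU3_map_D(1)[OF tgl_map[OF B]]
    have "open (W \<inter> (\<lambda>y. norm (xi B y (u j) $ i)) -` {1/2<..})" "open (W \<inter> (\<lambda>y. norm (xi B y (u j) $ i)) -` {..<1/2})" for i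
      by (rule continuous_open_preimage[OF c o]; simp)+
    moreover have "{y \<in> W. norm (xi B y (u j) $ i) > 1/2} = W \<inter> (\<lambda>y. norm (xi B y (u j) $ i)) -` {1/2<..}"
      "{y \<in> W. norm (xi B y (u j) $ i) < 1/2} = W \<inter> (\<lambda>y. norm (xi B y (u j) $ i)) -` {..<1/2}" for i by auto
    ultimately show ?thesis by (cases "i = j") simp_all
  qed
  ultimately have W1: "open W1" by (metis (no_types, lifting) open_INT finite_UNIV finite)
  have W1: "open W1" "W1 \<subseteq> W" using W1 by (auto simp: W1_def)
  have xW1: "x \<in> W1" using x t(1) by (simp add: W1_def u axis_def)
  have flatW1: "Im (cnj (X $ i) * Y $ i) = 0" if y: "y \<in> W1" and XY: "X \<in> range (xi B y)" "Y \<in> range (xi B y)" for X Y i y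
  proof (rule ccontr)
    assume "Im (cnj (X $ i) * Y $ i) \<noteq> 0"
    from curvature_invariant.curved_case[OF tgl_curvature_invariant XY this] y W1
    obtain k a where ka: "norm a = 1"
      "range (xi B y) = {X. X $ (k+2) = a * cnj (X $ (k+1)) \<and> Re (a * X $ k) = 0}"
      by auto
    have "xi B y (u (k+1)) \<in> range (xi B y)" by blast
    then have "norm (xi B y (u (k+1)) $ (k+2)) = norm (xi B y (u (k+1)) $ (k+1))"
      unfolding ka(2) by (simp add: norm_mult ka(1))
    moreover have "norm (xi B y (u (k+1)) $ (k+1)) > 1/2" "norm (xi B y (u (k+1)) $ (k+2)) < 1/2"
      using y cyclic_distinct(3)[of k] unfolding W1_def by (metis (mono_tags, lifting) mem_Collect_eq)+
    ultimately show False by simp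
  qed
  have n: "xi B x (u j) $ j \<noteq> 0" for j using t(1)[of j] by (auto simp: u axis_def)
  have d: "(\<lambda>y. xi B y (u j) $ j) differentiable (at y)" if "y \<in> W1" for y j
    using tgl_xi_differentiable that W1 by blast
  obtain U1 a1 where 1: "open U1" "x \<in> U1" "U1 \<subseteq> W1" "\<And>y. y \<in> U1 \<Longrightarrow> a1 differentiable (at y)"
    "\<And>y. y \<in> U1 \<Longrightarrow> xi B y (u 1) $ 1 \<noteq> 0 \<and> xi B y (u 1) $ 1 = of_real (norm (xi B y (u 1) $ 1)) * cis (a1 y)"
    using local_argument[OF W1(1) xW1 n d] by metis
  obtain U2 a2 where 2: "open U2" "x \<in> U2" "U2 \<subseteq> W1" "\<And>y. y \<in> U2 \<Longrightarrow> a2 differentiable (at y)"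
    "\<And>y. y \<in> U2 \<Longrightarrow> xi B y (u 2) $ 2 \<noteq> 0 \<and> xi B y (u 2) $ 2 = of_real (norm (xi B y (u 2) $ 2)) * cis (a2 y)"
    using local_argument[OF W1(1) xW1 n d] by metis
  define b :: "real^3 \<Rightarrow> real^3" where "b y = vector [- a1 y, - a2 y, a1 y + a2 y]" for y
  define U where "U = U1 \<inter> U2"
  have bn: "b y $ 1 = - a1 y" "b y $ 2 = - a2 y" "b y $ 3 = a1 y + a2 y" for y by (simp_all add: b_def)
  have U: "open U" "x \<in> U" "U \<subseteq> W" using 1 2 W1 by (auto simp: U_def)
  have db: "b differentiable (at y)" if "y \<in> U" for y
  proof -
    have a: "a1 differentiable (at y)" "a2 differentiable (at y)" using that 1 2 by (auto simp: U_def)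
    have "(b has_derivative (\<lambda>u. vector [- D a1 y u, - D a2 y u, D a1 y u + D a2 y u])) (at y)"
    proof (rule has_derivative_vecI)
      fix i :: 3
      show "((\<lambda>y. b y $ i) has_derivative (\<lambda>u. vector [- D a1 y u, - D a2 y u, D a1 y u + D a2 y u] $ i)) (at y)"
        using exhaust_3[of i] D_has_derivative[OF a(1)] D_has_derivative[OF a(2)]
        by (auto simp: bn intro!: has_derivative_minus has_derivative_add)
    qed
    then show ?thesis by (auto simp: differentiable_def)
  qed
  have s: "b y $ 1 + b y $ 2 + b y $ 3 = 0" for y by (simp add: bn)
  have "range (xi (\<lambda>y. B y ** rotation (b y)) y) = model None" if y: "y \<in> U" for y
  proof (rule tgl_rotated_range[OF U(1,3) y db s])
    fix X assume X: "X \<in> range (xi B y)"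
    have yW: "y \<in> W1" "y \<in> W" using y 1 W1 by (auto simp: U_def)
    obtain t where t: "\<And>i. norm (t $ i) = 1" "Im (t $ 1 * t $ 2 * t $ 3) = 0"
       "range (xi B y) = {X. \<forall>i. Im (cnj (t $ i) * X $ i) = 0}"
      using curvature_invariant.flat_case[OF tgl_curvature_invariant[OF yW(2)] flatW1[OF yW(1)]] by auto
    have tt: "t$i * cnj (t$i) = 1" for i
      using t(1)[of i] complex_norm_square[of "t$i"] by (metis of_real_1 one_power2)
    \<comment> \<open>The phase of a real line is determined up to its sign.\<close>
    have sign: "cis (- a) = cnj (t $ i) \<or> cis (- a) = - cnj (t $ i)"
      if "xi B y v $ i \<noteq> 0" "xi B y v $ i = of_real (norm (xi B y v $ i)) * cis a" for i v a
    proof -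
      have "Im (cnj (t $ i) * xi B y v $ i) = 0" using t(3) by blast
      then have "Im (cnj (t $ i) * (of_real (norm (xi B y v $ i)) * cis a)) = 0" using that(2) by metis
      then have "norm (xi B y v $ i) * Im (cnj (t $ i) * cis a) = 0"
        by (simp add: algebra_simps)
      then have "Im (cnj (t $ i) * cis a) = 0" using that(1) by simp
      then have "cnj (t $ i) * cis a = 1 \<or> cnj (t $ i) * cis a = -1"
        by (intro unit_real) (simp_all add: norm_mult t(1))
      moreover have "(cnj (t $ i) * cis a) * cis (- a) = cnj (t $ i)" by (simp add: mult.assoc cis_mult)
      ultimately show ?thesis by (metis minus_mult_left mult_1 minus_equation_iff)
    qed
    have s1: "cis (b y $ 1) = cnj (t $ 1) \<or> cis (b y $ 1) = - cnj (t $ 1)"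
      unfolding bn using 1(5)[of y] y by (intro sign) (auto simp: U_def)
    have s2: "cis (b y $ 2) = cnj (t $ 2) \<or> cis (b y $ 2) = - cnj (t $ 2)"
      unfolding bn using 2(5)[of y] y by (intro sign) (auto simp: U_def)
    have "t $ 1 * t $ 2 * t $ 3 = 1 \<or> t $ 1 * t $ 2 * t $ 3 = -1"
      by (intro unit_real t(2)) (simp add: norm_mult t(1))
    moreover have "z * (w * cnj w) = cnj w \<or> z * (w * cnj w) = - cnj w" if "z * w = 1 \<or> z * w = -1" for z w :: complex
      unfolding mult.assoc[symmetric] using that by auto
    ultimately have "t $ 1 * t $ 2 * (t $ 3 * cnj (t $ 3)) = cnj (t $ 3) \<or> t $ 1 * t $ 2 * (t $ 3 * cnj (t $ 3)) = - cnj (t $ 3)"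
      by blast
    then have t3: "t $ 1 * t $ 2 = cnj (t $ 3) \<or> t $ 1 * t $ 2 = - cnj (t $ 3)" by (simp add: tt)
    have "cis (b y $ 3) = cnj (cis (b y $ 1)) * cnj (cis (b y $ 2))"
      by (simp add: bn cis_cnj cis_mult)
    then have s3: "cis (b y $ 3) = cnj (t $ 3) \<or> cis (b y $ 3) = - cnj (t $ 3)"
      using s1 s2 t3 by auto
    have sgn: "cis (b y $ i) = cnj (t $ i) \<or> cis (b y $ i) = - cnj (t $ i)" for i
      using exhaust_3[of i] s1 s2 s3 by auto
    have "Im (cis (b y $ i) * X $ i) = 0" for i
    proof -
      have "Im (cnj (t $ i) * X $ i) = 0" using X t(3) by blast
      then show ?thesis using sgn[of i] by (metis minus_mult_left uminus_complex.simps(2) neg_equal_zero minus_zero)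
    qed
    then show "phases (b y) * X \<in> model None"
      by (simp add: model_def real_space_def phases_def)
  qed
  then show ?thesis using that[OF U db s] by blast
qed

text \<open>In the curved normal form \<open>a\<close> is the phase of the product of the coordinates \<open>k + 1\<close> and \<open>k + 2\<close> of any
  tangent vector. That the normal form persists near \<open>x\<close>, with the same \<open>k\<close>, is seen by comparing the
  moduli of the coordinates of one tangent field.\<close>

lemma adapt_curved:
  assumes x: "x \<in> W" and XY: "X \<in> range (xi B x)" "Y \<in> range (xi B x)" "Im (cnj (X $ i) * Y $ i) \<noteq> 0"
  obtains U b k where "open U" "x \<in> U" "U \<subseteq> W" "\<And>y. y \<in> U \<Longrightarrow> b differentiable (at y)"
    "\<And>y. y \<in> U \<Longrightarrow> b y $ 1 + b y $ 2 + b y $ 3 = 0"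
    "\<And>y. y \<in> U \<Longrightarrow> range (xi (\<lambda>y. B y ** rotation (b y)) y) = model (Some k)"
proof -
  obtain k a where ka: "norm a = 1" "range (xi B x) = {X. X $ (k+2) = a * cnj (X $ (k+1)) \<and> Re (a * X $ k) = 0}"
    using curvature_invariant.curved_case[OF tgl_curvature_invariant[OF x] XY] by auto
  note dist = cyclic_distinct[of k] cyclic_distinct[of k, symmetric]
  have "(\<chi> i. if i = k then 0 else if i = k+1 then 1 else a) \<in> range (xi B x)"
    "(\<chi> i. if i = k then 0 else if i = k+1 then \<i> else - \<i> * a) \<in> range (xi B x)"
    unfolding ka(2) using dist by auto
  then obtain u v where u: "xi B x u = (\<chi> i. if i = k then 0 else if i = k+1 then 1 else a)"
    and v: "xi B x v = (\<chi> i. if i = k then 0 else if i = k+1 then \<i> else - \<i> * a)"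
    by (auto simp del: vec_lambda_unique)
  define W1 where "W1 = {y \<in> W. norm (xi B y u $ k) < norm (xi B y u $ (k+1))} \<inter>
    {y \<in> W. norm (xi B y u $ k) < norm (xi B y u $ (k+2))} \<inter>
    {y \<in> W. 0 < Im (cnj (xi B y u $ (k+1)) * xi B y v $ (k+1))}"
  note o = SU3_map_D(1)[OF tgl_map[OF B]]
  have pos: "open {y \<in> W. f y < g y}" if "continuous_on W f" "continuous_on W g" for f g :: "real^3 \<Rightarrow> real"
  proof -
    have "{y \<in> W. f y < g y} = W \<inter> (\<lambda>y. g y - f y) -` {0<..}" by auto
    then show ?thesis
      using continuous_open_preimage[OF continuous_on_diff[OF that(2,1)] o] by simp
  qed
  have W1: "open W1" "W1 \<subseteq> W"
    unfolding W1_def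
    by (intro open_Int pos continuous_intros continuous_on_Im continuous_on_cnj tgl_xi_continuous) auto
  have xW1: "x \<in> W1" using x dist ka(1) by (simp add: W1_def u v)
  have form: "\<exists>a. norm a = 1 \<and> range (xi B y) = {X. X $ (k+2) = a * cnj (X $ (k+1)) \<and> Re (a * X $ k) = 0}"
    if y: "y \<in> W1" for y
  proof -
    have yW: "y \<in> W" using y W1(2) by blast
    have "Im (cnj (xi B y u $ (k+1)) * xi B y v $ (k+1)) \<noteq> 0" using y unfolding W1_def by auto
    from curvature_invariant.curved_case[OF tgl_curvature_invariant[OF yW] rangeI[of _ u] rangeI[of _ v] this]
    obtain l a where la: "norm a = 1" "range (xi B y) = {X. X $ (l+2) = a * cnj (X $ (l+1)) \<and> Re (a * X $ l) = 0}"
      by auto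
    have "norm (xi B y u $ (l+2)) = norm (xi B y u $ (l+1))"
    proof -
      have "xi B y u \<in> range (xi B y)" by blast
      then show ?thesis unfolding la(2) by (simp add: norm_mult la(1))
    qed
    then have "l = k"
      using y exhaust_3[of k] exhaust_3[of l] by (auto simp: W1_def numeral_mod_3)
    then show ?thesis using la by blast
  qed
  define f where "f y = xi B y u $ (k+1) * xi B y u $ (k+2)" for y
  have "f x \<noteq> 0" using dist ka(1) by (auto simp: f_def u)
  moreover have "f differentiable (at y)" if "y \<in> W1" for y
    unfolding f_def using that W1(2) by (intro differentiable_mult tgl_xi_differentiable) auto
  ultimately obtain U c where U: "open U" "x \<in> U" "U \<subseteq> W1" "\<And>y. y \<in> U \<Longrightarrow> c differentiable (at y)"
    "\<And>y. y \<in> U \<Longrightarrow> f y \<noteq> 0 \<and> f y = of_real (norm (f y)) * cis (c y)"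
    using local_argument[OF W1(1) xW1, of f] by metis
  define b where "b y = (\<chi> i. if i = k then c y else - c y / 2)" for y
  have db: "b differentiable (at y)" if "y \<in> U" for y
  proof -
    have "(b has_derivative (\<lambda>u. \<chi> i. if i = k then D c y u else - D c y u / 2)) (at y)"
      using D_has_derivative[OF U(4)[OF that]]
      by (intro has_derivative_vecI, rename_tac i, case_tac "i = k") (auto simp: b_def intro!: derivative_eq_intros)
    then show ?thesis by (auto simp: differentiable_def)
  qed
  have s: "b y $ 1 + b y $ 2 + b y $ 3 = 0" for y
    using exhaust_3[of k] by (auto simp: b_def)
  have UW: "U \<subseteq> W" using U W1 by auto
  have "range (xi (\<lambda>y. B y ** rotation (b y)) y) = model (Some k)" if y: "y \<in> U" for y
  proof (rule tgl_rotated_range[OF U(1) UW y db s])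
    obtain a where a: "norm a = 1" "range (xi B y) = {X. X $ (k+2) = a * cnj (X $ (k+1)) \<and> Re (a * X $ k) = 0}"
      using form y U(3) by blast
    have ac: "a = cis (c y)"
    proof -
      let ?p = "xi B y u $ (k+1)"
      have "xi B y u \<in> range (xi B y)" by blast
      then have "f y = a * (?p * cnj ?p)" unfolding a(2) by (simp add: f_def)
      then have e: "f y = of_real ((norm ?p)\<^sup>2) * a" unfolding complex_norm_square by (simp add: mult.commute)
      then have "norm (f y) = (norm ?p)\<^sup>2" using a(1) by (simp add: norm_mult norm_power)
      then show ?thesis using e U(5)[OF y] by (metis mult_cancel_left mult_eq_0_iff)
    qed
    fix X assume "X \<in> range (xi B y)"
    then have X: "X $ (k+2) = a * cnj (X $ (k+1))" "Re (a * X $ k) = 0" unfolding a(2) by auto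
    have bk: "b y $ k = c y" "b y $ (k+1) = - c y / 2" "b y $ (k+2) = - c y / 2"
      using dist by (simp_all add: b_def)
    have "cis (- c y / 2) * cis (c y) = cnj (cis (- c y / 2))" by (simp add: cis_mult cis_cnj)
    then have "cis (- c y / 2) * (a * cnj (X $ (k+1))) = cnj (cis (- c y / 2) * X $ (k+1))"
      by (simp add: ac mult.assoc[symmetric])
    then show "phases (b y) * X \<in> model (Some k)"
      unfolding model_def sphere_space_def option.case mem_Collect_eq vector_mult_component phases_def vec_lambda_beta bk X(1)
      using X(2) by (simp add: ac)
  qed
  then show ?thesis using that[OF U(1,2) UW db s] by blast
qed

end

definition axis_vec :: "3 \<Rightarrow> complex^3" where
  "axis_vec k = (\<chi> i. if i = k + 2 then 0 else 1)"

text \<open>The subgroup of \<open>SU(3)\<close> whose orbit through the standard flag has the model as its tangent space,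
  taken so large that it contains the torus elements preserving the model: the scalar multiples of real
  matrices, and the stabilizers of complex lines.\<close>

definition model_group :: "3 option \<Rightarrow> mat3 set" where
  "model_group m = (case m of None \<Rightarrow> {A \<in> SU3. \<exists>z. \<forall>i j. A $ i $ j = z * cnj (A $ i $ j)}
     | Some k \<Rightarrow> {A \<in> SU3. \<exists>c. A *v axis_vec k = c *s axis_vec k})"

definition model_algebra :: "3 option \<Rightarrow> mat3 set" where
  "model_algebra m = (case m of None \<Rightarrow> {X. \<forall>i j. Im (X $ i $ j) = 0}
     | Some k \<Rightarrow> {X. \<exists>c. X *v axis_vec k = c *s axis_vec k})"

lemma model_group_SU3: "A \<in> model_group m \<Longrightarrow> A \<in> SU3"
  by (cases m) (auto simp: model_group_def)

lemma model_group_mult: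
  assumes "A \<in> model_group m" "B \<in> model_group m"
  shows "A ** B \<in> model_group m"
proof (cases m)
  case None
  obtain z w where z: "\<forall>i j. A $ i $ j = z * cnj (A $ i $ j)" and w: "\<forall>i j. B $ i $ j = w * cnj (B $ i $ j)"
    using assms by (auto simp: model_group_def None)
  have *: "A $ i $ k * B $ k $ j = (z * w) * cnj (A $ i $ k * B $ k $ j)" for i j k
    using z w by (metis (no_types, lifting) complex_cnj_mult mult.assoc mult.left_commute)
  have "(A ** B) $ i $ j = (z * w) * cnj ((A ** B) $ i $ j)" for i j
    unfolding mm_nth complex_cnj_add distrib_left by (intro arg_cong2[where f = "(+)"] *)
  then show ?thesis using assms[THEN model_group_SU3] by (auto simp: model_group_def None SU3_mult)
next
  case (Some k)
  obtain z w where z: "A *v axis_vec k = z *s axis_vec k" and w: "B *v axis_vec k = w *s axis_vec k"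
    using assms by (auto simp: model_group_def Some)
  have "(A ** B) *v axis_vec k = (w * z) *s axis_vec k"
    by (simp add: matrix_vector_mul_assoc[symmetric] w z vector_scalar_commute)
  then show ?thesis using assms[THEN model_group_SU3] by (auto simp: model_group_def Some SU3_mult)
qed

lemma model_group_ct:
  assumes "A \<in> model_group m"
  shows "conj_transpose A \<in> model_group m"
proof (cases m)
  case None
  obtain z where z: "\<forall>i j. A $ i $ j = z * cnj (A $ i $ j)"
    using assms by (auto simp: model_group_def None)
  have "conj_transpose A $ i $ j = cnj z * cnj (conj_transpose A $ i $ j)" for i j
    using z by (metis complex_cnj_mult ct_nth)
  then show ?thesis using SU3_ct[OF assms[THEN model_group_SU3]]
    unfolding model_group_def None option.case mem_Collect_eq by blast
next
  case (Some k)
  obtain z where z: "A *v axis_vec k = z *s axis_vec k"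
    using assms by (auto simp: model_group_def Some)
  note S = assms[THEN model_group_SU3]
  have e: "axis_vec k = z *s (conj_transpose A *v axis_vec k)"
    using arg_cong[OF z, of "(*v) (conj_transpose A)"]
    by (simp add: matrix_vector_mul_assoc SU3_left[OF S] vector_scalar_commute)
  have "axis_vec k $ k = 1" using cyclic_distinct(2)[of k] by (simp add: axis_vec_def)
  then have "z \<noteq> 0" using arg_cong[OF e, of "\<lambda>x. x $ k"] by auto
  then have "conj_transpose A *v axis_vec k = inverse z *s axis_vec k"
    using arg_cong[OF e, of "(*s) (inverse z)"] by (simp add: vector_smult_assoc)
  then show ?thesis using S by (auto simp: model_group_def Some SU3_ct)
qed

lemma subspace_model: "subspace (model m)"
  by (cases m) (auto simp: model_def real_space_def sphere_space_def subspace_def complex_eq_iff)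

lemma D_in_model:
  assumes "open U" "x \<in> U" "\<And>y. y \<in> U \<Longrightarrow> g y \<in> model m" "g differentiable (at x)"
  shows "D g x u \<in> model m"
proof -
  have 0: "L (D g x u) = 0" if "bounded_linear L" "\<And>X. X \<in> model m \<Longrightarrow> L X = 0"
    for L :: "complex^3 \<Rightarrow> complex"
  proof -
    have "D (\<lambda>y. L (g y)) x u = D (\<lambda>y. 0) x u"
      using D_cong[OF assms(1,2), of "\<lambda>y. L (g y)" "\<lambda>y. 0"] that(2) assms(3) by simp
    then show ?thesis by (simp add: D_bounded_linear[OF that(1) assms(4)])
  qed
  have l: "bounded_linear (\<lambda>X::complex^3. of_real (Im (X $ i)) :: complex)"
    "bounded_linear (\<lambda>X::complex^3. of_real (Re (X $ i)) :: complex)"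
    "bounded_linear (\<lambda>X::complex^3. X $ i - cnj (X $ j))" for i j
    by (simp_all add: linear_conv_bounded_linear[symmetric] linear_iff complex_eq_iff algebra_simps)
  show ?thesis
    using 0[OF l(1)] 0[OF l(2)] 0[OF l(3)]
    by (cases m) (auto simp: model_def real_space_def sphere_space_def)
qed

text \<open>The diagonal of \<open>X\<close> preserves the model. For \<open>\<real>\<^sup>3\<close> this makes it a multiple of the identity, hence zero;
  in the other cases it kills the real line of the model, and then \<open>axis_vec k\<close> is an eigenvector of \<open>X\<close>.\<close>

lemma weights_model:
  assumes X: "skew X" "X$1$1 + X$2$2 + X$3$3 = 0" "coords X \<in> model m" 
    and w: "\<And>Y. Y \<in> model m \<Longrightarrow> weights X * Y \<in> model m"
  shows "X \<in> model_algebra m"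
proof (cases m)
  case None
  have "(\<chi> i. 1) \<in> model m" by (simp add: None model_def real_space_def)
  then have "Im (weights X $ i) = 0" for i using w by (fastforce simp: None model_def real_space_def)
  then have "weights X $ i = 0" for i using Re_weights[OF X(1)] by (simp add: complex_eq_iff)
  from this[of 1] this[of 2] have d: "X$2$2 = X$1$1" "X$3$3 = X$1$1" by simp_all
  then have "X$1$1 = 0" using X(2) by simp
  then have "Im (X$i$j) = 0" for i j
    using skew_nth[OF X(1)] X(3) d exhaust_3[of i] exhaust_3[of j]
    by (auto simp: None model_def real_space_def forall_3)
  then show ?thesis by (simp add: None model_algebra_def)
next
  case (Some k)
  have "axis k \<i> \<in> model m"
    using cyclic_distinct[of k] by (auto simp: Some model_def sphere_space_def axis_def)
  then have "Re ((weights X * axis k \<i>) $ k) = 0"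
    using w[of "axis k \<i>"] by (simp only: Some model_def sphere_space_def option.case mem_Collect_eq)
  then have "Re (weights X $ k * \<i>) = 0" by (simp add: axis_def)
  then have wk: "weights X $ k = 0" using Re_weights[OF X(1), of k] by (simp add: complex_eq_iff)
  have m: "coords X $ (k+2) = cnj (coords X $ (k+1))" "Re (coords X $ k) = 0"
    using X(3) by (auto simp: Some model_def sphere_space_def)
  have z: "cnj (coords X $ k) = - coords X $ k" using m(2) by (simp add: complex_eq_iff)
  have "X *v axis_vec k = (X $ (k+1) $ (k+1) + coords X $ k) *s axis_vec k"
    using exhaust_3[of k]
  proof (elim disjE)
    assume k: "k = 1"
    show ?thesis using wk m(1) z skew_nth(1-3)[OF X(1)] unfolding k
      by (simp add: c3_eq_iff mv_nth axis_vec_def numeral_mod_3)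
  next
    assume k: "k = 2"
    show ?thesis using wk m(1) z skew_nth(1-3)[OF X(1)] unfolding k
      by (simp add: c3_eq_iff mv_nth axis_vec_def numeral_mod_3)
  next
    assume k: "k = 3"
    show ?thesis using wk m(1) z skew_nth(1-3)[OF X(1)] unfolding k
      by (simp add: c3_eq_iff mv_nth axis_vec_def numeral_mod_3)
  qed
  then show ?thesis unfolding Some model_algebra_def option.case mem_Collect_eq by (rule exI)
qed

text \<open>In an adapted lift both the covariant and the ordinary derivatives of \<open>xi\<close> stay in the model, so the
  connection form preserves it.\<close>

lemma adapted_algebra:
  assumes B: "tgl W B" and U: "open U" "U \<subseteq> W" "x \<in> U"
    and b: "\<And>y. y \<in> U \<Longrightarrow> b differentiable (at y)" "\<And>y. y \<in> U \<Longrightarrow> b y $ 1 + b y $ 2 + b y $ 3 = 0"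
    and m: "\<And>y. y \<in> U \<Longrightarrow> range (xi (\<lambda>y. B y ** rotation (b y)) y) = model m"
  shows "mc (\<lambda>y. B y ** rotation (b y)) x u \<in> model_algebra m"
proof -
  let ?B = "\<lambda>y. B y ** rotation (b y)"
  note map = SU3_map_subset[OF tgl_map[OF B] U(1,2)]
  note g = gauge[OF map b U(3)]
  have diff: "SU3_diff U ?B" by (rule g(1))
  show ?thesis
  proof (rule weights_model)
    show "skew (mc ?B x u)" by (rule skew_mc[OF diff U(3)])
    show "mc ?B x u $ 1 $ 1 + mc ?B x u $ 2 $ 2 + mc ?B x u $ 3 $ 3 = 0" by (rule trace_mc[OF diff U(3)])
    show "coords (mc ?B x u) \<in> model m" using m[OF U(3)] unfolding xi_def by blast
    fix Y assume "Y \<in> model m"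
    then obtain v where Y: "Y = xi ?B x v" using m[OF U(3)] by blast
    have "canon B x u v \<in> range (xi B x)" using tgl_canon[OF B] U by blast
    then obtain v' where "canon B x u v = xi B x v'" by blast
    then have "canon ?B x u v = xi ?B x v'"
      using gauge(3)[OF map b U(3), of u v] gauge(2)[OF map b U(3), of v'] by simp
    then have 1: "canon ?B x u v \<in> model m" using m[OF U(3)] by blast
    have "(\<lambda>y. phases (b y)) differentiable (at x)"
      using phases_derivative[OF map b U(3)] by (auto simp: differentiable_def)
    then have "(\<lambda>y. phases (b y) * xi B y v) differentiable (at x)"
      by (rule differentiable_bilinear[OF bounded_bilinear_vmult _ xi_differentiable(1)[OF map U(3)]])
    then have "(\<lambda>y. xi ?B y v) differentiable (at x)"
      using differentiable_cong[OF U(1,3), of "\<lambda>y. xi ?B y v" "\<lambda>y. phases (b y) * xi B y v"]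
        gauge(2)[OF map b] by blast
    note d = this
    have "D (\<lambda>y. xi ?B y v) x u \<in> model m"
      by (rule D_in_model[OF U(1,3) _ d]) (use m in blast)
    then have "canon ?B x u v - D (\<lambda>y. xi ?B y v) x u \<in> model m"
      by (rule subspace_diff[OF subspace_model 1])
    then show "weights (mc ?B x u) * Y \<in> model m" by (simp add: Y canon_def)
  qed
qed

subsection \<open>Adapted lifts are tangent to cosets of the model group\<close>

lemma constant_on_convex:
  assumes "convex U" "open U" "x \<in> U" "y \<in> U" "\<And>z. z \<in> U \<Longrightarrow> (f has_derivative (\<lambda>h. 0)) (at z)"
  shows "f y = f x"
  by (rule has_derivative_zero_unique[OF assms(1) _ assms(4,3)]) (use assms(5) has_derivative_at_withinI in blast)

text \<open>If \<open>G\<^sup>-\<^sup>1 dG\<close> is real then the matrix \<open>cnj G ** G\<^sup>-\<^sup>1\<close> is constant.\<close>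

lemma real_coset:
  assumes B: "SU3_diff U B" and U: "convex U" "x \<in> U" "y \<in> U"
    and r: "\<And>z u i j. z \<in> U \<Longrightarrow> Im (mc B z u $ i $ j) = 0"
  shows "Im ((conj_transpose (B x) ** B y) $ i $ j) = 0"
proof -
  define G where "G z = conj_transpose (B x) ** B z" for z
  define cj :: "mat3 \<Rightarrow> mat3" where "cj A = (\<chi> i j. cnj (A $ i $ j))" for A
  have cj: "bounded_linear cj"
    by (simp add: linear_conv_bounded_linear[symmetric] linear_iff cj_def mat3_eq_iff)
  have cj_mult: "cj (A ** A') = cj A ** cj A'" for A A' by (simp add: cj_def mat3_eq_iff mm_nth)
  have GS: "G z \<in> SU3" if "z \<in> U" for z
    using SU3_diff_D(2)[OF B] that U by (simp add: G_def SU3_mult SU3_ct)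
  have dG: "(G has_derivative (\<lambda>u. G z ** mc B z u)) (at z)" if "z \<in> U" for z
  proof -
    have "(G has_derivative (\<lambda>u. conj_transpose (B x) ** D B z u)) (at z)"
      unfolding G_def
      using bounded_linear.has_derivative[OF bounded_bilinear.bounded_linear_right[OF bounded_bilinear_mm]
          D_has_derivative[OF SU3_diff_D(3)[OF B that]]] .
    then show ?thesis by (simp add: D_mc[OF B that] G_def matrix_mul_assoc)
  qed
  have "((\<lambda>z. cj (G z) ** conj_transpose (G z)) has_derivative (\<lambda>u. 0)) (at z)" if z: "z \<in> U" for z
  proof -
    have "cj (mc B z u) = mc B z u" "conj_transpose (mc B z u) = - mc B z u" for u
    proof -
      show "cj (mc B z u) = mc B z u"
        unfolding cj_def mat3_eq_iff by (simp add: complex_eq_iff r[OF z])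
      show "conj_transpose (mc B z u) = - mc B z u"
        using skew_mc[OF B z] unfolding skew_def .
    qed
    then have "cj (G z) ** conj_transpose (G z ** mc B z u) + cj (G z ** mc B z u) ** conj_transpose (G z) = 0" for u
      by (simp add: cj_mult ct_mult mm_minus matrix_mul_assoc)
    then show ?thesis
      using bounded_bilinear.FDERIV[OF bounded_bilinear_mm bounded_linear.has_derivative[OF cj dG[OF z]]
          bounded_linear.has_derivative[OF bounded_linear_ct dG[OF z]]] by simp
  qed
  then have "cj (G y) ** conj_transpose (G y) = cj (G x) ** conj_transpose (G x)"
    by (rule constant_on_convex[OF U(1) SU3_diff_D(1)[OF B] U(2,3)])
  also have "G x = mat 1" using SU3_left[OF SU3_diff_D(2)[OF B U(2)]] by (simp add: G_def)
  also have "cj (mat 1) ** conj_transpose (mat 1) = mat 1" by (simp add: cj_def mat3_eq_iff mm_nth mat1_nth forall_3)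
  finally have "cj (G y) ** conj_transpose (G y) ** G y = G y" by simp
  then have "cj (G y) = G y" by (simp add: SU3_cancel[OF GS[OF U(3)]])
  then have "cnj (G y $ i $ j) = G y $ i $ j" unfolding cj_def mat3_eq_iff by simp
  then have "Im (G y $ i $ j) = 0" by (simp add: complex_eq_iff)
  then show ?thesis by (simp add: G_def)
qed

text \<open>If \<open>G\<^sup>-\<^sup>1 dG\<close> fixes the line spanned by \<open>e\<close> then the projection to the line spanned by \<open>G e\<close> is
  constant.\<close>

lemma line_coset:
  assumes B: "SU3_diff U B" and U: "convex U" "x \<in> U" "y \<in> U"
    and r: "\<And>z u. z \<in> U \<Longrightarrow> \<exists>c. mc B z u *v axis_vec k = c *s axis_vec k"
  shows "\<exists>c. (conj_transpose (B x) ** B y) *v axis_vec k = c *s axis_vec k"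
proof -
  let ?e = "axis_vec k"
  define g where "g z = (conj_transpose (B x) ** B z) *v ?e" for z
  have dg: "(g has_derivative (\<lambda>u. (conj_transpose (B x) ** B z) *v (mc B z u *v ?e))) (at z)" if "z \<in> U" for z
  proof -
    have "(g has_derivative (\<lambda>u. (conj_transpose (B x) ** D B z u) *v ?e)) (at z)"
      unfolding g_def
      using bounded_linear.has_derivative[OF bounded_bilinear.bounded_linear_left[OF bounded_bilinear_mv]
          bounded_linear.has_derivative[OF bounded_bilinear.bounded_linear_right[OF bounded_bilinear_mm]
          D_has_derivative[OF SU3_diff_D(3)[OF B that]]]] .
    then show ?thesis by (simp add: D_mc[OF B that] matrix_mul_assoc matrix_vector_mul_assoc)
  qed
  have const: "g y $ i * cnj (g y $ j) = g x $ i * cnj (g x $ j)" for i j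
  proof (rule constant_on_convex[OF U(1) SU3_diff_D(1)[OF B] U(2,3)])
    fix z assume z: "z \<in> U"
    obtain c where c: "mc B z u *v ?e = c u *s ?e" for u using r[OF z] by metis
    \<comment> \<open>The eigenvalue is imaginary, as the matrix is skew-Hermitian.\<close>
    have Re: "Re (c u) = 0" for u
    proof -
      note s = skew_nth[OF skew_mc[OF B z, of u]]
      have "(mc B z u *v ?e) $ k = c u" "(mc B z u *v ?e) $ (k+1) = c u"
        unfolding c vector_smult_component using cyclic_distinct[of k] by (simp_all add: axis_vec_def)
      then have "2 * Re (c u) = Re ((mc B z u *v ?e) $ k + (mc B z u *v ?e) $ (k+1))" by simp
      also have "\<dots> = 0"
        using exhaust_3[of k]
      proof (elim disjE)
        assume k: "k = 1"
        show ?thesis using s unfolding k by (simp add: mv_nth axis_vec_def numeral_mod_3)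
      next
        assume k: "k = 2"
        show ?thesis using s unfolding k by (simp add: mv_nth axis_vec_def numeral_mod_3)
      next
        assume k: "k = 3"
        show ?thesis using s unfolding k by (simp add: mv_nth axis_vec_def numeral_mod_3)
      qed
      finally show ?thesis by simp
    qed
    have gz: "(conj_transpose (B x) ** B z) *v (mc B z u *v ?e) = c u *s g z" for u
      by (simp add: c g_def vector_scalar_commute)
    have d: "((\<lambda>z. g z $ i) has_derivative (\<lambda>u. c u * g z $ i)) (at z)" for i
      using bounded_linear.has_derivative[OF bounded_linear_vec_nth dg[OF z]] by (simp add: gz)
    have "((\<lambda>z. g z $ i * cnj (g z $ j)) has_derivative
        (\<lambda>u. g z $ i * cnj (c u * g z $ j) + c u * g z $ i * cnj (g z $ j))) (at z)"
      by (rule has_derivative_mult[OF d bounded_linear.has_derivative[OF bounded_linear_cnj d]])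
    moreover have "g z $ i * cnj (c u * g z $ j) + c u * g z $ i * cnj (g z $ j) = 0" for u
    proof -
      have "cnj (c u) = - c u" using Re by (simp add: complex_eq_iff)
      then show ?thesis by simp
    qed
    ultimately show "((\<lambda>z. g z $ i * cnj (g z $ j)) has_derivative (\<lambda>h. 0)) (at z)" by simp
  qed
  have gx: "g x = ?e" using SU3_left[OF SU3_diff_D(2)[OF B U(2)]] by (simp add: g_def)
  have k: "?e $ k = 1" using cyclic_distinct(2)[of k] by (simp add: axis_vec_def)
  have 1: "g y $ k * cnj (g y $ k) = 1" using const[of k k] by (simp add: gx k)
  have gy: "g y $ i = g y $ k * ?e $ i" for i
  proof -
    have "g y $ i = g y $ i * cnj (g y $ k) * g y $ k" using 1 by (simp add: mult_ac)
    also have "g y $ i * cnj (g y $ k) = ?e $ i" using const[of i k] by (simp add: gx k)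
    finally show ?thesis by simp
  qed
  have "g y = g y $ k *s ?e"
    unfolding vec_eq_iff vector_smult_component by (rule allI, rule gy)
  then show ?thesis unfolding g_def by blast
qed

lemma model_coset:
  assumes B: "SU3_diff U B" and U: "convex U" "x \<in> U" "y \<in> U"
    and r: "\<And>z u. z \<in> U \<Longrightarrow> mc B z u \<in> model_algebra m"
  shows "conj_transpose (B x) ** B y \<in> model_group m"
proof -
  have S: "conj_transpose (B x) ** B y \<in> SU3"
    using SU3_diff_D(2)[OF B] U by (simp add: SU3_mult SU3_ct)
  show ?thesis
  proof (cases m)
    case None
    have "Im ((conj_transpose (B x) ** B y) $ i $ j) = 0" for i j
      by (rule real_coset[OF B U]) (use r in \<open>auto simp: None model_algebra_def\<close>)
    then have "(conj_transpose (B x) ** B y) $ i $ j = 1 * cnj ((conj_transpose (B x) ** B y) $ i $ j)" for i j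
      by (simp add: complex_eq_iff)
    then show ?thesis using S unfolding model_group_def None by fastforce
  next
    case (Some k)
    show ?thesis
      using line_coset[OF B U, of k] r S by (auto simp: Some model_group_def model_algebra_def)
  qed
qed

theorem adapted_lift:
  assumes B: "tgl W B" and x: "x \<in> W"
  obtains U T m where "open U" "convex U" "x \<in> U" "U \<subseteq> W" "\<And>y. y \<in> U \<Longrightarrow> T y \<in> torus"
    "SU3_diff U (\<lambda>y. B y ** T y)" "\<And>y. y \<in> U \<Longrightarrow> range (xi (\<lambda>y. B y ** T y) y) = model m"
    "\<And>y z. y \<in> U \<Longrightarrow> z \<in> U \<Longrightarrow> conj_transpose (B y ** T y) ** (B z ** T z) \<in> model_group m"
proof -
  have "\<exists>U b m. open U \<and> x \<in> U \<and> U \<subseteq> W \<and> (\<forall>y\<in>U. b differentiable (at y)) \<and>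
    (\<forall>y\<in>U. b y $ 1 + b y $ 2 + b y $ 3 = 0) \<and> (\<forall>y\<in>U. range (xi (\<lambda>y. B y ** rotation (b y)) y) = model m)"
  proof (cases "\<forall>X\<in>range (xi B x). \<forall>Y\<in>range (xi B x). \<forall>i. Im (cnj (X $ i) * Y $ i) = 0")
    case True
    show ?thesis
    proof (rule adapt_flat[OF B x])
      show "Im (cnj (X $ i) * Y $ i) = 0" if "X \<in> range (xi B x)" "Y \<in> range (xi B x)" for X Y i
        using True that by blast
      fix U b assume "open U" "x \<in> U" "U \<subseteq> W" "\<And>y. y \<in> U \<Longrightarrow> b differentiable (at y)"
        "\<And>y. y \<in> U \<Longrightarrow> b y $ 1 + b y $ 2 + b y $ 3 = 0"
        "\<And>y. y \<in> U \<Longrightarrow> range (xi (\<lambda>y. B y ** rotation (b y)) y) = model None"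
      then show ?thesis by (intro exI[of _ U] exI[of _ b] exI[of _ None]) simp
    qed
  next
    case False
    then obtain X Y i where XY: "X \<in> range (xi B x)" "Y \<in> range (xi B x)" "Im (cnj (X $ i) * Y $ i) \<noteq> 0" by blast
    show ?thesis
    proof (rule adapt_curved[OF B x XY])
      fix U b k assume "open U" "x \<in> U" "U \<subseteq> W" "\<And>y. y \<in> U \<Longrightarrow> b differentiable (at y)"
        "\<And>y. y \<in> U \<Longrightarrow> b y $ 1 + b y $ 2 + b y $ 3 = 0"
        "\<And>y. y \<in> U \<Longrightarrow> range (xi (\<lambda>y. B y ** rotation (b y)) y) = model (Some k)"
      then show ?thesis by (intro exI[of _ U] exI[of _ b] exI[of _ "Some k"]) simp
    qed
  qed
  then obtain V b m where V: "open V" "x \<in> V" "V \<subseteq> W" and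
    b: "\<And>y. y \<in> V \<Longrightarrow> b differentiable (at y)" "\<And>y. y \<in> V \<Longrightarrow> b y $ 1 + b y $ 2 + b y $ 3 = 0"
    and m: "\<And>y. y \<in> V \<Longrightarrow> range (xi (\<lambda>y. B y ** rotation (b y)) y) = model m" by blast
  obtain e where e: "e > 0" "ball x e \<subseteq> V" using V openE by blast
  let ?B = "\<lambda>y. B y ** rotation (b y)"
  have "SU3_diff V ?B"
    using gauge(1)[OF SU3_map_subset[OF tgl_map[OF B] V(1,3)] b V(2)] .
  then have d: "SU3_diff (ball x e) ?B" by (rule SU3_diff_subset) (use e in auto)
  have "conj_transpose (?B y) ** ?B z \<in> model_group m" if "y \<in> ball x e" "z \<in> ball x e" for y z
    by (rule model_coset[OF d _ that]) (use adapted_algebra[OF B V(1,3) _ b m] e in auto)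
  moreover have "range (xi ?B y) = model m" if "y \<in> ball x e" for y
    by (rule m) (use e that in blast)
  moreover have "x \<in> ball x e" "ball x e \<subseteq> W" using e V by auto
  ultimately show ?thesis
    using that[of "ball x e" "\<lambda>y. rotation (b y)" m] d rotation_torus open_ball convex_ball by blast
qed

text \<open>The models are pairwise inequivalent under the torus, and the torus elements which preserve one
  of them lie in its group.\<close>

lemma model_unique:
  assumes T: "T \<in> torus" and sub: "\<And>X. X \<in> model m \<Longrightarrow> twist T * X \<in> model n"
  shows "m = n" "T \<in> model_group m"
proof -
  define t where "t = twist T"
  have nt: "t $ i \<noteq> 0" "norm (t $ i) = 1" for i using twist_norm[OF T, of i] by (auto simp: t_def)
  have tt: "t $ i * cnj (t $ i) = 1" "cnj (t $ i) * t $ i = 1" for i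
    using nt(2)[of i] complex_norm_square[of "t $ i"] by (simp_all add: mult.commute)
  have u: "T $ i $ i * cnj (T $ i $ i) = 1" "cnj (T $ i $ i) * T $ i $ i = 1" for i
    using torus_norm[OF T, of i] complex_norm_square[of "T $ i $ i"] by (simp_all add: mult.commute)
  have off: "T $ i $ j = 0" if "i \<noteq> j" for i j using T that by (simp add: torus_def)
  have TS: "T \<in> SU3" using T by (simp add: torus_def)
  have prod: "t $ k * (t $ (k+1) * t $ (k+2)) = 1" for k
  proof -
    have "t $ 1 * (t $ 2 * t $ 3) = (T$1$1 * cnj (T$1$1)) * (T$2$2 * cnj (T$2$2)) * (T$3$3 * cnj (T$3$3))"
      by (simp add: t_def mult_ac)
    then have "t $ 1 * (t $ 2 * t $ 3) = 1" by (simp add: u)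
    then show ?thesis using exhaust_3[of k] by (auto simp: numeral_mod_3 mult_ac)
  qed
  have "m = n \<and> T \<in> model_group m"
  proof (cases m)
    case None
    have one: "axis i 1 \<in> model m" for i by (simp add: None model_def real_space_def axis_def)
    have n: "n = None"
    proof (rule ccontr)
      assume "n \<noteq> None"
      then obtain k where k: "n = Some k" by auto
      have "t * axis (k+1) 1 \<in> model n" using sub[OF one] by (simp add: t_def)
      then show False using nt(1)[of "k+1"] cyclic_distinct[of k]
        by (simp add: k model_def sphere_space_def axis_def)
    qed
    have "Im (t $ i) = 0" for i
    proof -
      have "t * axis i 1 \<in> model n" using sub[OF one] by (simp add: t_def)
      then have "Im ((t * axis i 1) $ i) = 0" by (simp only: n model_def real_space_def option.case mem_Collect_eq)
      then show ?thesis by (simp add: axis_def)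
    qed
    then have r: "cnj (t $ i) = t $ i" for i by (simp add: complex_eq_iff)
    have r1: "cnj (T$1$1) * T$2$2 = cnj (T$2$2) * T$1$1" and r3: "cnj (T$3$3) * T$1$1 = cnj (T$1$1) * T$3$3"
      using r[of 1] r[of 3] by (simp_all add: t_def mult.commute)
    have "T$2$2 = T$1$1 * T$1$1 * cnj (T$2$2)"
    proof -
      have "T$2$2 = T$1$1 * (cnj (T$1$1) * T$2$2)" using u[of 1] by (simp add: mult.assoc[symmetric])
      then show ?thesis by (simp add: r1 mult_ac)
    qed
    moreover have "T$3$3 = T$1$1 * T$1$1 * cnj (T$3$3)"
    proof -
      have "T$3$3 = T$1$1 * (cnj (T$1$1) * T$3$3)" using u[of 1] by (simp add: mult.assoc[symmetric])
      then show ?thesis by (simp add: r3[symmetric] mult_ac)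
    qed
    moreover have "T$1$1 = T$1$1 * T$1$1 * cnj (T$1$1)" using u[of 1] by (simp add: mult.assoc)
    ultimately have "T$i$j = (T$1$1 * T$1$1) * cnj (T$i$j)" for i j
      using off[of i j] exhaust_3[of i] by (cases "i = j") auto
    then show ?thesis using TS n unfolding None model_group_def by auto
  next
    case (Some k)
    have ik: "axis k \<i> \<in> model m"
      using cyclic_distinct[of k] by (auto simp: Some model_def sphere_space_def axis_def)
    have ak: "(\<chi> i. if i = k then 0 else if i = k+1 then z else cnj z) \<in> model m" for z
      using cyclic_distinct[of k] by (auto simp: Some model_def sphere_space_def)
    have n: "n \<noteq> None"
    proof
      assume n: "n = None"
      have "Im (t $ (k+1) * z) = 0" for z
      proof -
        have "Im ((t * (\<chi> i. if i = k then 0 else if i = k+1 then z else cnj z)) $ (k+1)) = 0"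
          using sub[OF ak, of z] by (simp only: t_def n model_def real_space_def option.case mem_Collect_eq)
        then show ?thesis using cyclic_distinct(1)[of k] by simp
      qed
      from this[of 1] this[of \<i>] show False using nt(1)[of "k+1"] by (simp add: complex_eq_iff)
    qed
    then obtain l where l: "n = Some l" by auto
    have tik: "t * axis k \<i> \<in> sphere_space l" using sub[OF ik] by (simp add: t_def l model_def)
    have "k = l"
    proof (rule ccontr)
      assume "k \<noteq> l"
      then have "k = l + 1 \<or> k = l + 2" using three_cases[of k l] by auto
      then show False using tik nt(1)[of k] cyclic_distinct[of l]
        by (auto simp: sphere_space_def axis_def)
    qed
    then have "Re (t $ k * \<i>) = 0" using tik by (simp add: sphere_space_def axis_def)
    then have Im0: "Im (t $ k) = 0" by simp
    have "(t * (\<chi> i. if i = k then 0 else if i = k+1 then 1 else cnj 1)) \<in> sphere_space k"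
      using sub[OF ak, of 1] by (simp add: t_def l model_def \<open>k = l\<close>)
    then have "t $ (k+2) = cnj (t $ (k+1))" using cyclic_distinct[of k] by (simp add: sphere_space_def)
    then have tk: "t $ k = 1" using prod[of k] by (simp add: tt)
    have "T *v axis_vec k = T $ k $ k *s axis_vec k"
    proof -
      have eq: "T$2$2 = T$1$1" if "cnj (T$2$2) * T$1$1 = 1"
        using arg_cong[OF that, of "\<lambda>z. T$2$2 * z"] u[of 2] by (simp add: mult.assoc[symmetric])
      have eq2: "T$3$3 = T$2$2" if "cnj (T$3$3) * T$2$2 = 1"
        using arg_cong[OF that, of "\<lambda>z. T$3$3 * z"] u[of 3] by (simp add: mult.assoc[symmetric])
      have eq3: "T$1$1 = T$3$3" if "cnj (T$1$1) * T$3$3 = 1"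
        using arg_cong[OF that, of "\<lambda>z. T$1$1 * z"] u[of 1] by (simp add: mult.assoc[symmetric])
      from exhaust_3[of k] show ?thesis
      proof (elim disjE)
        assume k: "k = 1"
        show ?thesis using eq tk off unfolding k by (simp add: t_def c3_eq_iff mv_nth axis_vec_def)
      next
        assume k: "k = 2"
        show ?thesis using eq2 tk off unfolding k by (simp add: t_def c3_eq_iff mv_nth axis_vec_def numeral_mod_3)
      next
        assume k: "k = 3"
        show ?thesis using eq3 tk off unfolding k by (simp add: t_def c3_eq_iff mv_nth axis_vec_def numeral_mod_3)
      qed
    qed
    then show ?thesis using TS l \<open>k = l\<close> unfolding Some model_group_def by auto
  qed
  then show "m = n" "T \<in> model_group m" by auto
qed

section \<open>The flag manifold as a homogeneous space\<close>

subsection \<open>The action on flags\<close>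

lemma act_mult: "act (A ** B) f = act A (act B f)"
  by (simp add: act_def image_image matrix_vector_mul_assoc)

lemma act_1: "act (mat 1) f = f"
  by (simp add: act_def)

lemma torus_SU3: "T \<in> torus \<Longrightarrow> T \<in> SU3"
  by (simp add: torus_def)

lemma torus_ct: "T \<in> torus \<Longrightarrow> conj_transpose T \<in> torus"
  by (simp add: torus_def SU3_ct)

lemma act_torus:
  assumes "T \<in> torus"
  shows "act T f_st = f_st"
proof -
  let ?l = "{v::complex^3. v $ 2 = 0 \<and> v $ 3 = 0}" and ?p = "{v::complex^3. v $ 3 = 0}"
  have sub: "(*v) S ` ?l \<subseteq> ?l" "(*v) S ` ?p \<subseteq> ?p" if "S \<in> torus" for S
    using that by (auto simp: torus_def mv_nth)
  have id: "v = T *v (conj_transpose T *v v)" for v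
    by (simp add: matrix_vector_mul_assoc SU3_right torus_SU3 assms)
  have "?l \<subseteq> (*v) T ` ?l" "?p \<subseteq> (*v) T ` ?p"
    using sub[OF torus_ct[OF assms]] id by (blast intro: image_eqI)+
  then show ?thesis using sub[OF assms] by (auto simp: act_def f_st_def)
qed

lemma act_fixed:
  assumes C: "C \<in> SU3" and f: "act C f_st = f_st"
  shows "C \<in> torus"
proof -
  have "C *v axis 1 1 \<in> {v. v $ 2 = 0 \<and> v $ 3 = 0}" "C *v axis 2 1 \<in> {v. v $ 3 = 0}"
    using f unfolding act_def f_st_def by (auto simp: axis_def prod_eq_iff)
  then have z: "C$2$1 = 0" "C$3$1 = 0" "C$3$2 = 0" by (auto simp: mv_nth axis_def)
  have o: "cnj (C$1$i) * C$1$j + cnj (C$2$i) * C$2$j + cnj (C$3$i) * C$3$j = (if i = j then 1 else 0)" for i j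
    using arg_cong[OF SU3_left[OF C], of "\<lambda>X. X $ i $ j"] by (simp add: mm_nth mat1_nth)
  have "C$1$1 \<noteq> 0" using o[of 1 1] z by auto
  then have z2: "C$1$2 = 0" "C$1$3 = 0" using o[of 1 2] o[of 1 3] z by simp_all
  have "C$2$2 \<noteq> 0" using o[of 2 2] z z2 by auto
  then have "C$2$3 = 0" using o[of 2 3] z z2 by simp
  then have "C $ i $ j = 0" if "i \<noteq> j" for i j
    using z z2 that exhaust_3[of i] exhaust_3[of j] by auto
  then show ?thesis using C by (simp add: torus_def)
qed

lemma act_eq_iff:
  assumes "A \<in> SU3" "B \<in> SU3"
  shows "act A f_st = act B f_st \<longleftrightarrow> conj_transpose A ** B \<in> torus"
proof
  assume "act A f_st = act B f_st"
  then have "act (conj_transpose A) (act B f_st) = act (conj_transpose A) (act A f_st)" by simp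
  also have "\<dots> = f_st" by (simp add: act_mult[symmetric] SU3_left assms act_1)
  finally have "act (conj_transpose A ** B) f_st = f_st" by (simp add: act_mult)
  then show "conj_transpose A ** B \<in> torus"
    using act_fixed SU3_mult[OF SU3_ct[OF assms(1)] assms(2)] by blast
next
  assume "conj_transpose A ** B \<in> torus"
  then have "act A (act (conj_transpose A ** B) f_st) = act A f_st" by (simp add: act_torus)
  then show "act A f_st = act B f_st"
    by (simp add: act_mult[symmetric] SU3_cancel[OF assms(1)])
qed

text \<open>The unitary matrix with two prescribed orthonormal columns.\<close>

definition frame :: "complex^3 \<Rightarrow> complex^3 \<Rightarrow> mat3" where
  "frame x y = (\<chi> i j. if j = 1 then x $ i else if j = 2 then y $ i else ccross x y $ i)"

definition hermitian :: "complex^3 \<Rightarrow> complex^3 \<Rightarrow> complex" where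
  "hermitian x y = cnj (x$1) * y$1 + cnj (x$2) * y$2 + cnj (x$3) * y$3"

lemma frame_SU3:
  assumes "hermitian x x = 1" "hermitian y y = 1" "hermitian x y = 0"
  shows "frame x y \<in> SU3"
proof -
  have 0: "hermitian y x = 0" using arg_cong[OF assms(3), of cnj] by (simp add: hermitian_def mult.commute)
  have "hermitian (ccross x y) (ccross x y) = hermitian x x * hermitian y y - hermitian x y * hermitian y x"
    by (simp add: hermitian_def algebra_simps)
  then have n: "hermitian (ccross x y) (ccross x y) = 1" using assms by simp
  have o: "hermitian x (ccross x y) = 0" "hermitian (ccross x y) x = 0"
    "hermitian y (ccross x y) = 0" "hermitian (ccross x y) y = 0"
    by (simp_all add: hermitian_def algebra_simps)
  have "det (frame x y) = hermitian (ccross x y) (ccross x y)"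
    by (simp add: det_3 frame_def hermitian_def algebra_simps)
  moreover have "conj_transpose (frame x y) ** frame x y = mat 1"
    using assms 0 n o unfolding mat3_eq_iff forall_3 mm_nth mat1_nth ct_nth hermitian_def
    by (simp add: frame_def)
  ultimately show ?thesis using n by (simp add: SU3_def)
qed

lemma hermitian_scale: "hermitian (a *\<^sub>R x) (b *\<^sub>R y) = of_real (a * b) * hermitian x y"
  by (simp add: hermitian_def scaleR_conv_of_real[where 'a=complex] algebra_simps)

lemma hermitian_self: "hermitian x x = of_real ((norm x)\<^sup>2)"
  unfolding power2_norm_eq_inner inner_c3 by (simp add: hermitian_def complex_eq_iff)

lemma hermitian_sgn: "x \<noteq> 0 \<Longrightarrow> hermitian (sgn x) (sgn x) = 1"
  unfolding hermitian_self by (simp add: norm_sgn)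

text \<open>Gram-Schmidt orthonormalization of a basis of the plane that extends one of the line.\<close>

lemma flags_transitive:
  assumes "f \<in> flags"
  obtains A where "A \<in> SU3" "act A f_st = f"
proof -
  obtain l p where f: "f = (l, p)" by force
  have l: "vec.subspace l" "vec.dim l = 1" and p: "vec.subspace p" "vec.dim p = 2" and lp: "l \<subseteq> p"
    using assms by (auto simp: flags_def f)
  obtain B where B: "B \<subseteq> l" "vec.independent B" "l \<subseteq> vec.span B" "card B = 1"
    using vec.basis_exists[of l] l by metis
  obtain v where v: "B = {v}" using B(4) by (auto simp: card_1_singleton_iff)
  have l_eq: "l = vec.span {v}" using B v vec.span_minimal[of "{v}" l] l(1) by blast
  have v0: "v \<noteq> 0" using B(2) v vec.dependent_zero by blast
  have "\<not> p \<subseteq> vec.span {v}"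
    using vec.dim_subset[of p "vec.span {v}"] l_eq l p by auto
  then obtain w where w: "w \<in> p" "w \<notin> vec.span {v}" by blast
  have ind: "vec.independent {w, v}" using B(2) v w by (simp add: vec.independent_insert)
  have "p \<subseteq> vec.span {w, v}"
    using w v B lp p ind by (intro vec.card_ge_dim_independent) (auto simp: card_insert_if intro: vec.span_base)
  moreover have "vec.span {w, v} \<subseteq> p"
    using w v B lp p(1) by (intro vec.span_minimal) auto
  ultimately have p_eq: "p = vec.span {w, v}" by blast
  define x where "x = sgn v"
  define w' where "w' = w - hermitian x w *s x"
  have xv: "x = of_real (inverse (norm v)) *s v" "v = of_real (norm v) *s x"
    using v0 by (simp_all add: x_def sgn_div_norm vec_eq_iff scaleR_conv_of_real[where 'a=complex])
  have xx: "hermitian x x = 1" using v0 by (simp add: x_def hermitian_sgn)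
  have xin: "x \<in> vec.span {v}" unfolding xv(1) by (intro vec.span_scale vec.span_base) simp
  have "w' \<noteq> 0"
    using w(2) vec.span_scale[OF xin, of "hermitian x w"] by (auto simp: w'_def)
  define y where "y = sgn w'"
  have yy: "hermitian y y = 1" using \<open>w' \<noteq> 0\<close> by (simp add: y_def hermitian_sgn)
  have "hermitian x w' = hermitian x w - hermitian x w * hermitian x x"
    by (simp add: w'_def hermitian_def algebra_simps)
  then have "hermitian x w' = 0" using xx by simp
  then have xy: "hermitian x y = 0"
    using hermitian_scale[of 1 x "inverse (norm w')" w'] by (simp add: y_def sgn_div_norm)
  have A: "frame x y \<in> SU3" by (rule frame_SU3[OF xx yy xy])
  have col: "frame x y *v z = z$1 *s x + z$2 *s y + z$3 *s ccross x y" for z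
    by (simp add: c3_eq_iff mv_nth frame_def mult.commute)
  have yw: "w' = of_real (norm w') *s y"
    using \<open>w' \<noteq> 0\<close> by (simp add: y_def sgn_div_norm vec_eq_iff scaleR_conv_of_real[where 'a=complex])
  have yin: "y \<in> vec.span {w, v}"
  proof -
    have "w' \<in> vec.span {w, v}" unfolding w'_def
      using xin vec.span_mono[of "{v}" "{w, v}"] by (intro vec.span_diff vec.span_scale) (auto intro: vec.span_base)
    moreover have "y = of_real (inverse (norm w')) *s w'"
      by (simp add: y_def sgn_div_norm vec_eq_iff scaleR_conv_of_real[where 'a=complex])
    ultimately show ?thesis by (simp add: vec.span_scale)
  qed
  have "(*v) (frame x y) ` {v. v $ 2 = 0 \<and> v $ 3 = 0} = l"
  proof
    show "(*v) (frame x y) ` {v. v $ 2 = 0 \<and> v $ 3 = 0} \<subseteq> l"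
      unfolding l_eq using xin by (auto simp: col intro: vec.span_scale)
    show "l \<subseteq> (*v) (frame x y) ` {v. v $ 2 = 0 \<and> v $ 3 = 0}"
    proof
      fix z assume "z \<in> l"
      then obtain k where "z = k *s v" unfolding l_eq by (auto simp: vec.span_singleton)
      then have "z = frame x y *v axis 1 (k * of_real (norm v))"
        by (subst (asm) xv(2)) (simp add: col axis_def vector_smult_assoc)
      then show "z \<in> (*v) (frame x y) ` {v. v $ 2 = 0 \<and> v $ 3 = 0}" by (auto simp: axis_def)
    qed
  qed
  moreover have "(*v) (frame x y) ` {v. v $ 3 = 0} = p"
  proof
    have "x \<in> p" using xin lp l_eq by auto
    then show "(*v) (frame x y) ` {v. v $ 3 = 0} \<subseteq> p"
      using yin p(1) unfolding p_eq[symmetric]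
      by (auto simp: col intro!: vec.subspace_add vec.subspace_scale)
    have "vec.span {w, v} \<subseteq> (*v) (frame x y) ` {v. v $ 3 = 0}"
    proof (rule vec.span_minimal)
      show "vec.subspace ((*v) (frame x y) ` {v. v $ 3 = 0})"
        by (rule vec.linear_subspace_image[OF matrix_vector_mul_linear_gen])
          (auto simp: vec.subspace_def)
      have "v = frame x y *v axis 1 (of_real (norm v))"
        by (subst xv(2)) (simp add: col axis_def)
      moreover have "w = frame x y *v (axis 1 (hermitian x w) + axis 2 (of_real (norm w')))"
        using yw by (simp add: col axis_def w'_def)
      ultimately show "{w, v} \<subseteq> (*v) (frame x y) ` {v. v $ 3 = 0}" by (force simp: axis_def)
    qed
    then show "p \<subseteq> (*v) (frame x y) ` {v. v $ 3 = 0}" by (simp add: p_eq)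
  qed
  ultimately have "act (frame x y) f_st = f" by (simp add: act_def f_st_def f)
  then show ?thesis using that A by blast
qed

lemma f_st_flag: "f_st \<in> flags"
proof -
  let ?l = "{v::complex^3. v $ 2 = 0 \<and> v $ 3 = 0}" and ?p = "{v::complex^3. v $ 3 = 0}"
  have s: "vec.subspace ?l" "vec.subspace ?p" by (auto simp: vec.subspace_def)
  have i1: "vec.independent {axis 1 1 :: complex^3}" by (simp add: axis_eq_axis vec.dependent_single axis_eq_0_iff)
  have sp: "vec.span {axis 1 1 :: complex^3} = ?l"
  proof
    show "vec.span {axis 1 1} \<subseteq> ?l" by (rule vec.span_minimal[OF _ s(1)]) (simp add: axis_def)
    show "?l \<subseteq> vec.span {axis 1 1}"
    proof
      fix v assume "v \<in> ?l"
      then have "v = v$1 *s axis 1 1" by (simp add: c3_eq_iff axis_def)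
      then show "v \<in> vec.span {axis 1 1}" by (metis vec.span_base vec.span_scale singletonI)
    qed
  qed
  have "(axis 2 1 :: complex^3) \<notin> vec.span {axis 1 1}" unfolding sp by (simp add: axis_def)
  then have i2: "vec.independent {axis 2 1 :: complex^3, axis 1 1}" using i1 by (simp add: vec.independent_insert)
  have "?p \<subseteq> vec.span {axis 2 1, axis 1 1}"
  proof
    fix v assume "v \<in> ?p"
    then have "v = v$2 *s axis 2 1 + v$1 *s axis 1 1" by (simp add: c3_eq_iff axis_def)
    then show "v \<in> vec.span {axis 2 1, axis 1 1}"
      by (metis vec.span_base vec.span_scale vec.span_add insertI1 insertI2)
  qed
  then have "vec.dim ?p = 2"
  proof (intro vec.dim_unique[OF _ _ i2])
    show "card {axis 2 1 :: complex^3, axis 1 1} = 2" by (simp add: axis_eq_axis)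
  qed (auto simp: axis_def)
  moreover have "vec.dim ?l = 1"
  proof (rule vec.dim_unique[OF _ _ i1])
    show "{axis 1 1} \<subseteq> ?l" by (simp add: axis_def)
    show "?l \<subseteq> vec.span {axis 1 1}" unfolding sp by simp
  qed simp
  ultimately show ?thesis using s by (auto simp: flags_def f_st_def)
qed

lemma act_flag:
  assumes "A \<in> SU3" "f \<in> flags"
  shows "act A f \<in> flags"
proof -
  have lin: "Vector_Spaces.linear (*s) (*s) ((*v) A)" by (rule matrix_vector_mul_linear_gen)
  have "v = w" if "A *v v = A *v w" for v w
  proof -
    have "conj_transpose A *v (A *v v) = conj_transpose A *v (A *v w)" using that by simp
    then show ?thesis by (simp add: matrix_vector_mul_assoc SU3_left assms)
  qed
  then have inj: "inj_on ((*v) A) S" for S by (auto intro: inj_onI)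
  have "vec.dim ((*v) A ` S) = vec.dim S" for S by (rule vec.dim_image_eq[OF lin inj])
  then show ?thesis using assms(2) vec.linear_subspace_image[OF lin]
    by (auto simp: flags_def act_def)
qed

lemma flags_orbit: "flags = (\<lambda>A. act A f_st) ` SU3"
  using flags_transitive act_flag[OF _ f_st_flag] by blast

lemma topspace_flag: "topspace flag_topology = flags"
proof -
  have "openin flag_topology flags"
    using act_flag[OF _ f_st_flag] unfolding openin_flag_topology by (auto simp: Collect_conv_if cong: conj_cong)
  then show ?thesis
    by (metis openin_flag_topology openin_subset openin_topspace subset_antisym)
qed

lemma continuous_map_orbit: "continuous_map (top_of_set SU3) flag_topology (\<lambda>A. act A f_st)"
  unfolding continuous_map_def topspace_flag
  using act_flag[OF _ f_st_flag] by (auto simp: openin_flag_topology)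

lemma continuous_map_lift:
  assumes "continuous_on S A" "\<And>x. x \<in> S \<Longrightarrow> A x \<in> SU3"
  shows "continuous_map (top_of_set S) flag_topology (\<lambda>x. act (A x) f_st)"
  using continuous_map_compose[OF _ continuous_map_orbit, of "top_of_set S" A] assms
  by (auto simp: o_def image_subset_iff_funcset)

subsection \<open>The big cell\<close>

definition big_cell :: "mat3 set" where
  "big_cell = {A. A$1$1 \<noteq> 0 \<and> A$3$3 \<noteq> 0}"

text \<open>The entries below the diagonal of the lower unipotent factor of \<open>A\<close>. Unitarity turns the minors
  that express the third one into entries of the last column.\<close>

definition cell_coords :: "mat3 \<Rightarrow> complex^3" where
  "cell_coords A = vector [A$2$1 / A$1$1, A$3$1 / A$1$1, - cnj (A$2$3 / A$3$3)]"

lemma cell_coords_nth: "cell_coords A $ 1 = A$2$1 / A$1$1" "cell_coords A $ 2 = A$3$1 / A$1$1"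
  "cell_coords A $ 3 = - cnj (A$2$3 / A$3$3)"
  by (simp_all add: cell_coords_def)

text \<open>The inverse of a matrix in \<open>SU(3)\<close> is its adjugate and also its conjugate transpose.\<close>

lemma SU3_cofactor:
  assumes A: "A \<in> SU3"
  shows "A$i$3 = ccross (\<chi> i. A$i$1) (\<chi> i. A$i$2) $ i" "A$i$1 = ccross (\<chi> i. A$i$2) (\<chi> i. A$i$3) $ i"
    "A$i$2 = ccross (\<chi> i. A$i$3) (\<chi> i. A$i$1) $ i"
proof -
  have det: "cnj (det A) = 1" using A by (simp add: SU3_def)
  have o: "cnj (A$1$i) * A$1$j + cnj (A$2$i) * A$2$j + cnj (A$3$i) * A$3$j = (if i = j then 1 else 0)" for i j
    using arg_cong[OF SU3_left[OF A], of "\<lambda>X. X $ i $ j"] by (simp add: mm_nth mat1_nth)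
  note o13 = o[of 1 1] o[of 1 2] o[of 1 3] o[of 2 1] o[of 2 2] o[of 2 3] o[of 3 1] o[of 3 2] o[of 3 3]
  have *: "x = y" if "conj_transpose A *v x = conj_transpose A *v y" for x y
  proof -
    have "A *v (conj_transpose A *v x) = A *v (conj_transpose A *v y)" using that by simp
    then show ?thesis by (simp add: matrix_vector_mul_assoc SU3_right A)
  qed
  have "(\<chi> i. A$i$3) = ccross (\<chi> i. A$i$1) (\<chi> i. A$i$2)"
    by (rule *) (use det o13 in \<open>simp add: c3_eq_iff mv_nth det_3 algebra_simps\<close>)
  then show "A$i$3 = ccross (\<chi> i. A$i$1) (\<chi> i. A$i$2) $ i" by (metis vec_lambda_beta)
  have "(\<chi> i. A$i$1) = ccross (\<chi> i. A$i$2) (\<chi> i. A$i$3)"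
    by (rule *) (use det o13 in \<open>simp add: c3_eq_iff mv_nth det_3 algebra_simps\<close>)
  then show "A$i$1 = ccross (\<chi> i. A$i$2) (\<chi> i. A$i$3) $ i" by (metis vec_lambda_beta)
  have "(\<chi> i. A$i$2) = ccross (\<chi> i. A$i$3) (\<chi> i. A$i$1)"
    by (rule *) (use det o13 in \<open>simp add: c3_eq_iff mv_nth det_3 algebra_simps\<close>)
  then show "A$i$2 = ccross (\<chi> i. A$i$3) (\<chi> i. A$i$1) $ i" by (metis vec_lambda_beta)
qed

lemma cell_torus:
  assumes "A \<in> big_cell" "T \<in> torus"
  shows "A ** T \<in> big_cell" "cell_coords (A ** T) = cell_coords A"
proof -
  have n: "T $ i $ i \<noteq> 0" for i using torus_norm[OF assms(2), of i] by auto
  have o: "T $ i $ j = 0" if "i \<noteq> j" for i j using assms(2) that by (simp add: torus_def)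
  show "A ** T \<in> big_cell" "cell_coords (A ** T) = cell_coords A"
    using assms(1) n o by (simp_all add: big_cell_def cell_coords_def mm_nth)
qed

text \<open>The first column of \<open>A\<close> and the last two entries of its last column are determined up to scalars; the
  remaining entry of the last column follows from the orthogonality of the two columns.\<close>

lemma cell_coords_inj:
  assumes A: "A \<in> SU3" "A \<in> big_cell" and B: "B \<in> SU3" "B \<in> big_cell"
    and eq: "cell_coords A = cell_coords B"
  shows "conj_transpose A ** B \<in> torus"
proof -
  have nz: "A$1$1 \<noteq> 0" "A$3$3 \<noteq> 0" "B$1$1 \<noteq> 0" "B$3$3 \<noteq> 0" using A B by (auto simp: big_cell_def)
  define c where "c = B$1$1 / A$1$1"
  define d where "d = B$3$3 / A$3$3"
  have cd: "c \<noteq> 0" "d \<noteq> 0" using nz by (auto simp: c_def d_def)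
  have "B$2$1 / B$1$1 = A$2$1 / A$1$1" "B$3$1 / B$1$1 = A$3$1 / A$1$1" "B$2$3 / B$3$3 = A$2$3 / A$3$3"
    using eq by (simp_all add: c3_eq_iff cell_coords_nth flip: complex_cnj_divide)
  then have 1: "B$1$1 = c * A$1$1" "B$2$1 = c * A$2$1" "B$3$1 = c * A$3$1" and
    2: "B$3$3 = d * A$3$3" "B$2$3 = d * A$2$3"
    using nz by (auto simp: c_def d_def field_simps)
  have oA: "cnj (A$1$i) * A$1$j + cnj (A$2$i) * A$2$j + cnj (A$3$i) * A$3$j = (if i = j then 1 else 0)" for i j
    using arg_cong[OF SU3_left[OF A(1)], of "\<lambda>X. X $ i $ j"] by (simp add: mm_nth mat1_nth)
  have oB: "cnj (B$1$i) * B$1$j + cnj (B$2$i) * B$2$j + cnj (B$3$i) * B$3$j = (if i = j then 1 else 0)" for i j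
    using arg_cong[OF SU3_left[OF B(1)], of "\<lambda>X. X $ i $ j"] by (simp add: mm_nth mat1_nth)
  have "cnj c * (cnj (A$1$1) * B$1$3 + d * (cnj (A$2$1) * A$2$3 + cnj (A$3$1) * A$3$3)) = 0"
    using oB[of 1 3] by (simp add: 1 2 algebra_simps)
  then have "cnj (A$1$1) * B$1$3 + d * (cnj (A$2$1) * A$2$3 + cnj (A$3$1) * A$3$3) = 0" using cd by simp
  moreover have "cnj (A$2$1) * A$2$3 + cnj (A$3$1) * A$3$3 = - (cnj (A$1$1) * A$1$3)"
    using oA[of 1 3] by (simp add: eq_neg_iff_add_eq_0 add_ac)
  ultimately have "cnj (A$1$1) * (B$1$3 - d * A$1$3) = 0" by (simp add: algebra_simps)
  then have 3: "B$1$3 = d * A$1$3" using nz by simp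
  define C where "C = conj_transpose A ** B"
  have C: "C \<in> SU3" unfolding C_def by (rule SU3_mult[OF SU3_ct[OF A(1)] B(1)])
  have "C$i$1 = c * (cnj (A$1$i) * A$1$1 + cnj (A$2$i) * A$2$1 + cnj (A$3$i) * A$3$1)"
    "C$i$3 = d * (cnj (A$1$i) * A$1$3 + cnj (A$2$i) * A$2$3 + cnj (A$3$i) * A$3$3)" for i
    by (simp_all add: C_def mm_nth 1 2 3 algebra_simps)
  then have "C$i$1 = c * (if i = 1 then 1 else 0)" "C$i$3 = d * (if i = 3 then 1 else 0)" for i
    unfolding oA by blast+
  then have z: "C$1$1 = c" "C$2$1 = 0" "C$3$1 = 0" "C$1$3 = 0" "C$2$3 = 0" "C$3$3 = d" by simp_all
  have oC: "cnj (C$1$i) * C$1$j + cnj (C$2$i) * C$2$j + cnj (C$3$i) * C$3$j = (if i = j then 1 else 0)" for i j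
    using arg_cong[OF SU3_left[OF C], of "\<lambda>X. X $ i $ j"] by (simp add: mm_nth mat1_nth)
  have "C$1$2 = 0" "C$3$2 = 0" using oC[of 1 2] oC[of 3 2] z cd by simp_all
  then have "C $ i $ j = 0" if "i \<noteq> j" for i j
    using z that exhaust_3[of i] exhaust_3[of j] by auto
  then show ?thesis using C by (simp add: torus_def C_def)
qed

text \<open>Both sides vanish exactly when the first and the last column move within their complex lines.\<close>

lemma cell_coords_derivative:
  assumes A: "SU3_diff W A" and y: "y \<in> W" and big: "A y \<in> big_cell"
  shows "(\<lambda>z. cell_coords (A z)) differentiable (at y)"
    "D (\<lambda>z. cell_coords (A z)) y u = 0 \<longleftrightarrow> xi A y u = 0"
proof -
  define M where "M = mc A y u"
  define x where "x = xi A y u"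
  have nz: "A y$1$1 \<noteq> 0" "A y$3$3 \<noteq> 0" using big by (auto simp: big_cell_def)
  have d: "((\<lambda>z. A z $ i $ j) has_derivative (\<lambda>u. D A y u $ i $ j)) (at y)" for i j
    using bounded_linear.has_derivative[OF bounded_linear_entry D_has_derivative[OF SU3_diff_D(3)[OF A y]]] .
  define q where "q i j k u = (D A y u $ i $ j * A y $ k $ j - A y $ i $ j * D A y u $ k $ j) / (A y $ k $ j * A y $ k $ j)" for i j k u
  have dq: "((\<lambda>z. A z $ i $ j / A z $ k $ j) has_derivative q i j k) (at y)" if "A y $ k $ j \<noteq> 0" for i j k
    using has_derivative_divide'[OF d d that] by (simp add: q_def[abs_def])
  have "((\<lambda>z. cell_coords (A z)) has_derivative (\<lambda>u. vector [q 2 1 1 u, q 3 1 1 u, - cnj (q 2 3 3 u)])) (at y)"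
  proof (rule has_derivative_vecI)
    fix i :: 3
    show "((\<lambda>z. cell_coords (A z) $ i) has_derivative (\<lambda>u. vector [q 2 1 1 u, q 3 1 1 u, - cnj (q 2 3 3 u)] $ i)) (at y)"
      using exhaust_3[of i] dq[OF nz(1), of 2] dq[OF nz(1), of 3]
        has_derivative_minus[OF bounded_linear.has_derivative[OF bounded_linear_cnj dq[OF nz(2), of 2]]]
      by (auto simp: cell_coords_nth simp del: complex_cnj_divide)
  qed
  then have D: "(\<lambda>z. cell_coords (A z)) differentiable (at y)"
    "D (\<lambda>z. cell_coords (A z)) y u = vector [q 2 1 1 u, q 3 1 1 u, - cnj (q 2 3 3 u)]"
    by (auto simp: differentiable_def D_eq)
  show "(\<lambda>z. cell_coords (A z)) differentiable (at y)" by (rule D)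
  note s = skew_nth[OF skew_mc[OF A y, of u], folded M_def]
  note cof = SU3_cofactor[OF SU3_diff_D(2)[OF A y]]
  have DA: "D A y u = A y ** M" by (simp add: M_def D_mc[OF A y])
  have x: "x $ 1 = M$2$1" "x $ 2 = M$3$2" "x $ 3 = M$1$3" by (simp_all add: x_def xi_def M_def)
  have qn: "q i j k u * (A y$k$j * A y$k$j) = D A y u $ i $ j * A y $ k $ j - A y $ i $ j * D A y u $ k $ j"
    if "A y$k$j \<noteq> 0" for i j k using that by (simp add: q_def)
  have n1: "q 2 1 1 u * (A y$1$1 * A y$1$1) = cnj (A y$3$3) * x$1 + cnj (A y$3$2) * cnj (x$3)"
    unfolding qn[OF nz(1)] DA mm_nth x cof(1)[of 3] cof(3)[of 3]
    by (simp add: s algebra_simps)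
  have n2: "q 3 1 1 u * (A y$1$1 * A y$1$1) = - cnj (A y$2$3) * x$1 - cnj (A y$2$2) * cnj (x$3)"
    unfolding qn[OF nz(1)] DA mm_nth x cof(1)[of 2] cof(3)[of 2]
    by (simp add: s algebra_simps)
  have n3: "q 2 3 3 u * (A y$3$3 * A y$3$3) = - cnj (A y$1$2) * x$3 - cnj (A y$1$1) * cnj (x$2)"
    unfolding qn[OF nz(2)] DA mm_nth x cof(2)[of 1] cof(3)[of 1]
    by (simp add: s algebra_simps)
  have cof11: "cnj (A y$1$1) = A y$2$2 * A y$3$3 - A y$3$2 * A y$2$3"
    using cof(2)[of 1] by simp
  have c11: "A y$1$1 = cnj (A y$2$2) * cnj (A y$3$3) - cnj (A y$3$2) * cnj (A y$2$3)"
    using arg_cong[OF cof11, of cnj] by simp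
  show "D (\<lambda>z. cell_coords (A z)) y u = 0 \<longleftrightarrow> xi A y u = 0"
  proof
    assume "xi A y u = 0"
    then have "q 2 1 1 u = 0" "q 3 1 1 u = 0" "q 2 3 3 u = 0" using n1 n2 n3 nz by (simp_all add: x_def)
    then show "D (\<lambda>z. cell_coords (A z)) y u = 0" by (simp add: D c3_eq_iff)
  next
    assume "D (\<lambda>z. cell_coords (A z)) y u = 0"
    then have q: "q 2 1 1 u = 0" "q 3 1 1 u = 0" "q 2 3 3 u = 0" by (simp_all add: D c3_eq_iff)
    have e1: "cnj (A y$3$3) * x$1 + cnj (A y$3$2) * cnj (x$3) = 0"
      and e2: "cnj (A y$2$3) * x$1 + cnj (A y$2$2) * cnj (x$3) = 0"
      and e3: "cnj (A y$1$2) * x$3 + cnj (A y$1$1) * cnj (x$2) = 0"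
      using n1 n2 n3 by (simp_all add: q add_eq_0_iff)
    have "A y$1$1 * x$1 = cnj (A y$2$2) * (cnj (A y$3$3) * x$1 + cnj (A y$3$2) * cnj (x$3))
        - cnj (A y$3$2) * (cnj (A y$2$3) * x$1 + cnj (A y$2$2) * cnj (x$3))"
      unfolding c11 by (simp add: algebra_simps)
    then have "x$1 = 0" using e1 e2 nz by simp
    moreover have "A y$1$1 * cnj (x$3) = cnj (A y$3$3) * (cnj (A y$2$3) * x$1 + cnj (A y$2$2) * cnj (x$3))
        - cnj (A y$2$3) * (cnj (A y$3$3) * x$1 + cnj (A y$3$2) * cnj (x$3))"
      unfolding c11 by (simp add: algebra_simps)
    then have "x$3 = 0" using e1 e2 nz by simp
    moreover have "x$2 = 0" using e3 \<open>x$3 = 0\<close> nz by simp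
    ultimately show "xi A y u = 0" by (simp add: x_def[symmetric] c3_eq_iff)
  qed
qed

subsection \<open>Smoothness of explicit expressions\<close>

lemma smooth_on_vecI:
  fixes f :: "'a::euclidean_space \<Rightarrow> 'b::euclidean_space^'n"
  assumes "open S" "\<And>i. smooth_on S (\<lambda>x. f x $ i)"
  shows "smooth_on S f"
proof (rule smooth_on_components[OF assms(1)])
  fix b :: "'b^'n" assume "b \<in> Basis"
  then obtain i c where "b = axis i c" by (auto simp: Basis_vec_def)
  then have "(\<lambda>x. f x \<bullet> b) = (\<lambda>x. f x $ i \<bullet> c)" by (simp add: inner_axis)
  then show "smooth_on S (\<lambda>x. f x \<bullet> b)"
    using smooth_on_bounded_linear[OF assms(1) bounded_linear_inner_left assms(2)] by simp
qed

lemma smooth_on_nth: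
  fixes f :: "'a::euclidean_space \<Rightarrow> 'b::euclidean_space^'n"
  shows "open S \<Longrightarrow> smooth_on S f \<Longrightarrow> smooth_on S (\<lambda>x. f x $ i)"
  by (rule smooth_on_bounded_linear[OF _ bounded_linear_vec_nth])

lemma smooth_on_mult: "open S \<Longrightarrow> smooth_on S f \<Longrightarrow> smooth_on S g \<Longrightarrow> smooth_on S (\<lambda>x. f x * g x :: complex)"
  by (rule smooth_on_bilinear[OF _ bounded_bilinear_mult])

lemma smooth_on_cnj: "open S \<Longrightarrow> smooth_on S f \<Longrightarrow> smooth_on S (\<lambda>x. cnj (f x))"
  by (rule smooth_on_bounded_linear[OF _ bounded_linear_cnj])

lemma smooth_on_minus:
  fixes f :: "'a::euclidean_space \<Rightarrow> 'b::euclidean_space"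
  shows "open S \<Longrightarrow> smooth_on S f \<Longrightarrow> smooth_on S (\<lambda>x. - f x)"
  by (rule smooth_on_bounded_linear[OF _ bounded_linear_minus[OF bounded_linear_ident]])

lemma smooth_on_diff:
  fixes f :: "'a::euclidean_space \<Rightarrow> 'b::euclidean_space"
  shows "open S \<Longrightarrow> smooth_on S f \<Longrightarrow> smooth_on S g \<Longrightarrow> smooth_on S (\<lambda>x. f x - g x)"
  using smooth_on_add[of S f "\<lambda>x. - g x"] smooth_on_minus[of S g] by simp

lemma smooth_on_real_inverse:
  assumes "open S" "smooth_on S f" "\<And>x. x \<in> S \<Longrightarrow> f x \<noteq> 0"
  shows "smooth_on S (\<lambda>x. inverse (f x :: real))"
  by (rule smooth_on_compose[OF assms(1) _ _ assms(2) smooth_on_inverse]) (use assms in auto)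

lemma smooth_on_divide:
  fixes f g :: "'a::euclidean_space \<Rightarrow> complex"
  assumes "open S" "smooth_on S f" "smooth_on S g" "\<And>x. x \<in> S \<Longrightarrow> g x \<noteq> 0"
  shows "smooth_on S (\<lambda>x. f x / g x)"
proof -
  have "f x / g x = inverse (g x \<bullet> g x) *\<^sub>R (f x * cnj (g x))" for x
  proof -
    have "(of_real (norm (g x)))\<^sup>2 = (of_real (g x \<bullet> g x) :: complex)"
      by (metis of_real_power power2_norm_eq_inner)
    then show ?thesis using complex_div_cnj[of "f x" "g x"] by (simp add: scaleR_conv_of_real divide_inverse mult_ac)
  qed
  moreover have "smooth_on S (\<lambda>x. inverse (g x \<bullet> g x) *\<^sub>R (f x * cnj (g x)))"
    by (intro smooth_on_bilinear[OF _ bounded_bilinear_scaleR] smooth_on_real_inverse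
        smooth_on_bilinear[OF _ bounded_bilinear_inner] smooth_on_mult smooth_on_cnj assms) (simp add: assms(4))
  ultimately show ?thesis by simp
qed

lemma smooth_on_sgn:
  fixes f :: "'a::euclidean_space \<Rightarrow> 'b::euclidean_space"
  assumes "open S" "smooth_on S f" "\<And>x. x \<in> S \<Longrightarrow> f x \<noteq> 0"
  shows "smooth_on S (\<lambda>x. sgn (f x))"
proof -
  have i: "smooth_on S (\<lambda>x. f x \<bullet> f x)"
    by (rule smooth_on_bilinear[OF assms(1) bounded_bilinear_inner assms(2,2)])
  have "smooth_on S (\<lambda>x. sqrt (f x \<bullet> f x))"
    by (rule smooth_on_compose[OF assms(1) _ _ i smooth_on_sqrt]) (use assms in auto)
  then have "smooth_on S (\<lambda>x. inverse (sqrt (f x \<bullet> f x)) *\<^sub>R f x)"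
    by (intro smooth_on_bilinear[OF assms(1) bounded_bilinear_scaleR] smooth_on_real_inverse assms) (simp_all add: assms(3))
  then show ?thesis by (simp add: sgn_div_norm norm_eq_sqrt_inner inverse_eq_divide)
qed

lemma smooth_on_cell_coords:
  assumes "open S" "smooth_on S A" "\<And>y. y \<in> S \<Longrightarrow> A y \<in> big_cell"
  shows "smooth_on S (\<lambda>y. cell_coords (A y))"
proof (rule smooth_on_vecI[OF assms(1)])
  fix i :: 3
  have e: "smooth_on S (\<lambda>y. A y $ i $ j)" for i j
    by (intro smooth_on_nth assms)
  have n: "A y $ 1 $ 1 \<noteq> 0" "A y $ 3 $ 3 \<noteq> 0" if "y \<in> S" for y
    using assms(3)[OF that] by (auto simp: big_cell_def)
  have "smooth_on S (\<lambda>y. A y $ 2 $ 1 / A y $ 1 $ 1)" "smooth_on S (\<lambda>y. A y $ 3 $ 1 / A y $ 1 $ 1)"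
    "smooth_on S (\<lambda>y. - cnj (A y $ 2 $ 3 / A y $ 3 $ 3))"
    using n by (intro smooth_on_divide smooth_on_minus smooth_on_cnj assms(1) e; simp)+
  then show "smooth_on S (\<lambda>y. cell_coords (A y) $ i)"
    using exhaust_3[of i] by (auto simp: cell_coords_nth simp del: complex_cnj_divide)
qed

lemma smooth_on_ccross:
  assumes "open S" "smooth_on S f" "smooth_on S g"
  shows "smooth_on S (\<lambda>x. ccross (f x) (g x))"
proof (rule smooth_on_vecI[OF assms(1)])
  fix i :: 3
  have e: "smooth_on S (\<lambda>y. f y $ i)" "smooth_on S (\<lambda>y. g y $ i)" for i
    by (intro smooth_on_nth assms)+
  show "smooth_on S (\<lambda>x. ccross (f x) (g x) $ i)"
    unfolding ccross_cyclic by (intro smooth_on_cnj smooth_on_diff smooth_on_mult assms(1) e)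
qed

lemma smooth_on_frame:
  assumes "open S" "smooth_on S f" "smooth_on S g"
  shows "smooth_on S (\<lambda>x. frame (f x) (g x))"
proof (intro smooth_on_vecI[OF assms(1)])
  fix i j :: 3
  have "smooth_on S (\<lambda>y. f y $ i)" "smooth_on S (\<lambda>y. g y $ i)" "smooth_on S (\<lambda>y. ccross (f y) (g y) $ i)"
    by (intro smooth_on_nth smooth_on_ccross assms)+
  then show "smooth_on S (\<lambda>x. frame (f x) (g x) $ i $ j)"
    using exhaust_3[of j] by (auto simp: frame_def)
qed

subsection \<open>Charts\<close>

text \<open>The cyclic permutation matrix. Its right action on frames is the part of the Weyl group that
  preserves \<open>J\<close>.\<close>

definition cyclic :: mat3 where
  "cyclic = (\<chi> i j. if i = j + 1 then 1 else 0)"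

lemma mult_cyclic: "((A::mat3) ** cyclic) $ i $ j = A $ i $ (j + 1)"
  using exhaust_3[of j] by (auto simp: mm_nth cyclic_def numeral_mod_3)

lemma ct_cyclic_mult: "(conj_transpose cyclic ** (A::mat3)) $ i $ j = A $ (i + 1) $ j"
  using exhaust_3[of i] by (auto simp: mm_nth cyclic_def numeral_mod_3)

lemma cyclic_SU3: "cyclic \<in> SU3"
proof -
  have "conj_transpose cyclic ** cyclic = mat 1"
    unfolding mat3_eq_iff ct_cyclic_mult by (simp add: cyclic_def mat1_nth)
  moreover have "det cyclic = 1" by (simp add: det_3 cyclic_def numeral_mod_3)
  ultimately show ?thesis by (simp add: SU3_def)
qed

text \<open>The first column spans the line \<open>(1, z\<^sub>1, z\<^sub>2)\<close>, and the last one is conjugate to the cross product of the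
  first two columns of the lower unipotent matrix with entries \<open>z\<close>.\<close>

definition cell_lift :: "complex^3 \<Rightarrow> mat3" where
  "cell_lift z = frame (sgn (vector [cnj (z$1 * z$3 - z$2), - cnj (z$3), 1])) (sgn (vector [1, z$1, z$2])) ** cyclic"

lemma sgn_nth: "sgn (x::complex^3) $ i = of_real (inverse (norm x)) * x $ i"
  by (simp add: sgn_div_norm scaleR_conv_of_real[where 'a=complex])

lemma cell_lift:
  "cell_lift z \<in> SU3" "cell_lift z \<in> big_cell" "cell_coords (cell_lift z) = z"
proof -
  define u :: "complex^3" where "u = vector [1, z$1, z$2]"
  define v :: "complex^3" where "v = vector [cnj (z$1 * z$3 - z$2), - cnj (z$3), 1]"
  have un: "u $ 1 = 1" "u $ 2 = z $ 1" "u $ 3 = z $ 2" by (simp_all add: u_def)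
  have vn: "v $ 1 = cnj (z$1 * z$3 - z$2)" "v $ 2 = - cnj (z$3)" "v $ 3 = 1" by (simp_all add: v_def)
  have nz: "u \<noteq> 0" "v \<noteq> 0" using un vn by (auto simp: c3_eq_iff)
  have L: "cell_lift z = frame (sgn v) (sgn u) ** cyclic" by (simp add: cell_lift_def u_def v_def)
  have "hermitian v u = 0" by (simp add: hermitian_def un vn algebra_simps)
  then have "hermitian (sgn v) (sgn u) = 0" by (simp add: sgn_div_norm hermitian_scale)
  then have "frame (sgn v) (sgn u) \<in> SU3" using nz by (intro frame_SU3 hermitian_sgn)
  then show "cell_lift z \<in> SU3" unfolding L by (rule SU3_mult[OF _ cyclic_SU3])
  have c: "cell_lift z $ i $ 1 = sgn u $ i" "cell_lift z $ i $ 3 = sgn v $ i" for i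
    unfolding L mult_cyclic by (simp_all add: frame_def numeral_mod_3)
  have n: "norm u \<noteq> 0" "norm v \<noteq> 0" using nz by auto
  show "cell_lift z \<in> big_cell" using n by (simp add: big_cell_def c sgn_nth un vn)
  show "cell_coords (cell_lift z) = z" using n
    by (simp add: c3_eq_iff cell_coords_nth c sgn_nth un vn)
qed

lemma smooth_on_cell_lift:
  assumes "open S" "smooth_on S f"
  shows "smooth_on S (\<lambda>x. cell_lift (f x))"
proof -
  have e: "smooth_on S (\<lambda>y. f y $ i)" for i by (intro smooth_on_nth assms)
  have u: "smooth_on S (\<lambda>x. vector [1, f x$1, f x$2] :: complex^3)"
  proof (rule smooth_on_vecI[OF assms(1)])
    fix i :: 3
    show "smooth_on S (\<lambda>x. (vector [1, f x$1, f x$2] :: complex^3) $ i)"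
      using exhaust_3[of i] e by (auto simp: smooth_on_const)
  qed
  have v: "smooth_on S (\<lambda>x. vector [cnj (f x$1 * f x$3 - f x$2), - cnj (f x$3), 1] :: complex^3)"
  proof (rule smooth_on_vecI[OF assms(1)])
    fix i :: 3
    have "smooth_on S (\<lambda>x. cnj (f x$1 * f x$3 - f x$2))" "smooth_on S (\<lambda>x. - cnj (f x$3))"
      by (intro smooth_on_cnj smooth_on_diff smooth_on_mult smooth_on_minus e assms(1))+
    then show "smooth_on S (\<lambda>x. (vector [cnj (f x$1 * f x$3 - f x$2), - cnj (f x$3), 1] :: complex^3) $ i)"
      using exhaust_3[of i] by (auto simp: smooth_on_const simp del: complex_cnj_diff complex_cnj_mult)
  qed
  have nz: "(vector [1, a, b] :: complex^3) \<noteq> 0" "(vector [a, b, 1] :: complex^3) \<noteq> 0" for a b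
    by (auto simp: c3_eq_iff)
  show ?thesis unfolding cell_lift_def
    by (intro smooth_on_bilinear[OF assms(1) bounded_bilinear_mm] smooth_on_frame smooth_on_sgn
        smooth_on_const assms(1) u v nz)
qed

definition c3_of :: "real^6 \<Rightarrow> complex^3" where
  "c3_of = (SOME f. linear f \<and> bij f)"

definition of_c3 :: "complex^3 \<Rightarrow> real^6" where
  "of_c3 = inv c3_of"

lemma c3_of: "linear c3_of" "bij c3_of"
proof -
  have d: "DIM(real^6) = DIM(complex^3)" by simp
  obtain f :: "real^6 \<Rightarrow> complex^3" and g where "linear f" "\<And>x. g (f x) = x" "\<And>y. f (g y) = y"
    by (rule isomorphisms_UNIV_UNIV[OF d]) blast
  then have "linear f \<and> bij f" by (metis bijI')
  then have "linear c3_of \<and> bij c3_of" unfolding c3_of_def by (rule someI[where P = "\<lambda>f. linear f \<and> bij f"])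
  then show "linear c3_of" "bij c3_of" by auto
qed

lemma c3_inverse [simp]: "c3_of (of_c3 z) = z" "of_c3 (c3_of x) = x"
  using c3_of(2) by (simp_all add: of_c3_def bij_is_surj bij_is_inj surj_f_inv_f inv_f_f)

lemma linear_of_c3: "linear of_c3"
proof -
  have "of_c3 (a + b) = of_c3 a + of_c3 b" for a b
    by (metis c3_inverse linear_add[OF c3_of(1)])
  moreover have "of_c3 (r *\<^sub>R a) = r *\<^sub>R of_c3 a" for r a
    by (metis c3_inverse linear_scale[OF c3_of(1)])
  ultimately show ?thesis by (rule linearI)
qed

lemma bounded_linear_c3: "bounded_linear c3_of" "bounded_linear of_c3"
  using c3_of(1) linear_of_c3 by (simp_all add: linear_conv_bounded_linear)

definition representative :: "flag \<Rightarrow> mat3" where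
  "representative f = (SOME A. A \<in> SU3 \<and> act A f_st = f)"

lemma representative:
  assumes "f \<in> flags"
  shows "representative f \<in> SU3" "act (representative f) f_st = f"
proof -
  have "representative f \<in> SU3 \<and> act (representative f) f_st = f"
    unfolding representative_def by (rule someI_ex) (use flags_transitive[OF assms] in blast)
  then show "representative f \<in> SU3" "act (representative f) f_st = f" by auto
qed

definition cell :: "mat3 \<Rightarrow> flag set" where
  "cell B = {act A f_st | A. A \<in> SU3 \<and> conj_transpose B ** A \<in> big_cell}"

definition cell_map :: "mat3 \<Rightarrow> flag \<Rightarrow> complex^3" where
  "cell_map B f = cell_coords (conj_transpose B ** representative f)"

definition cell_chart :: "mat3 \<Rightarrow> (flag, real^6) chart" where
  "cell_chart B = (cell B, \<lambda>f. of_c3 (cell_map B f))"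

lemma cell_eval:
  assumes A: "A \<in> SU3"
  shows "act A f_st \<in> cell B \<longleftrightarrow> conj_transpose B ** A \<in> big_cell"
    "act A f_st \<in> cell B \<Longrightarrow> cell_map B (act A f_st) = cell_coords (conj_transpose B ** A)"
proof -
  show *: "act A f_st \<in> cell B \<longleftrightarrow> conj_transpose B ** A \<in> big_cell"
  proof
    assume "act A f_st \<in> cell B"
    then obtain A' where A': "A' \<in> SU3" "act A f_st = act A' f_st" "conj_transpose B ** A' \<in> big_cell"
      by (auto simp: cell_def)
    then have "conj_transpose A' ** A \<in> torus" using act_eq_iff A by metis
    from cell_torus(1)[OF A'(3) this] show "conj_transpose B ** A \<in> big_cell"
      by (simp add: SU3_cancel[OF A'(1)] flip: matrix_mul_assoc)
  qed (use A in \<open>auto simp: cell_def\<close>)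
  assume "act A f_st \<in> cell B"
  then have big: "conj_transpose B ** A \<in> big_cell" using * by simp
  let ?R = "representative (act A f_st)"
  have R: "?R \<in> SU3" "act ?R f_st = act A f_st" using representative act_flag[OF A f_st_flag] by auto
  have "conj_transpose A ** ?R \<in> torus" using act_eq_iff[OF A R(1)] R(2) by simp
  from cell_torus(2)[OF big this] show "cell_map B (act A f_st) = cell_coords (conj_transpose B ** A)"
    by (simp add: cell_map_def SU3_cancel[OF A] flip: matrix_mul_assoc)
qed

lemma cell_self: "B \<in> SU3 \<Longrightarrow> act B f_st \<in> cell B"
  by (simp add: cell_eval(1) SU3_left big_cell_def mat1_nth)

lemma cell_sub_flags: "cell B \<subseteq> flags"
  using act_flag[OF _ f_st_flag] by (auto simp: cell_def)

lemma cell_inj: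
  assumes B: "B \<in> SU3" and f: "f \<in> cell B" "g \<in> cell B" "cell_map B f = cell_map B g"
  shows "f = g"
proof -
  obtain A A' where A: "A \<in> SU3" "f = act A f_st" and A': "A' \<in> SU3" "g = act A' f_st"
    using f by (auto simp: cell_def)
  have "conj_transpose (conj_transpose B ** A) ** (conj_transpose B ** A') \<in> torus"
    using f cell_eval[OF A(1), of B] cell_eval[OF A'(1), of B] A A' SU3_mult SU3_ct B
    by (intro cell_coords_inj) auto
  then have "conj_transpose A ** A' \<in> torus"
    by (simp add: ct_mult SU3_cancel[OF B] flip: matrix_mul_assoc)
  then show ?thesis using act_eq_iff[OF A(1) A'(1)] A A' by simp
qed

lemma open_big_cell_preimage:
  assumes "open O'"
  shows "openin (top_of_set SU3) {A \<in> SU3. conj_transpose B ** A \<in> big_cell \<and> cell_coords (conj_transpose B ** A) \<in> O'}"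
proof -
  have "continuous_on UNIV (\<lambda>A::mat3. conj_transpose B ** A)"
    by (rule linear_continuous_on[OF bounded_bilinear.bounded_linear_right[OF bounded_bilinear_mm]])
  moreover have o: "open big_cell"
  proof -
    have c: "continuous_on UNIV (\<lambda>A::mat3. A $ i $ j)" for i j by (intro continuous_intros)
    have eq: "big_cell = (\<lambda>A. A $ 1 $ 1) -` (- {0}) \<inter> (\<lambda>A. A $ 3 $ 3) -` (- {0})" by (auto simp: big_cell_def)
    show ?thesis unfolding eq by (intro open_Int open_vimage[OF _ c]) auto
  qed
  moreover have "continuous_on big_cell cell_coords"
    using smooth_on_continuous[OF smooth_on_cell_coords[OF o smooth_on_linear[OF bounded_linear_ident]]] by simp
  then have "open (big_cell \<inter> cell_coords -` O')" using o assms continuous_open_preimage by blast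
  ultimately have "open ((\<lambda>A. conj_transpose B ** A) -` (big_cell \<inter> cell_coords -` O'))"
    by (metis open_vimage)
  moreover have "{A \<in> SU3. conj_transpose B ** A \<in> big_cell \<and> cell_coords (conj_transpose B ** A) \<in> O'}
    = SU3 \<inter> (\<lambda>A. conj_transpose B ** A) -` (big_cell \<inter> cell_coords -` O')" by auto
  ultimately show ?thesis by (simp add: openin_open_Int)
qed

lemma openin_cell_preimage:
  assumes "open O'"
  shows "openin flag_topology {f \<in> cell B. cell_map B f \<in> O'}"
proof -
  have "{A \<in> SU3. act A f_st \<in> {f \<in> cell B. cell_map B f \<in> O'}} =
    {A \<in> SU3. conj_transpose B ** A \<in> big_cell \<and> cell_coords (conj_transpose B ** A) \<in> O'}"
    using cell_eval by auto
  then show ?thesis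
    using open_big_cell_preimage[OF assms] cell_sub_flags by (auto simp: openin_flag_topology)
qed

lemma cell_chart_inverse:
  assumes B: "B \<in> SU3"
  shows "act (B ** cell_lift z) f_st \<in> cell B" "cell_map B (act (B ** cell_lift z) f_st) = z"
proof -
  have S: "B ** cell_lift z \<in> SU3" by (rule SU3_mult[OF B cell_lift(1)])
  show 1: "act (B ** cell_lift z) f_st \<in> cell B"
    by (simp add: cell_eval(1)[OF S] SU3_cancel[OF B] cell_lift)
  show "cell_map B (act (B ** cell_lift z) f_st) = z"
    using cell_eval(2)[OF S 1] by (simp add: SU3_cancel[OF B] cell_lift)
qed

lemma inj_coframe_iff:
  assumes "SU3_diff W A" "x \<in> W"
  shows "inj (flag_coframe A x) \<longleftrightarrow> inj (xi A x)"
proof -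
  have "linear (\<lambda>u. m_proj (mc A x u))"
    using linear_compose[OF linear_mc[OF assms] linear_m_proj] by (simp add: o_def)
  then have l: "linear (flag_coframe A x)" by (simp add: flag_coframe_def[abs_def] mc_def[symmetric])
  have "flag_coframe A x u = 0 \<longleftrightarrow> xi A x u = 0" for u
    using m_proj_eq_0_iff[OF skew_mc[OF assms]] by (simp add: flag_coframe_def mc_def[symmetric] xi_def)
  then show ?thesis
    using linear_injective_0[OF l] linear_injective_0[OF linear_xi[OF assms]] by simp
qed

lemma cell_chart_image:
  assumes "B \<in> SU3"
  shows "chart_image (cell_chart B) = UNIV"
proof -
  have "x \<in> (\<lambda>f. of_c3 (cell_map B f)) ` cell B" for x
    using cell_chart_inverse[OF assms, of "c3_of x"] by (metis c3_inverse(2) imageI)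
  then show ?thesis by (auto simp: chart_image_def cell_chart_def)
qed

lemma cell_chart_inv:
  assumes "B \<in> SU3"
  shows "chart_inv (cell_chart B) x = act (B ** cell_lift (c3_of x)) f_st"
proof -
  have inj: "inj_on (\<lambda>f. of_c3 (cell_map B f)) (cell B)"
    using cell_inj[OF assms] by (intro inj_onI) (metis c3_inverse(1))
  show ?thesis
    using inv_into_f_f[OF inj cell_chart_inverse(1)[OF assms, of "c3_of x"]]
    by (simp add: chart_inv_def cell_chart_def cell_chart_inverse(2)[OF assms])
qed

lemma cell_chart_smooth_lift:
  assumes "B \<in> SU3"
  shows "SU3_map UNIV (\<lambda>x. B ** cell_lift (c3_of x))"
  unfolding SU3_map_def
  using smooth_on_bounded_linear[OF open_UNIV bounded_bilinear.bounded_linear_right[OF bounded_bilinear_mm]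
      smooth_on_cell_lift[OF open_UNIV smooth_on_linear[OF bounded_linear_c3(1)]]]
    SU3_mult[OF assms cell_lift(1)] by simp

lemma cell_chart_is_chart:
  assumes B: "B \<in> SU3"
  shows "is_chart flag_topology (cell_chart B)"
proof -
  let ?f = "\<lambda>f. of_c3 (cell_map B f)" and ?g = "\<lambda>x. act (B ** cell_lift (c3_of x)) f_st"
  have op: "openin flag_topology (cell B)" using openin_cell_preimage[OF open_UNIV, of B] by simp
  have "continuous_map (subtopology flag_topology (cell B)) euclidean ?f"
    unfolding continuous_map_def
  proof (intro conjI allI impI)
    fix U :: "(real^6) set" assume "openin euclidean U"
    then have "open U" by (simp only: open_openin)
    then have "open (of_c3 -` U)"
      by (rule open_vimage[OF _ linear_continuous_on[OF bounded_linear_c3(2)]])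
    from openin_cell_preimage[OF this, of B]
    have "openin flag_topology {x \<in> cell B. ?f x \<in> U}" by simp
    moreover have "{x \<in> topspace (subtopology flag_topology (cell B)). ?f x \<in> U} = {x \<in> cell B. ?f x \<in> U}"
      using cell_sub_flags by (auto simp: topspace_flag)
    ultimately show "openin (subtopology flag_topology (cell B)) {x \<in> topspace (subtopology flag_topology (cell B)). ?f x \<in> U}"
      using openin_open_subtopology[OF op] by auto
  qed simp
  moreover have "continuous_map euclidean (subtopology flag_topology (cell B)) ?g"
    using continuous_map_lift[OF smooth_on_continuous[OF SU3_map_D(2)[OF cell_chart_smooth_lift[OF B]]]]
      SU3_map_D(3)[OF cell_chart_smooth_lift[OF B]] cell_chart_inverse(1)[OF B]
    by (auto simp: continuous_map_in_subtopology)
  moreover have "?g (?f f) = f" if "f \<in> cell B" for f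
    using cell_inj[OF B cell_chart_inverse(1)[OF B] that] cell_chart_inverse(2)[OF B] by simp
  moreover have "?f (?g x) = x" for x by (simp add: cell_chart_inverse(2)[OF B])
  ultimately have "homeomorphic_maps (subtopology flag_topology (cell B)) euclidean ?f ?g"
    by (auto simp: homeomorphic_maps_def)
  then have "homeomorphic_map (subtopology flag_topology (cell B)) euclidean ?f"
    using homeomorphic_map_maps by blast
  then show ?thesis
    unfolding is_chart_def cell_chart_image[OF B] using op by (simp add: cell_chart_def)
qed

lemma cell_chart_atlas:
  assumes B: "B \<in> SU3"
  shows "cell_chart B \<in> flag_atlas"
proof -
  let ?A = "\<lambda>x. B ** cell_lift (c3_of x)"
  note m = cell_chart_smooth_lift[OF B]
  have "flag_lift (cell_chart B) UNIV ?A"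
    using SU3_map_D[OF m] by (simp add: flag_lift_def cell_chart_image[OF B] cell_chart_inv[OF B])
  moreover have "inj (flag_coframe ?A x)" for x
  proof -
    have m': "SU3_map UNIV (\<lambda>x. cell_lift (c3_of x))"
      using cell_chart_smooth_lift[OF SU3_1] by simp
    have "xi ?A x u = xi (\<lambda>x. cell_lift (c3_of x)) x u" for u
      unfolding xi_def mc_def
      using D_bounded_linear[OF bounded_bilinear.bounded_linear_right[OF bounded_bilinear_mm] SU3_map_D(4)[OF m' UNIV_I], of B x u]
      by (simp add: ct_mult SU3_cancel[OF B] flip: matrix_mul_assoc)
    moreover have Dc: "D (\<lambda>x. cell_coords (cell_lift (c3_of x))) x u = c3_of u" for u
      unfolding cell_lift by (simp add: D_eq[OF bounded_linear_imp_has_derivative[OF bounded_linear_c3(1)]])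
    have "xi (\<lambda>x. cell_lift (c3_of x)) x u = 0 \<longleftrightarrow> c3_of u = 0" for u
      using cell_coords_derivative(2)[OF SU3_diffI[OF m'] UNIV_I cell_lift(2), of x u] Dc[of u] by simp
    moreover have "c3_of u = 0 \<Longrightarrow> u = 0" for u
      by (metis c3_inverse(2) linear_0[OF c3_of(1)])
    ultimately have "inj (xi ?A x)"
      using linear_injective_0[OF linear_xi[OF SU3_diffI[OF m] UNIV_I]] by simp
    then show ?thesis using inj_coframe_iff[OF SU3_diffI[OF m] UNIV_I] by blast
  qed
  ultimately show ?thesis
    unfolding flag_atlas_def using cell_chart_is_chart[OF B] by blast
qed

lemma is_chart_inverse:
  assumes c: "is_chart M c"
  shows "x \<in> chart_image c \<Longrightarrow> chart_inv c x \<in> fst c" "x \<in> chart_image c \<Longrightarrow> snd c (chart_inv c x) = x"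
    "p \<in> fst c \<Longrightarrow> chart_inv c (snd c p) = p" "p \<in> fst c \<Longrightarrow> snd c p \<in> chart_image c"
    "continuous_map (top_of_set (chart_image c)) M (chart_inv c)"
proof -
  have top: "topspace (subtopology M (fst c)) = fst c"
    using c openin_subset by (fastforce simp: is_chart_def)
  have h: "homeomorphic_map (subtopology M (fst c)) (top_of_set (chart_image c)) (snd c)"
    using c by (simp add: is_chart_def)
  have inj: "inj_on (snd c) (fst c)" using homeomorphic_imp_injective_map[OF h] top by simp
  show 1: "chart_inv c x \<in> fst c" "snd c (chart_inv c x) = x" if "x \<in> chart_image c" for x
    using that unfolding chart_image_def chart_inv_def by (auto simp: inv_into_into f_inv_into_f)
  show 2: "p \<in> fst c \<Longrightarrow> chart_inv c (snd c p) = p" unfolding chart_inv_def by (rule inv_into_f_f[OF inj])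
  show "p \<in> fst c \<Longrightarrow> snd c p \<in> chart_image c" by (simp add: chart_image_def)
  obtain g where g: "homeomorphic_maps (subtopology M (fst c)) (top_of_set (chart_image c)) (snd c) g"
    using h homeomorphic_map_maps by blast
  have "g x = chart_inv c x" if x: "x \<in> chart_image c" for x
  proof -
    have "g (snd c (chart_inv c x)) = chart_inv c x"
      using g 1(1)[OF x] top unfolding homeomorphic_maps_def by blast
    then show ?thesis by (simp add: 1(2)[OF x])
  qed
  moreover have "continuous_map (top_of_set (chart_image c)) M g"
    using g unfolding homeomorphic_maps_def continuous_map_in_subtopology by blast
  ultimately show "continuous_map (top_of_set (chart_image c)) M (chart_inv c)"
    using continuous_map_eq[of "top_of_set (chart_image c)" M g "chart_inv c"] by simp
qed

lemma local_map_continuous: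
  assumes c: "is_chart M c" and d: "is_chart N d" and f: "continuous_map M N f"
  shows "open (local_dom c d f)" "continuous_on (local_dom c d f) (local_map c d f)"
    "x \<in> local_dom c d f \<Longrightarrow> local_map c d f x \<in> chart_image d"
    "x \<in> local_dom c d f \<Longrightarrow> chart_inv d (local_map c d f x) = f (chart_inv c x)"
proof -
  let ?S = "local_dom c d f"
  have cf: "continuous_map (top_of_set (chart_image c)) N (\<lambda>x. f (chart_inv c x))"
    using continuous_map_compose[OF is_chart_inverse(5)[OF c] f] by (simp add: o_def)
  have "openin (top_of_set (chart_image c)) {x \<in> topspace (top_of_set (chart_image c)). f (chart_inv c x) \<in> fst d}"
    by (rule openin_continuous_map_preimage[OF cf]) (use d in \<open>simp add: is_chart_def\<close>)
  then show "open ?S"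
    using c by (simp add: local_dom_def is_chart_def openin_open_eq)
  have "continuous_map (top_of_set ?S) (subtopology N (fst d)) (\<lambda>x. f (chart_inv c x))"
    using continuous_map_from_subtopology_mono[OF cf, of ?S]
    by (auto simp: continuous_map_in_subtopology local_dom_def)
  moreover have "continuous_map (subtopology N (fst d)) (top_of_set (chart_image d)) (snd d)"
    using d homeomorphic_imp_continuous_map by (auto simp: is_chart_def)
  ultimately have "continuous_map (top_of_set ?S) (top_of_set (chart_image d)) (snd d \<circ> (\<lambda>x. f (chart_inv c x)))"
    by (rule continuous_map_compose)
  moreover have "snd d \<circ> (\<lambda>x. f (chart_inv c x)) = local_map c d f" by (auto simp: local_map_def)
  ultimately show "continuous_on ?S (local_map c d f)" by (simp add: continuous_map_in_subtopology)
  show "x \<in> ?S \<Longrightarrow> local_map c d f x \<in> chart_image d" "x \<in> ?S \<Longrightarrow> chart_inv d (local_map c d f x) = f (chart_inv c x)"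
    using is_chart_inverse(3,4)[OF d] by (auto simp: local_dom_def local_map_def)
qed

subsection \<open>The structure tensors in terms of lifts\<close>

lemma xi_left_mult:
  assumes "C \<in> SU3" "A differentiable (at x)"
  shows "xi (\<lambda>y. C ** A y) x u = xi A x u"
  unfolding xi_def mc_def
  using D_bounded_linear[OF bounded_bilinear.bounded_linear_right[OF bounded_bilinear_mm] assms(2), of C u]
  by (simp add: ct_mult SU3_cancel[OF assms(1)] flip: matrix_mul_assoc)

lemma SU3_map_left_mult:
  assumes "C \<in> SU3" "SU3_map W A"
  shows "SU3_map W (\<lambda>y. C ** A y)"
  using SU3_map_D[OF assms(2)] SU3_mult[OF assms(1)]
    smooth_on_bounded_linear[OF _ bounded_bilinear.bounded_linear_right[OF bounded_bilinear_mm]]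
  by (simp add: SU3_map_def)

lemma SU3_map_right_mult:
  assumes "C \<in> SU3" "SU3_map W A"
  shows "SU3_map W (\<lambda>y. A y ** C)"
  using SU3_map_D[OF assms(2)] SU3_mult[OF _ assms(1)]
    smooth_on_bounded_linear[OF _ bounded_bilinear.bounded_linear_left[OF bounded_bilinear_mm]]
  by (simp add: SU3_map_def)

text \<open>Two lifts of the same map differ by a torus-valued function, whose derivative is diagonal.\<close>

lemma lift_change:
  assumes A: "SU3_diff W A" "x \<in> W" and A': "SU3_diff W' A'" "x \<in> W'"
    and eq: "\<And>y. y \<in> W \<inter> W' \<Longrightarrow> act (A y) f_st = act (A' y) f_st"
  shows "conj_transpose (A x) ** A' x \<in> torus" "xi A' x u = twist (conj_transpose (A x) ** A' x) * xi A x u"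
proof -
  let ?V = "W \<inter> W'" and ?T = "\<lambda>y. conj_transpose (A y) ** A' y"
  have V: "open ?V" "x \<in> ?V" using assms SU3_diff_D(1) by auto
  have T: "?T y \<in> torus" if "y \<in> ?V" for y
    using that act_eq_iff eq SU3_diff_D(2)[OF A(1)] SU3_diff_D(2)[OF A'(1)] by blast
  have d: "?T differentiable (at x)"
    by (intro differentiable_bilinear[OF bounded_bilinear_mm] differentiable_bounded_linear[OF bounded_linear_ct]
        SU3_diff_D(3)[OF A] SU3_diff_D(3)[OF A'])
  have e: "A' y = A y ** ?T y" if "y \<in> ?V" for y
    using SU3_cancel(2)[OF SU3_diff_D(2)[OF A(1)]] that by simp
  have "xi A' x u = xi (\<lambda>y. A y ** ?T y) x u"
    unfolding xi_def mc_def using D_cong[OF V e] e[OF V(2)] by simp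
  also have "\<dots> = twist (?T x) * xi A x u"
    by (rule xi_change(1)[OF SU3_diff_subset[OF A(1) V(1)] V(2) T d]) auto
  finally show "xi A' x u = twist (?T x) * xi A x u" .
  show "?T x \<in> torus" using T V by blast
qed

lemma xi_compose:
  assumes "F differentiable (at x)" "A differentiable (at (F x))"
  shows "xi (\<lambda>y. A (F y)) x u = xi A (F x) (D F x u)"
  unfolding xi_def mc_def by (simp add: D_chain[OF assms])

lemma flag_atlas_chart: "d \<in> flag_atlas \<Longrightarrow> is_chart flag_topology d"
  by (simp add: flag_atlas_def)

lemma flag_lift_map: "flag_lift c W A \<Longrightarrow> SU3_map W A"
  by (simp add: flag_lift_def SU3_map_def)

lemma flag_lift_xi_inj:
  assumes c: "c \<in> flag_atlas" and A: "flag_lift c W A" "x \<in> W"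
  shows "inj (xi A x)"
proof -
  have "x \<in> chart_image c" using A by (auto simp: flag_lift_def)
  then obtain W' A' where A': "flag_lift c W' A'" "x \<in> W'" "inj (flag_coframe A' x)"
    using c by (auto simp: flag_atlas_def)
  have "inj (xi A' x)"
    using A' inj_coframe_iff[OF SU3_diffI[OF flag_lift_map[OF A'(1)]] A'(2)] by simp
  moreover have "xi A' x u = twist (conj_transpose (A x) ** A' x) * xi A x u" for u
    by (rule lift_change(2)[OF SU3_diffI[OF flag_lift_map[OF A(1)]] A(2) SU3_diffI[OF flag_lift_map[OF A'(1)]] A'(2)])
      (use A(1) A'(1) in \<open>simp add: flag_lift_def\<close>)
  ultimately show ?thesis unfolding inj_def by metis
qed

lemma flag_lift_exists:
  assumes "c \<in> flag_atlas" "x \<in> chart_image c"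
  obtains W A where "flag_lift c W A" "x \<in> W"
  using assms by (auto simp: flag_atlas_def)

lemma invariant_tensor_eq:
  assumes b: "\<And>X Y. skew X \<Longrightarrow> skew Y \<Longrightarrow> \<beta> (m_proj X) (m_proj Y) = b (coords X) (coords Y)"
    and inv: "\<And>t X Y. (\<And>i. norm (t $ i) = 1) \<Longrightarrow> b (t * X) (t * Y) = b X Y"
    and A: "flag_lift c W A" "x \<in> W"
  shows "invariant_tensor \<beta> c x u v = b (xi A x u) (xi A x v)"
proof -
  note d = SU3_diffI[OF flag_lift_map]
  have v: "\<beta> (flag_coframe A x u) (flag_coframe A x v) = b (xi A x u) (xi A x v)" if "flag_lift c W A" "x \<in> W" for A W
    using b[OF skew_mc[OF d[OF that(1)] that(2)] skew_mc[OF d[OF that(1)] that(2)]]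
    by (simp add: flag_coframe_def mc_def xi_def)
  have "b (xi A x u) (xi A x v) = b (xi A' x u) (xi A' x v)" if A': "flag_lift c W' A'" "x \<in> W'" for A' W'
  proof -
    have eq: "act (A y) f_st = act (A' y) f_st" if "y \<in> W \<inter> W'" for y
      using that A A' by (simp add: flag_lift_def)
    let ?T = "conj_transpose (A x) ** A' x"
    have T: "?T \<in> torus" by (rule lift_change(1)[OF d[OF A(1)] A(2) d[OF A'(1)] A'(2)]) (rule eq)
    have l: "xi A' x u = twist ?T * xi A x u" for u
      by (rule lift_change(2)[OF d[OF A(1)] A(2) d[OF A'(1)] A'(2)]) (rule eq)
    show ?thesis unfolding l[of u] l[of v] using inv[of "twist ?T" "xi A x u" "xi A x v"] twist_norm[OF T] by simp
  qed
  then show ?thesis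
    unfolding invariant_tensor_def using v A by (intro the_equality) (metis, metis)
qed

lemma flag_metric_eq:
  "flag_lift c W A \<Longrightarrow> x \<in> W \<Longrightarrow> flag_metric c x u v = xi A x u \<bullet> xi A x v"
  unfolding flag_metric_def
  by (rule invariant_tensor_eq[where b = "(\<bullet>)"]) (auto simp: g_m_m_proj unit_mult_inner)

lemma flag_omega_eq:
  "flag_lift c W A \<Longrightarrow> x \<in> W \<Longrightarrow> flag_omega c x u v = kaehler (xi A x u) (xi A x v)"
  unfolding flag_omega_def
  by (rule invariant_tensor_eq[where b = kaehler]) (auto simp: \<omega>_m_m_proj unit_mult_inner)

lemma of_c3_inj: "of_c3 X = of_c3 Y \<Longrightarrow> X = Y"
  by (metis c3_inverse(1))

lemma flag_lift_xi_surj: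
  assumes "c \<in> flag_atlas" "flag_lift c W A" "x \<in> W"
  shows "\<exists>w. xi A x w = Z"
proof -
  note l = linear_xi[OF SU3_diffI[OF flag_lift_map[OF assms(2)]] assms(3)]
  have "linear (\<lambda>u. of_c3 (xi A x u))"
    using linear_compose[OF l linear_of_c3] by (simp add: o_def)
  moreover have "inj (\<lambda>u. of_c3 (xi A x u))"
    using flag_lift_xi_inj[OF assms] unfolding inj_def by (metis c3_inverse(1))
  ultimately have "surj (\<lambda>u. of_c3 (xi A x u))" using linear_injective_imp_surjective by blast
  then obtain u where "of_c3 Z = of_c3 (xi A x u)" by (rule surjE)
  then have "Z = xi A x u" by (rule of_c3_inj)
  then show ?thesis by blast
qed

subsection \<open>The Levi-Civita connection\<close>

text \<open>The homogeneous space is naturally reductive: half the bracket has to be added to the canonical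
  connection in order to make it torsion free, and it remains metric because the bracket is totally
  skew.\<close>

lemma flag_christoffel:
  assumes c: "c \<in> flag_atlas" and A: "flag_lift c W A" "x \<in> W"
  shows "xi A x (christoffel (flag_metric c) x u v) = canon A x u v + (1/2) *\<^sub>R ccross (xi A x u) (xi A x v)"
proof -
  note m = flag_lift_map[OF A(1)]
  let ?x = "xi A x" and ?N = "canon A x"
  obtain w where w: "?x w = ?N u v + (1/2) *\<^sub>R ccross (?x u) (?x v)"
    using flag_lift_xi_surj[OF c A] by blast
  have g: "D (\<lambda>y. flag_metric c y a b) x z = ?N z a \<bullet> ?x b + ?x a \<bullet> ?N z b" for a b z
  proof -
    have "D (\<lambda>y. flag_metric c y a b) x z = D (\<lambda>y. xi A y a \<bullet> xi A y b) x z"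
      using D_cong[OF SU3_map_D(1)[OF m] A(2) flag_metric_eq[OF A(1)]] by simp
    then show ?thesis by (simp add: canon_metric(1)[OF m A(2)])
  qed
  have tor: "?N a b = ?N b a - ccross (?x a) (?x b)" for a b
    using canon_torsion[OF m A(2), of a b] by (simp add: algebra_simps)
  have skew: "X \<bullet> ccross Y Z = - (Y \<bullet> ccross X Z)" for X Y Z
    by (simp add: inner_c3 algebra_simps)
  have koszul: "2 * flag_metric c x w z = D (\<lambda>y. flag_metric c y v z) x u + D (\<lambda>y. flag_metric c y u z) x v
      - D (\<lambda>y. flag_metric c y u v) x z" for z
  proof -
    have "D (\<lambda>y. flag_metric c y v z) x u + D (\<lambda>y. flag_metric c y u z) x v - D (\<lambda>y. flag_metric c y u v) x z
      = ?N u v \<bullet> ?x z + ?x v \<bullet> (?N u z - ?N z u) + ?N v u \<bullet> ?x z + ?x u \<bullet> (?N v z - ?N z v)"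
      unfolding g by (simp add: inner_diff_right inner_commute)
    also have "\<dots> = (?N u v + ?N v u) \<bullet> ?x z - (?x v \<bullet> ccross (?x u) (?x z) + ?x u \<bullet> ccross (?x v) (?x z))"
      unfolding tor[of u z] tor[of v z] by (simp add: inner_add_left inner_diff_right)
    also have "\<dots> = (?N u v + ?N v u) \<bullet> ?x z" using skew[of "?x v" "?x u" "?x z"] by simp
    also have "?N v u = ?N u v + ccross (?x u) (?x v)"
      using tor[of v u] ccross_anti[of "?x u" "?x v"] by simp
    also have "(?N u v + (?N u v + ccross (?x u) (?x v))) \<bullet> ?x z = 2 * (?N u v \<bullet> ?x z) + ccross (?x u) (?x v) \<bullet> ?x z"
      unfolding inner_add_left by simp
    finally show ?thesis unfolding flag_metric_eq[OF A] w inner_add_left by simp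
  qed
  have "christoffel (flag_metric c) x u v = w"
    unfolding christoffel_def
  proof (rule the_equality)
    show "\<forall>z. 2 * flag_metric c x w z = D (\<lambda>y. flag_metric c y v z) x u + D (\<lambda>y. flag_metric c y u z) x v
      - D (\<lambda>y. flag_metric c y u v) x z" using koszul by blast
    fix w' assume "\<forall>z. 2 * flag_metric c x w' z = D (\<lambda>y. flag_metric c y v z) x u
      + D (\<lambda>y. flag_metric c y u z) x v - D (\<lambda>y. flag_metric c y u v) x z"
    then have "2 * flag_metric c x w' z = 2 * flag_metric c x w z" for z using koszul by simp
    then have "?x w' \<bullet> ?x (w' - w) = ?x w \<bullet> ?x (w' - w)" by (simp add: flag_metric_eq[OF A])
    then have "(?x w' - ?x w) \<bullet> ?x (w' - w) = 0" by (simp add: inner_diff_left)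
    moreover have "?x (w' - w) = ?x w' - ?x w" using linear_diff[OF linear_xi[OF SU3_diffI[OF m] A(2)]] .
    ultimately have "?x w' = ?x w" by simp
    then show "w' = w" using flag_lift_xi_inj[OF c A] by (simp add: inj_def)
  qed
  then show ?thesis using w by simp
qed

text \<open>\<open>J\<close> is the multiplication by \<open>\<i>\<close> in the coordinates of \<open>\<mm>\<close>.\<close>

lemma flag_J_eq:
  assumes c: "c \<in> flag_atlas" and A: "flag_lift c W A" "x \<in> W"
  shows "flag_metric c x (flag_J c x u) v = flag_omega c x u v"
    "(\<And>v. flag_metric c x w v = flag_omega c x u v) \<Longrightarrow> flag_J c x u = w"
proof -
  let ?x = "xi A x"
  obtain w0 where w0: "?x w0 = (\<chi> i. \<i> * ?x u $ i)" using flag_lift_xi_surj[OF c A] by blast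
  have 1: "flag_metric c x w0 v = flag_omega c x u v" for v
    by (simp add: flag_metric_eq[OF A] flag_omega_eq[OF A] w0 kaehler_inner)
  have 2: "w = w0" if "\<And>v. flag_metric c x w v = flag_omega c x u v" for w
  proof -
    have "flag_metric c x w (w - w0) = flag_metric c x w0 (w - w0)" using that 1 by simp
    then have "(?x w - ?x w0) \<bullet> ?x (w - w0) = 0" by (simp add: flag_metric_eq[OF A] inner_diff_left)
    moreover have "?x (w - w0) = ?x w - ?x w0"
      using linear_diff[OF linear_xi[OF SU3_diffI[OF flag_lift_map[OF A(1)]] A(2)]] .
    ultimately show ?thesis using flag_lift_xi_inj[OF c A] by (simp add: inj_def)
  qed
  have "flag_J c x u = w0" unfolding flag_J_def
    by (rule the_equality) (use 1 2 in blast)+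
  then show "flag_metric c x (flag_J c x u) v = flag_omega c x u v"
    "(\<And>v. flag_metric c x w v = flag_omega c x u v) \<Longrightarrow> flag_J c x u = w"
    using 1 2 by auto
qed

subsection \<open>Symmetries\<close>

lemma xi_two_sided:
  assumes B: "B \<in> SU3" and A: "A differentiable (at x)"
  shows "xi (\<lambda>y. B ** A y ** w) x u = coords (conj_transpose w ** mc A x u ** w)"
proof -
  have bl: "bounded_linear (\<lambda>X. B ** X ** w)"
    by (rule bounded_linear_compose[OF bounded_bilinear.bounded_linear_left[OF bounded_bilinear_mm]
        bounded_bilinear.bounded_linear_right[OF bounded_bilinear_mm]])
  show ?thesis
    unfolding xi_def mc_def D_bounded_linear[OF bl A]
    by (simp add: ct_mult SU3_cancel[OF B] flip: matrix_mul_assoc)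
qed

text \<open>The elements of the normalizer of the torus which preserve the metric and \<open>\<omega>\<^sub>J\<close> on \<open>\<mm>\<close>.\<close>

definition weyl :: "mat3 set" where
  "weyl = {w \<in> SU3. (\<forall>T\<in>torus. conj_transpose w ** T ** w \<in> torus) \<and>
     (\<forall>X Y. coords (conj_transpose w ** X ** w) \<bullet> coords (conj_transpose w ** Y ** w) = coords X \<bullet> coords Y \<and>
       kaehler (coords (conj_transpose w ** X ** w)) (coords (conj_transpose w ** Y ** w)) = kaehler (coords X) (coords Y))}"

lemma weyl_1: "mat 1 \<in> weyl"
  by (simp add: weyl_def SU3_1)

lemma weyl_mult:
  assumes "v \<in> weyl" "w \<in> weyl"
  shows "v ** w \<in> weyl"
proof -
  have "conj_transpose (v ** w) ** X ** (v ** w) = conj_transpose w ** (conj_transpose v ** X ** v) ** w" for X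
    by (simp add: ct_mult matrix_mul_assoc)
  then show ?thesis using assms by (simp add: weyl_def SU3_mult)
qed

lemma weyl_cyclic: "cyclic \<in> weyl"
proof -
  have e: "(conj_transpose cyclic ** X ** cyclic) $ i $ j = X $ (i + 1) $ (j + 1)" for X i j
    by (simp add: mult_cyclic ct_cyclic_mult)
  have "conj_transpose cyclic ** T ** cyclic \<in> torus" if "T \<in> torus" for T
    using that SU3_mult[OF SU3_mult[OF SU3_ct[OF cyclic_SU3]] cyclic_SU3] by (auto simp: torus_def e)
  then show ?thesis
    by (simp add: weyl_def cyclic_SU3 inner_c3 kaehler_def e numeral_mod_3)
qed

lemma weyl_ct:
  assumes "w \<in> {mat 1, cyclic, cyclic ** cyclic}"
  shows "w \<in> weyl" "conj_transpose w \<in> weyl"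
proof -
  have 1: "conj_transpose cyclic = cyclic ** cyclic"
  proof -
    have "(conj_transpose cyclic) $ i $ j = (cyclic ** cyclic) $ i $ j" for i j
      unfolding mult_cyclic using exhaust_3[of i] exhaust_3[of j] by (auto simp: cyclic_def numeral_mod_3)
    then show ?thesis by (simp add: mat3_eq_iff)
  qed
  have "conj_transpose (cyclic ** cyclic) = cyclic" unfolding 1[symmetric] by simp
  then show "w \<in> weyl" "conj_transpose w \<in> weyl"
    using assms 1 weyl_1 weyl_cyclic weyl_mult[OF weyl_cyclic weyl_cyclic] by auto
qed

text \<open>Left multiplication by \<open>B\<close> and right multiplication by an element of the Weyl group.\<close>

definition symmetry :: "mat3 \<Rightarrow> mat3 \<Rightarrow> flag \<Rightarrow> flag" where
  "symmetry B w f = act (B ** representative f ** w) f_st"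

lemma symmetry_act:
  assumes "B \<in> SU3" "w \<in> weyl" "A \<in> SU3"
  shows "symmetry B w (act A f_st) = act (B ** A ** w) f_st"
proof -
  let ?R = "representative (act A f_st)"
  have R: "?R \<in> SU3" "act ?R f_st = act A f_st" using representative act_flag[OF assms(3) f_st_flag] by auto
  have w: "w \<in> SU3" using assms by (simp add: weyl_def)
  have "conj_transpose ?R ** A \<in> torus" using act_eq_iff[OF R(1) assms(3)] R(2) by simp
  then have "conj_transpose w ** (conj_transpose ?R ** A) ** w \<in> torus" using assms by (simp add: weyl_def)
  then have "conj_transpose (B ** ?R ** w) ** (B ** A ** w) \<in> torus"
    by (simp add: ct_mult SU3_cancel[OF assms(1)] flip: matrix_mul_assoc)
  then show ?thesis
    unfolding symmetry_def using act_eq_iff SU3_mult assms R w by metis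
qed

lemma symmetry_continuous:
  assumes "B \<in> SU3" "w \<in> weyl"
  shows "continuous_map flag_topology flag_topology (symmetry B w)"
  unfolding continuous_map_def topspace_flag
proof (intro conjI allI impI)
  have w: "w \<in> SU3" using assms by (simp add: weyl_def)
  have S: "B ** A ** w \<in> SU3" if "A \<in> SU3" for A using SU3_mult assms w that by blast
  show fl: "symmetry B w \<in> flags \<rightarrow> flags"
    using symmetry_act[OF assms] S act_flag[OF _ f_st_flag] unfolding flags_orbit by auto
  fix U assume U: "openin flag_topology U"
  have "continuous_on UNIV (\<lambda>A. B ** A ** w)"
    by (rule linear_continuous_on[OF bounded_linear_compose[OF bounded_bilinear.bounded_linear_left[OF bounded_bilinear_mm]
          bounded_bilinear.bounded_linear_right[OF bounded_bilinear_mm]]])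
  then have "continuous_map (top_of_set SU3) flag_topology (\<lambda>A. act (B ** A ** w) f_st)"
    using S by (intro continuous_map_lift) (auto intro: continuous_on_subset)
  from openin_continuous_map_preimage[OF this U]
  have "openin (top_of_set SU3) {A \<in> SU3. act (B ** A ** w) f_st \<in> U}" by simp
  moreover have "{A \<in> SU3. act A f_st \<in> {f \<in> flags. symmetry B w f \<in> U}} = {A \<in> SU3. act (B ** A ** w) f_st \<in> U}"
    using symmetry_act[OF assms] act_flag[OF _ f_st_flag] by auto
  ultimately show "openin flag_topology {f \<in> flags. symmetry B w f \<in> U}"
    by (simp add: openin_flag_topology)
qed

context
  fixes B w c d
  assumes B: "B \<in> SU3" and w: "w \<in> weyl" and c: "c \<in> flag_atlas" and d: "d \<in> flag_atlas"
begin

lemma w_SU3: "w \<in> SU3"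
  using w by (simp add: weyl_def)

abbreviation "\<psi> \<equiv> local_map c d (symmetry B w)"
abbreviation "psi_dom \<equiv> local_dom c d (symmetry B w)"

lemmas psi_dom_facts = local_map_continuous[OF flag_atlas_chart[OF c] flag_atlas_chart[OF d] symmetry_continuous[OF B w]]

lemma symmetry_lift:
  assumes "flag_lift c W A" "flag_lift d W' A'" "y \<in> psi_dom" "y \<in> W" "\<psi> y \<in> W'"
  shows "act (A' (\<psi> y)) f_st = act (B ** A y ** w) f_st"
proof -
  have "act (A' (\<psi> y)) f_st = symmetry B w (chart_inv c y)"
    using assms psi_dom_facts(4)[OF assms(3)] by (simp add: flag_lift_def)
  also have "chart_inv c y = act (A y) f_st" using assms by (simp add: flag_lift_def)
  also have "symmetry B w \<dots> = act (B ** A y ** w) f_st"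
    using assms by (intro symmetry_act[OF B w]) (simp add: flag_lift_def)
  finally show ?thesis .
qed

lemma symmetry_lift_map: "flag_lift c W A \<Longrightarrow> SU3_map W (\<lambda>y. B ** A y ** w)"
  using SU3_map_right_mult[OF w_SU3 SU3_map_left_mult[OF B flag_lift_map]] .

text \<open>Let \<open>A\<close> and \<open>A'\<close> be lifts of the two charts. Composed with the coordinates of a big cell, \<open>A'\<close> becomes a
  local diffeomorphism \<open>f\<close> of Euclidean spaces, and \<open>f \<circ> \<psi>\<close> is an explicit function of \<open>A\<close>.\<close>

lemma symmetry_smooth: "smooth_on psi_dom \<psi>"
proof (rule smooth_on_local)
  fix x assume x: "x \<in> psi_dom"
  then have xc: "x \<in> chart_image c" by (simp add: local_dom_def)
  obtain W A where A: "flag_lift c W A" "x \<in> W" using flag_lift_exists[OF c xc] .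
  obtain W' A' where A': "flag_lift d W' A'" "\<psi> x \<in> W'" using flag_lift_exists[OF d psi_dom_facts(3)[OF x]] .
  define C where "C = A' (\<psi> x)"
  have C: "C \<in> SU3" using A' SU3_map_D(3)[OF flag_lift_map] by (auto simp: C_def)
  note CA = SU3_map_left_mult[OF SU3_ct[OF C] flag_lift_map[OF A'(1)]]
  define S where "S = {y \<in> W'. conj_transpose C ** A' y \<in> big_cell}"
  define f where "f y = of_c3 (cell_coords (conj_transpose C ** A' y))" for y
  have oW: "open W" "open W'" using SU3_map_D(1) flag_lift_map A A' by blast+
  have cS: "continuous_on W' (\<lambda>y. (conj_transpose C ** A' y) $ i $ i)" for i
    by (intro smooth_on_continuous smooth_on_nth SU3_map_D(2)[OF CA] oW)
  have S_eq: "S = (W' \<inter> (\<lambda>y. (conj_transpose C ** A' y) $ 1 $ 1) -` (- {0})) \<inter> (W' \<inter> (\<lambda>y. (conj_transpose C ** A' y) $ 3 $ 3) -` (- {0}))"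
    by (auto simp: S_def big_cell_def)
  have oS: "open S" unfolding S_eq
    by (intro open_Int continuous_open_preimage[OF cS oW(2)]) auto
  have xS: "\<psi> x \<in> S" using A' SU3_left[OF C] by (simp add: S_def C_def[symmetric] big_cell_def mat1_nth)
  define T where "T = (psi_dom \<inter> W) \<inter> \<psi> -` S"
  have "continuous_on (psi_dom \<inter> W) \<psi>" using psi_dom_facts(2) continuous_on_subset by blast
  then have oT: "open T" unfolding T_def using psi_dom_facts(1) oW oS by (intro continuous_open_preimage) auto
  have CS: "SU3_map S (\<lambda>y. conj_transpose C ** A' y)"
    by (rule SU3_map_subset[OF CA oS]) (auto simp: S_def)
  have big: "conj_transpose C ** A' y \<in> big_cell" if "y \<in> S" for y using that by (simp add: S_def)
  have "smooth_on T \<psi>"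
  proof (rule smooth_on_lift[OF oS oT])
    show "smooth_on S f" unfolding f_def
      by (intro smooth_on_bounded_linear[OF oS bounded_linear_c3(2)] smooth_on_cell_coords oS SU3_map_D(2)[OF CS] big)
    show "inj (D f y)" if y: "y \<in> S" for y
    proof -
      note cd = cell_coords_derivative[OF SU3_diffI[OF CS] y big[OF y]]
      have yW: "y \<in> W'" using y by (simp add: S_def)
      have Df: "D f y u = of_c3 (D (\<lambda>z. cell_coords (conj_transpose C ** A' z)) y u)" for u
        unfolding f_def by (rule D_bounded_linear[OF bounded_linear_c3(2) cd(1)])
      have "f differentiable (at y)" unfolding f_def
        by (rule differentiable_bounded_linear[OF bounded_linear_c3(2) cd(1)])
      then have "linear (D f y)" by (rule D_linear)
      moreover have "u = 0" if "D f y u = 0" for u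
      proof -
        have "D (\<lambda>z. cell_coords (conj_transpose C ** A' z)) y u = 0"
          using that Df by (metis c3_inverse(1) linear_0[OF c3_of(1)])
        then have "xi A' y u = 0"
          using cd(2) xi_left_mult[OF SU3_ct[OF C] SU3_map_D(4)[OF flag_lift_map[OF A'(1)] yW]] by simp
        then show ?thesis
          using flag_lift_xi_inj[OF d A'(1) yW]
            linear_injective_0[OF linear_xi[OF SU3_diffI[OF flag_lift_map[OF A'(1)]] yW]] by blast
      qed
      ultimately show ?thesis using linear_injective_0 by blast
    qed
    show "continuous_on T \<psi>" by (rule continuous_on_subset[OF psi_dom_facts(2)]) (auto simp: T_def)
    show "\<psi> ` T \<subseteq> S" by (auto simp: T_def)
    define k where "k z = of_c3 (cell_coords (conj_transpose C ** (B ** A z ** w)))" for z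
    have k: "f (\<psi> z) = k z" "conj_transpose C ** (B ** A z ** w) \<in> big_cell" if z: "z \<in> T" for z
    proof -
      have zz: "z \<in> psi_dom" "z \<in> W" "\<psi> z \<in> W'" "\<psi> z \<in> S" using z by (auto simp: T_def S_def)
      have S1: "A' (\<psi> z) \<in> SU3" using SU3_map_D(3)[OF flag_lift_map[OF A'(1)] zz(3)] .
      have S2: "B ** A z ** w \<in> SU3" using SU3_map_D(3)[OF symmetry_lift_map[OF A(1)] zz(2)] .
      note e = symmetry_lift[OF A(1) A'(1) zz(1-3)]
      have in1: "act (A' (\<psi> z)) f_st \<in> cell C" using cell_eval(1)[OF S1] big[OF zz(4)] by simp
      then have in2: "act (B ** A z ** w) f_st \<in> cell C" using e by simp
      then show "conj_transpose C ** (B ** A z ** w) \<in> big_cell" using cell_eval(1)[OF S2] by simp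
      show "f (\<psi> z) = k z"
        unfolding f_def k_def using cell_eval(2)[OF S1 in1] cell_eval(2)[OF S2 in2] e by simp
    qed
    have m: "SU3_map T (\<lambda>z. conj_transpose C ** (B ** A z ** w))"
      by (rule SU3_map_subset[OF SU3_map_left_mult[OF SU3_ct[OF C] symmetry_lift_map[OF A(1)]] oT]) (auto simp: T_def)
    have "smooth_on T k" unfolding k_def
      by (intro smooth_on_bounded_linear[OF oT bounded_linear_c3(2)] smooth_on_cell_coords oT SU3_map_D(2)[OF m] k(2))
    then show "smooth_on T (\<lambda>x. f (\<psi> x))" using smooth_on_cong[OF oT k(1)] by simp
  qed
  moreover have "x \<in> T" using x A xS by (simp add: T_def)
  ultimately show "\<exists>U. open U \<and> x \<in> U \<and> smooth_on U \<psi>" using oT by blast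
qed

text \<open>Both \<open>A' \<circ> \<psi>\<close> and \<open>B A w\<close> lift the same map; hence their coframes agree up to phases, and the second
  one is obtained from that of \<open>A\<close> by the adjoint action of \<open>w\<^sup>-\<^sup>1\<close>.\<close>

lemma symmetry_tensors:
  assumes x: "x \<in> psi_dom"
  shows "flag_metric d (\<psi> x) (D \<psi> x u) (D \<psi> x v) = flag_metric c x u v"
    "flag_omega d (\<psi> x) (D \<psi> x u) (D \<psi> x v) = flag_omega c x u v"
proof -
  have xc: "x \<in> chart_image c" using x by (simp add: local_dom_def)
  obtain W A where A: "flag_lift c W A" "x \<in> W" using flag_lift_exists[OF c xc] .
  obtain W' A' where A': "flag_lift d W' A'" "\<psi> x \<in> W'" using flag_lift_exists[OF d psi_dom_facts(3)[OF x]] .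
  have oW: "open W" "open W'" using SU3_map_D(1) flag_lift_map A A' by blast+
  define V where "V = psi_dom \<inter> \<psi> -` W'"
  have oV: "open V" unfolding V_def using psi_dom_facts(1,2) oW by (intro continuous_open_preimage)
  have xV: "x \<in> V" using x A' by (simp add: V_def)
  have d\<psi>: "\<psi> differentiable (at y)" if "y \<in> V" for y
    using smooth_on_differentiable[OF symmetry_smooth] that by (auto simp: V_def)
  have dA': "A' differentiable (at (\<psi> y))" if "y \<in> V" for y
    using SU3_map_D(4)[OF flag_lift_map[OF A'(1)]] that by (auto simp: V_def)
  have 1: "SU3_diff V (\<lambda>y. A' (\<psi> y))"
    unfolding SU3_diff_def
    using oV differentiable_chain_at[OF d\<psi> dA'] SU3_map_D(3)[OF flag_lift_map[OF A'(1)]]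
    by (auto simp: o_def V_def)
  note m = symmetry_lift_map[OF A(1)]
  have eq: "act (B ** A y ** w) f_st = act (A' (\<psi> y)) f_st" if "y \<in> W \<inter> V" for y
    using symmetry_lift[OF A(1) A'(1)] that by (simp add: V_def)
  have l1: "conj_transpose (B ** A x ** w) ** A' (\<psi> x) \<in> torus"
    by (rule lift_change(1)[OF SU3_diffI[OF m] A(2) 1 xV]) (rule eq)
  have l2: "xi (\<lambda>y. A' (\<psi> y)) x u = twist (conj_transpose (B ** A x ** w) ** A' (\<psi> x)) * xi (\<lambda>y. B ** A y ** w) x u" for u
    by (rule lift_change(2)[OF SU3_diffI[OF m] A(2) 1 xV]) (rule eq)
  have x1: "xi A' (\<psi> x) (D \<psi> x u) = twist (conj_transpose (B ** A x ** w) ** A' (\<psi> x)) * xi (\<lambda>y. B ** A y ** w) x u" for u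
    using l2[of u] xi_compose[OF d\<psi>[OF xV] dA'[OF xV]] by simp
  have "xi (\<lambda>y. B ** A y ** w) x u = coords (conj_transpose w ** mc A x u ** w)" for u
    by (rule xi_two_sided[OF B SU3_map_D(4)[OF flag_lift_map[OF A(1)] A(2)]])
  then have x2: "xi (\<lambda>y. B ** A y ** w) x u \<bullet> xi (\<lambda>y. B ** A y ** w) x v = xi A x u \<bullet> xi A x v"
    "kaehler (xi (\<lambda>y. B ** A y ** w) x u) (xi (\<lambda>y. B ** A y ** w) x v) = kaehler (xi A x u) (xi A x v)"
    using w by (simp_all add: weyl_def xi_def)
  show "flag_metric d (\<psi> x) (D \<psi> x u) (D \<psi> x v) = flag_metric c x u v"
    "flag_omega d (\<psi> x) (D \<psi> x u) (D \<psi> x v) = flag_omega c x u v"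
    unfolding flag_metric_eq[OF A'] flag_metric_eq[OF A] flag_omega_eq[OF A'] flag_omega_eq[OF A] x1
      unit_mult_inner[OF twist_norm[OF l1]] by (rule x2)+
qed

text \<open>\<open>J\<close> is determined by the metric and \<open>\<omega>\<^sub>J\<close>, both of which are preserved.\<close>

lemma symmetry_J:
  assumes x: "x \<in> psi_dom"
  shows "D \<psi> x (flag_J c x u) = flag_J d (\<psi> x) (D \<psi> x u)"
proof -
  have xc: "x \<in> chart_image c" using x by (simp add: local_dom_def)
  obtain W A where A: "flag_lift c W A" "x \<in> W" using flag_lift_exists[OF c xc] .
  obtain W' A' where A': "flag_lift d W' A'" "\<psi> x \<in> W'" using flag_lift_exists[OF d psi_dom_facts(3)[OF x]] .
  have l: "linear (D \<psi> x)" by (rule D_linear[OF smooth_on_differentiable[OF symmetry_smooth x]])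
  have "inj (D \<psi> x)"
  proof (subst linear_injective_0[OF l], intro allI impI)
    fix u assume "D \<psi> x u = 0"
    then have "flag_metric c x u u = 0"
      using symmetry_tensors(1)[OF x, of u u] linear_0[OF linear_xi[OF SU3_diffI[OF flag_lift_map[OF A'(1)]] A'(2)]]
      by (simp add: flag_metric_eq[OF A'])
    then have "xi A x u = 0" by (simp add: flag_metric_eq[OF A])
    then show "u = 0"
      using flag_lift_xi_inj[OF c A] linear_injective_0[OF linear_xi[OF SU3_diffI[OF flag_lift_map[OF A(1)]] A(2)]]
      by blast
  qed
  then have s: "surj (D \<psi> x)" using linear_injective_imp_surjective[OF l] by blast
  have "flag_J d (\<psi> x) (D \<psi> x u) = D \<psi> x (flag_J c x u)"
  proof (rule flag_J_eq(2)[OF d A'])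
    fix v'
    obtain v where "v' = D \<psi> x v" using s by (metis surjD)
    then show "flag_metric d (\<psi> x) (D \<psi> x (flag_J c x u)) v' = flag_omega d (\<psi> x) (D \<psi> x u) v'"
      by (simp add: symmetry_tensors[OF x] flag_J_eq(1)[OF c A])
  qed
  then show ?thesis by simp
qed

end

lemma symmetry_smooth_map:
  assumes "B \<in> SU3" "w \<in> weyl"
  shows "smooth_map flag_topology flag_atlas flag_topology flag_atlas (symmetry B w)"
  unfolding smooth_map_def using symmetry_continuous[OF assms] symmetry_smooth[OF assms] by blast

lemma smooth_map_cong:
  assumes f: "smooth_map M \<A> N \<B> f" and charts: "\<And>c. c \<in> \<A> \<Longrightarrow> is_chart M c" "\<And>d. d \<in> \<B> \<Longrightarrow> is_chart N d"
    and eq: "\<And>p. p \<in> topspace M \<Longrightarrow> f p = g p"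
  shows "smooth_map M \<A> N \<B> g"
proof -
  have cf: "continuous_map M N f" using f by (simp add: smooth_map_def)
  have "continuous_map M N g" using continuous_map_eq[OF cf] eq by blast
  moreover have "smooth_on (local_dom c d g) (local_map c d g)" if cd: "c \<in> \<A>" "d \<in> \<B>" for c d
  proof -
    have "chart_inv c x \<in> topspace M" if "x \<in> chart_image c" for x
      using is_chart_inverse(1)[OF charts(1)[OF cd(1)] that] charts(1)[OF cd(1)] openin_subset
      by (fastforce simp: is_chart_def)
    then have 1: "f (chart_inv c x) = g (chart_inv c x)" if "x \<in> chart_image c" for x using eq that by blast
    then have 2: "local_dom c d g = local_dom c d f" by (auto simp: local_dom_def)
    have "local_map c d f x = local_map c d g x" if "x \<in> local_dom c d f" for x
      using that 1 by (auto simp: local_dom_def local_map_def)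
    then show ?thesis
      using smooth_on_cong[OF local_map_continuous(1)[OF charts(1)[OF cd(1)] charts(2)[OF cd(2)] cf]] f cd 2
      by (metis smooth_map_def)
  qed
  ultimately show ?thesis by (simp add: smooth_map_def)
qed

theorem symmetry_isometry:
  assumes B: "B \<in> SU3" and w: "w \<in> weyl" "conj_transpose w \<in> weyl"
  shows "isometry flag_topology flag_atlas flag_metric (symmetry B w)"
    "preserves_endo flag_atlas flag_J (symmetry B w)"
proof -
  have wS: "w \<in> SU3" using w by (simp add: weyl_def)
  let ?f = "symmetry B w" and ?g = "symmetry (conj_transpose B) (conj_transpose w)"
  have S: "B ** A ** w \<in> SU3" "conj_transpose B ** A ** conj_transpose w \<in> SU3" if "A \<in> SU3" for A
    by (intro SU3_mult SU3_ct B wS that)+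
  have fg: "?g (?f p) = p" "?f (?g p) = p" "?f p \<in> flags" "?g p \<in> flags" if p: "p \<in> flags" for p
  proof -
    obtain A where A: "A \<in> SU3" "p = act A f_st" using flags_transitive[OF p] by metis
    have "?f p = act (B ** A ** w) f_st" "?g p = act (conj_transpose B ** A ** conj_transpose w) f_st"
      using A symmetry_act[OF B w(1)] symmetry_act[OF SU3_ct[OF B] w(2)] by auto
    then show "?g (?f p) = p" "?f (?g p) = p" "?f p \<in> flags" "?g p \<in> flags"
      using A S[OF A(1)] symmetry_act[OF B w(1) S(2)] symmetry_act[OF SU3_ct[OF B] w(2) S(1)] act_flag[OF _ f_st_flag]
      by (simp_all add: SU3_cancel[OF B] SU3_cancel[OF wS] flip: matrix_mul_assoc)
         (simp_all add: SU3_cancel[OF B] SU3_cancel[OF wS] SU3_left[OF wS] SU3_right[OF wS] matrix_mul_assoc)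
  qed
  have bij: "bij_betw ?f flags flags"
    by (rule bij_betw_byWitness[where f' = ?g]) (use fg in auto)
  have "inv_into flags ?f p = ?g p" if "p \<in> flags" for p
    using inv_into_f_f[OF bij_betw_imp_inj_on[OF bij] fg(4)[OF that]] fg(2)[OF that] by simp
  then have "smooth_map flag_topology flag_atlas flag_topology flag_atlas (inv_into flags ?f)"
    using smooth_map_cong[OF symmetry_smooth_map[OF SU3_ct[OF B] w(2)] flag_atlas_chart flag_atlas_chart]
    by (simp add: topspace_flag)
  then show "isometry flag_topology flag_atlas flag_metric ?f"
    unfolding isometry_def diffeomorphism_def topspace_flag
    using bij symmetry_smooth_map[OF B w(1)] symmetry_tensors(1)[OF B w(1)] by blast
  show "preserves_endo flag_atlas flag_J ?f"
    unfolding preserves_endo_def using symmetry_J[OF B w(1)] by blast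
qed

section \<open>Totally geodesic Lagrangian submanifolds, globally\<close>

subsection \<open>Lifts of the immersion\<close>

lemma xi_expand:
  assumes "SU3_diff W A" "y \<in> W"
  shows "xi A y V = (\<Sum>b\<in>Basis. (V \<bullet> b) *\<^sub>R xi A y b)"
  using linear_sum[OF linear_xi[OF assms], of "\<lambda>b. (V \<bullet> b) *\<^sub>R b" Basis] linear_scale[OF linear_xi[OF assms]]
  by (simp add: euclidean_representation)

text \<open>The covariant derivative along a composite: a field with components \<open>D F y v\<close> is differentiated both
  through its base point and through its components.\<close>

lemma canon_compose:
  assumes A: "SU3_map W' A" and W: "open W" "x \<in> W" and F: "smooth_on W F" "F ` W \<subseteq> W'"
  shows "canon (\<lambda>y. A (F y)) x u v = canon A (F x) (D F x u) (D F x v) + xi A (F x) (D (\<lambda>y. D F y v) x u)"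
proof -
  define G where "G y = D F y v" for y
  note d = SU3_diffI[OF A]
  have FW: "F y \<in> W'" if "y \<in> W" for y using F that by auto
  have dF: "F differentiable (at y)" if "y \<in> W" for y by (rule smooth_on_differentiable[OF F(1) that])
  have dG: "G differentiable (at x)"
    unfolding G_def by (rule smooth_on_differentiable[OF smooth_on_D[OF F(1)] W(2)])
  have xiB: "xi (\<lambda>y. A (F y)) y v = (\<Sum>b\<in>Basis. (G y \<bullet> b) *\<^sub>R xi A (F y) b)" if "y \<in> W" for y
    unfolding xi_compose[OF dF[OF that] SU3_map_D(4)[OF A FW[OF that]]] G_def
    by (rule xi_expand[OF d FW[OF that]])
  have dxi: "(\<lambda>y. xi A (F y) b) differentiable (at x)" for b
    using differentiable_chain_at[OF dF[OF W(2)] xi_differentiable(1)[OF A FW[OF W(2)]]] by (simp add: o_def)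
  have Dxi: "D (\<lambda>y. xi A (F y) b) x u = D (\<lambda>z. xi A z b) (F x) (D F x u)" for b
    by (rule D_chain[OF dF[OF W(2)] xi_differentiable(1)[OF A FW[OF W(2)]]])
  have dGb: "(\<lambda>y. G y \<bullet> b) differentiable (at x)" for b
    by (rule differentiable_bounded_linear[OF bounded_linear_inner_left dG])
  have DGb: "D (\<lambda>y. G y \<bullet> b) x u = D G x u \<bullet> b" for b
    by (rule D_bounded_linear[OF bounded_linear_inner_left dG])
  have 1: "D (\<lambda>y. xi (\<lambda>y. A (F y)) y v) x u
    = (\<Sum>b\<in>Basis. (G x \<bullet> b) *\<^sub>R D (\<lambda>z. xi A z b) (F x) (D F x u) + (D G x u \<bullet> b) *\<^sub>R xi A (F x) b)"
  proof -
    have "((\<lambda>y. \<Sum>b\<in>Basis. (G y \<bullet> b) *\<^sub>R xi A (F y) b) has_derivative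
      (\<lambda>u. \<Sum>b\<in>Basis. D (\<lambda>y. (G y \<bullet> b) *\<^sub>R xi A (F y) b) x u)) (at x)"
      by (intro has_derivative_sum D_has_derivative differentiable_bilinear[OF bounded_bilinear_scaleR dGb dxi])
    then have "D (\<lambda>y. \<Sum>b\<in>Basis. (G y \<bullet> b) *\<^sub>R xi A (F y) b) x u
      = (\<Sum>b\<in>Basis. D (\<lambda>y. (G y \<bullet> b) *\<^sub>R xi A (F y) b) x u)" by (simp add: D_eq)
    then show ?thesis
      using D_cong[OF W xiB] by (simp add: D_bilinear[OF bounded_bilinear_scaleR dGb dxi] DGb Dxi)
  qed
  have 2: "D (\<lambda>z. xi A z (G x)) (F x) U = (\<Sum>b\<in>Basis. (G x \<bullet> b) *\<^sub>R D (\<lambda>z. xi A z b) (F x) U)" for U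
  proof -
    have "((\<lambda>z. \<Sum>b\<in>Basis. (G x \<bullet> b) *\<^sub>R xi A z b) has_derivative
      (\<lambda>U. \<Sum>b\<in>Basis. (G x \<bullet> b) *\<^sub>R D (\<lambda>z. xi A z b) (F x) U)) (at (F x))"
      by (intro has_derivative_sum bounded_linear.has_derivative[OF bounded_linear_scaleR_right]
          D_has_derivative xi_differentiable(1)[OF A FW[OF W(2)]])
    then show ?thesis
      using D_cong[OF SU3_map_D(1)[OF A] FW[OF W(2)] xi_expand[OF d]] by (simp add: D_eq)
  qed
  have 3: "mc (\<lambda>y. A (F y)) x u = mc A (F x) (D F x u)"
    unfolding mc_def by (simp add: D_chain[OF dF[OF W(2)] SU3_map_D(4)[OF A FW[OF W(2)]]])
  show ?thesis
    unfolding canon_def 1 3 sum.distrib 2[symmetric]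
      xi_compose[OF dF[OF W(2)] SU3_map_D(4)[OF A FW[OF W(2)]]] G_def[symmetric]
    by (simp add: xi_expand[OF d FW[OF W(2)], of "D G x u"])
qed

text \<open>With \<open>canon_compose\<close> and \<open>flag_christoffel\<close>, the coframe turns the covariant Hessian into the canonical
  derivative plus half the bracket.\<close>

lemma lagrangian_lift:
  assumes L: "Lagrangian L \<A> \<iota>" and tg: "totally_geodesic \<A> flag_atlas flag_metric \<iota>"
    and c: "c \<in> \<A>" and x: "x \<in> chart_image c"
  obtains W B where "tgl W B" "x \<in> W" "W \<subseteq> chart_image c" "\<And>y. y \<in> W \<Longrightarrow> act (B y) f_st = \<iota> (chart_inv c y)"
proof -
  have imm: "immersion L \<A> flag_topology flag_atlas \<iota>" and man: "smooth_manifold L \<A>"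
    using L by (auto simp: Lagrangian_def flag_submanifold3_def)
  have sm: "smooth_map L \<A> flag_topology flag_atlas \<iota>" using imm by (simp add: immersion_def)
  have cont: "continuous_map L flag_topology \<iota>" using sm by (simp add: smooth_map_def)
  have cc: "is_chart L c" using man c by (simp add: smooth_manifold_def)
  have "chart_inv c x \<in> topspace L"
    using is_chart_inverse(1)[OF cc x] cc openin_subset by (fastforce simp: is_chart_def)
  then have fl: "\<iota> (chart_inv c x) \<in> flags" using cont topspace_flag by (auto simp: continuous_map_def)
  define d where "d = cell_chart (representative (\<iota> (chart_inv c x)))"
  have d: "d \<in> flag_atlas" unfolding d_def by (rule cell_chart_atlas[OF representative(1)[OF fl]])
  have "\<iota> (chart_inv c x) \<in> fst d"
    using cell_self[OF representative(1)[OF fl]] representative(2)[OF fl] by (simp add: d_def cell_chart_def)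
  then have xd: "x \<in> local_dom c d \<iota>" using x by (simp add: local_dom_def)
  define F where "F = local_map c d \<iota>"
  note lm = local_map_continuous[OF cc flag_atlas_chart[OF d] cont, folded F_def]
  obtain W' A where A: "flag_lift d W' A" "F x \<in> W'" using flag_lift_exists[OF d lm(3)[OF xd]] .
  note mA = flag_lift_map[OF A(1)]
  have sF: "smooth_on (local_dom c d \<iota>) F" using sm c d by (simp add: smooth_map_def F_def)
  define W where "W = local_dom c d \<iota> \<inter> F -` W'"
  have oW: "open W" unfolding W_def
    by (rule continuous_open_preimage[OF lm(2,1) SU3_map_D(1)[OF mA]])
  have sFW: "smooth_on W F" by (rule smooth_on_subset[OF sF]) (auto simp: W_def)
  have FW: "F ` W \<subseteq> W'" by (auto simp: W_def)
  define B where "B y = A (F y)" for y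
  have mB: "SU3_map W B" unfolding SU3_map_def B_def
    using smooth_on_compose[OF oW SU3_map_D(1)[OF mA] FW sFW SU3_map_D(2)[OF mA]] oW FW SU3_map_D(3)[OF mA] by auto
  have Wd: "y \<in> local_dom c d \<iota>" "F y \<in> W'" if "y \<in> W" for y using that by (auto simp: W_def)
  have xiB: "xi B y u = xi A (F y) (D F y u)" if "y \<in> W" for y u
    unfolding B_def
    by (rule xi_compose[OF smooth_on_differentiable[OF sFW that] SU3_map_D(4)[OF mA Wd(2)[OF that]]])
  have "tgl W B" unfolding tgl_def
  proof (intro conjI ballI allI)
    show "SU3_map W B" by (rule mB)
    fix y assume y: "y \<in> W"
    note lA = linear_xi[OF SU3_diffI[OF mA] Wd(2)[OF y]]
    have "inj (D F y)" using imm c d Wd(1)[OF y] by (simp add: immersion_def F_def)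
    moreover have "inj (xi A (F y))" by (rule flag_lift_xi_inj[OF d A(1) Wd(2)[OF y]])
    ultimately show "inj (xi B y)" unfolding inj_def xiB[OF y] by blast
    fix u v
    show "kaehler (xi B y u) (xi B y v) = 0"
    proof -
      have "flag_omega d (F y) (D F y u) (D F y v) = 0"
        using L c d Wd(1)[OF y] unfolding Lagrangian_def pullback_vanishes_def F_def by blast
      then show ?thesis by (simp add: xiB[OF y] flag_omega_eq[OF A(1) Wd(2)[OF y]])
    qed
    have "covariant_hessian (flag_metric d) F y u v \<in> range (D F y)"
      using tg c d Wd(1)[OF y] by (simp add: totally_geodesic_def F_def)
    then obtain w where w: "covariant_hessian (flag_metric d) F y u v = D F y w" by blast
    have "xi A (F y) (covariant_hessian (flag_metric d) F y u v)
        = canon B y u v + (1/2) *\<^sub>R ccross (xi B y u) (xi B y v)"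
      unfolding covariant_hessian_def linear_add[OF lA] flag_christoffel[OF d A(1) Wd(2)[OF y]]
        canon_compose[OF mA oW y sFW FW, folded B_def] xiB[OF y] by simp
    then have "canon B y u v + (1/2) *\<^sub>R ccross (xi B y u) (xi B y v) = xi B y w" by (simp add: w xiB[OF y])
    then show "canon B y u v + (1/2) *\<^sub>R ccross (xi B y u) (xi B y v) \<in> range (xi B y)" by blast
  qed
  moreover have "x \<in> W" using xd A(2) by (simp add: W_def)
  moreover have "W \<subseteq> chart_image c" by (auto simp: W_def local_dom_def)
  moreover have "act (B y) f_st = \<iota> (chart_inv c y)" if "y \<in> W" for y
    using A(1) Wd[OF that] lm(4)[OF Wd(1)[OF that]] by (simp add: B_def flag_lift_def)
  ultimately show ?thesis using that by blast
qed

subsection \<open>The submanifold lies in one homogeneous model\<close>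

locale tg_lagrangian =
  fixes L :: "'l topology" and \<A> :: "('l, real^3) chart set" and \<iota> :: "'l \<Rightarrow> flag"
  assumes L: "Lagrangian L \<A> \<iota>" and conn: "connected_space L"
    and tg: "totally_geodesic \<A> flag_atlas flag_metric \<iota>"
begin

lemma manifold: "smooth_manifold L \<A>"
  using L by (simp add: Lagrangian_def flag_submanifold3_def)

lemma chart: "c \<in> \<A> \<Longrightarrow> is_chart L c"
  using manifold by (simp add: smooth_manifold_def)

text \<open>A lift over the part \<open>W\<close> of a chart which has a constant tangent space and stays in one coset.\<close>

definition adapted :: "('l, real^3) chart \<Rightarrow> (real^3) set \<Rightarrow> (real^3 \<Rightarrow> mat3) \<Rightarrow> 3 option \<Rightarrow> bool" where
  "adapted c W B m \<longleftrightarrow> SU3_diff W B \<and> W \<subseteq> chart_image c \<and> (\<forall>y\<in>W. inj (xi B y)) \<and>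
     (\<forall>y\<in>W. act (B y) f_st = \<iota> (chart_inv c y)) \<and> (\<forall>y\<in>W. range (xi B y) = model m) \<and>
     (\<forall>y\<in>W. \<forall>z\<in>W. conj_transpose (B y) ** B z \<in> model_group m)"

text \<open>The points near which the submanifold lies in the translate by \<open>C\<close> of the orbit of the model
  group.\<close>

definition part :: "3 option \<Rightarrow> mat3 \<Rightarrow> 'l set" where
  "part m C = {p. \<exists>c\<in>\<A>. \<exists>W B. p \<in> fst c \<and> snd c p \<in> W \<and> adapted c W B m \<and>
     conj_transpose C ** B (snd c p) \<in> model_group m}"

lemma part_cover:
  assumes "p \<in> topspace L"
  shows "\<exists>m C. C \<in> SU3 \<and> p \<in> part m C"
proof -
  have "p \<in> (\<Union>c\<in>\<A>. fst c)" using assms manifold by (simp add: smooth_manifold_def)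
  then obtain c where c: "c \<in> \<A>" "p \<in> fst c" by (rule UN_E)
  note ch = chart[OF c(1)]
  define x where "x = snd c p"
  have x: "x \<in> chart_image c" unfolding x_def by (rule is_chart_inverse(4)[OF ch c(2)])
  obtain W B where B: "tgl W B" "x \<in> W" "W \<subseteq> chart_image c" "\<And>y. y \<in> W \<Longrightarrow> act (B y) f_st = \<iota> (chart_inv c y)"
    by (rule lagrangian_lift[OF L tg c(1) x]) blast
  obtain U T m where U: "open U" "convex U" "x \<in> U" "U \<subseteq> W" and T: "\<And>y. y \<in> U \<Longrightarrow> T y \<in> torus"
    and BT: "SU3_diff U (\<lambda>y. B y ** T y)" "\<And>y. y \<in> U \<Longrightarrow> range (xi (\<lambda>y. B y ** T y) y) = model m"
    "\<And>y z. y \<in> U \<Longrightarrow> z \<in> U \<Longrightarrow> conj_transpose (B y ** T y) ** (B z ** T z) \<in> model_group m"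
    by (rule adapted_lift[OF B(1,2)]) blast
  have "inj (xi (\<lambda>y. B y ** T y) y)" if y: "y \<in> U" for y
  proof -
    have yW: "y \<in> W" using y U by blast
    have S: "B y \<in> SU3" using SU3_map_D(3)[OF tgl_map[OF B(1)] yW] .
    have "act (B z) f_st = act (B z ** T z) f_st" if "z \<in> W \<inter> U" for z
      using T that by (simp add: act_mult act_torus)
    then have "xi (\<lambda>y. B y ** T y) y u = twist (conj_transpose (B y) ** (B y ** T y)) * xi B y u" for u
      by (rule lift_change(2)[OF tgl_diff[OF B(1)] yW BT(1) y])
    then have "xi (\<lambda>y. B y ** T y) y u = twist (T y) * xi B y u" for u by (simp add: SU3_cancel[OF S])
    moreover have "X = Y" if "twist (T y) * X = twist (T y) * Y" for X Y
    proof -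
      have "twist (T y) $ i \<noteq> 0" for i using twist_norm[OF T[OF y], of i] by auto
      then show ?thesis using that by (metis mult_left_cancel vec_eq_iff vector_mult_component)
    qed
    moreover have "u = v" if "xi B y u = xi B y v" for u v
      using B(1) yW that by (auto simp: tgl_def dest: injD)
    ultimately show ?thesis by (intro injI) simp
  qed
  then have "adapted c U (\<lambda>y. B y ** T y) m"
    using BT U B T by (auto simp: adapted_def act_mult act_torus)
  moreover have "B x ** T x \<in> SU3" using SU3_diff_D(2)[OF BT(1) U(3)] .
  moreover have "conj_transpose (B x ** T x) ** (B x ** T x) \<in> model_group m" using BT(3)[OF U(3) U(3)] .
  ultimately show ?thesis using c U(3) unfolding part_def x_def by blast
qed

lemma part_sub: "part m C \<subseteq> topspace L"
  using chart openin_subset unfolding part_def is_chart_def by fastforce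

lemma part_open: "openin L (part m C)"
proof (subst openin_subopen, intro ballI)
  fix p assume "p \<in> part m C"
  then obtain c W B where c: "c \<in> \<A>" "p \<in> fst c" "snd c p \<in> W" and B: "adapted c W B m"
    "conj_transpose C ** B (snd c p) \<in> model_group m" by (auto simp: part_def)
  define T where "T = {q \<in> fst c. snd c q \<in> W}"
  have ch: "openin L (fst c)" "homeomorphic_map (subtopology L (fst c)) (top_of_set (chart_image c)) (snd c)"
    using chart[OF c(1)] by (auto simp: is_chart_def)
  have "openin (top_of_set (chart_image c)) W"
    using B(1) SU3_diff_D(1) by (auto simp: adapted_def intro: open_subset)
  from openin_continuous_map_preimage[OF homeomorphic_imp_continuous_map[OF ch(2)] this]
  have "openin (subtopology L (fst c)) {q \<in> topspace (subtopology L (fst c)). snd c q \<in> W}" .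
  moreover have "{q \<in> topspace (subtopology L (fst c)). snd c q \<in> W} = T"
    using openin_subset[OF ch(1)] by (auto simp: T_def)
  ultimately have "openin L T" using openin_open_subtopology[OF ch(1)] by auto
  moreover have "q \<in> part m C" if q: "q \<in> T" for q
  proof -
    have W: "snd c q \<in> W" "q \<in> fst c" using q by (auto simp: T_def)
    have S: "B (snd c p) \<in> SU3" using B(1) SU3_diff_D(2) c(3) by (auto simp: adapted_def)
    have "conj_transpose (B (snd c p)) ** B (snd c q) \<in> model_group m"
      using B(1) c(3) W(1) by (simp add: adapted_def)
    from model_group_mult[OF B(2) this]
    have "conj_transpose C ** B (snd c q) \<in> model_group m"
      by (simp add: SU3_cancel[OF S] flip: matrix_mul_assoc)
    then show ?thesis using c(1) W B(1) unfolding part_def by blast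
  qed
  ultimately show "\<exists>T. openin L T \<and> p \<in> T \<and> T \<subseteq> part m C" using c by (auto simp: T_def)
qed

lemma part_mono:
  assumes "C \<in> SU3" "conj_transpose C' ** C \<in> model_group m"
  shows "part m C \<subseteq> part m C'"
proof
  fix p assume "p \<in> part m C"
  then obtain c W B where c: "c \<in> \<A>" "p \<in> fst c" "snd c p \<in> W" and B: "adapted c W B m"
    "conj_transpose C ** B (snd c p) \<in> model_group m" by (auto simp: part_def)
  from model_group_mult[OF assms(2) B(2)]
  have "conj_transpose C' ** B (snd c p) \<in> model_group m"
    by (simp add: SU3_cancel[OF assms(1)] flip: matrix_mul_assoc)
  then show "p \<in> part m C'" using c B(1) unfolding part_def by blast
qed

text \<open>After passing to a common chart, the two lifts differ by a torus element that carries one model to the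
  other.\<close>

lemma adapted_unique:
  assumes c: "c \<in> \<A>" "p \<in> fst c" "snd c p \<in> W" and B: "adapted c W B m"
    and c': "c' \<in> \<A>" "p \<in> fst c'" "snd c' p \<in> W'" and B': "adapted c' W' B' n"
  shows "m = n" "conj_transpose (B (snd c p)) ** B' (snd c' p) \<in> model_group m"
proof -
  define x where "x = snd c p"
  define g where "g = local_map c c' id"
  note lm = local_map_continuous[OF chart[OF c(1)] chart[OF c'(1)] continuous_map_id, folded g_def]
  have g: "g = snd c' \<circ> chart_inv c" by (simp add: g_def local_map_def)
  have dom: "snd c ` (fst c \<inter> fst c') = local_dom c c' id"
    using is_chart_inverse[OF chart[OF c(1)]] by (force simp: local_dom_def)
  have sg: "smooth_on (local_dom c c' id) g"
    using manifold c(1) c'(1) unfolding smooth_manifold_def dom[symmetric] g by blast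
  have ip: "chart_inv c x = p" using is_chart_inverse(3)[OF chart[OF c(1)] c(2)] by (simp add: x_def)
  have xd: "x \<in> local_dom c c' id" using c c' unfolding dom[symmetric] x_def by blast
  have gx: "g x = snd c' p" by (simp add: g ip)
  have d: "SU3_diff W B" and d': "SU3_diff W' B'" using B B' by (auto simp: adapted_def)
  define V where "V = local_dom c c' id \<inter> g -` W'"
  have oV: "open V" unfolding V_def by (rule continuous_open_preimage[OF lm(2,1) SU3_diff_D(1)[OF d']])
  have xV: "x \<in> V" using xd c' gx by (simp add: V_def)
  have dg: "g differentiable (at y)" if "y \<in> V" for y
    using smooth_on_differentiable[OF sg] that by (simp add: V_def)
  have dB': "B' differentiable (at (g y))" if "y \<in> V" for y
    using SU3_diff_D(3)[OF d'] that by (simp add: V_def)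
  have 1: "SU3_diff V (\<lambda>y. B' (g y))"
    unfolding SU3_diff_def using oV differentiable_chain_at[OF dg dB'] SU3_diff_D(2)[OF d'] by (auto simp: o_def V_def)
  have eq: "act (B y) f_st = act (B' (g y)) f_st" if y: "y \<in> W \<inter> V" for y
  proof -
    have "chart_inv c' (g y) = chart_inv c y" using lm(4)[of y] y by (simp add: V_def)
    then show ?thesis using B B' y by (simp add: adapted_def V_def)
  qed
  have xW: "x \<in> W" using c by (simp add: x_def)
  let ?T = "conj_transpose (B x) ** B' (g x)"
  have T: "?T \<in> torus" by (rule lift_change(1)[OF d xW 1 xV]) (rule eq)
  have l: "xi (\<lambda>y. B' (g y)) x u = twist ?T * xi B x u" for u
    by (rule lift_change(2)[OF d xW 1 xV]) (rule eq)
  have sub: "twist ?T * X \<in> model n" if "X \<in> model m" for X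
  proof -
    have "X \<in> range (xi B x)" using that B xW by (simp add: adapted_def)
    then obtain u where "X = xi B x u" by blast
    then have "twist ?T * X = xi B' (g x) (D g x u)" using l[of u] xi_compose[OF dg[OF xV] dB'[OF xV]] by simp
    moreover have "range (xi B' (g x)) = model n" using B' c'(3) gx by (simp add: adapted_def)
    ultimately show ?thesis by blast
  qed
  show "m = n" "conj_transpose (B (snd c p)) ** B' (snd c' p) \<in> model_group m"
    using model_unique[OF T sub] gx by (simp_all add: x_def)
qed

lemma part_disjoint:
  assumes CC: "C \<in> SU3" "C' \<in> SU3" and p: "p \<in> part m C" "p \<in> part n C'"
  shows "part m C = part n C'"
proof -
  obtain c W B where c: "c \<in> \<A>" "p \<in> fst c" "snd c p \<in> W" and B: "adapted c W B m"
    "conj_transpose C ** B (snd c p) \<in> model_group m" using p(1) by (auto simp: part_def)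
  obtain c' W' B' where c': "c' \<in> \<A>" "p \<in> fst c'" "snd c' p \<in> W'" and B': "adapted c' W' B' n"
    "conj_transpose C' ** B' (snd c' p) \<in> model_group n" using p(2) by (auto simp: part_def)
  let ?b = "B (snd c p)" and ?b' = "B' (snd c' p)"
  have S: "?b \<in> SU3" "?b' \<in> SU3"
    using B(1) B'(1) SU3_diff_D(2) c(3) c'(3) by (auto simp: adapted_def)
  note u = adapted_unique[OF c B(1) c' B'(1)]
  have "conj_transpose C' ** ?b' \<in> model_group m" using u(1) B'(2) by simp
  from model_group_mult[OF this model_group_mult[OF model_group_ct[OF u(2)] model_group_ct[OF B(2)]]]
  have 1: "conj_transpose C' ** C \<in> model_group m"
    by (simp add: ct_mult SU3_cancel[OF S(1)] SU3_cancel[OF S(2)] flip: matrix_mul_assoc)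
  then have 2: "conj_transpose C ** C' \<in> model_group m" using model_group_ct[OF 1] by (simp add: ct_mult)
  show ?thesis using part_mono[OF CC(1) 1] part_mono[OF CC(2) 2] u(1) by blast
qed

text \<open>The parts cover, are open, and are pairwise equal or disjoint.\<close>

theorem single_model:
  assumes "topspace L \<noteq> {}"
  obtains m C where "C \<in> SU3" "part m C = topspace L"
proof -
  obtain p where p: "p \<in> topspace L" using assms by blast
  obtain m C where C: "C \<in> SU3" "p \<in> part m C" using part_cover[OF p] by blast
  define R where "R = \<Union>{part n C' | n C'. C' \<in> SU3 \<and> part n C' \<inter> part m C = {}}"
  have "openin L R" unfolding R_def by (intro openin_Union) (auto simp: part_open)
  moreover have "topspace L \<subseteq> part m C \<union> R"
  proof
    fix q assume "q \<in> topspace L"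
    then obtain n C' where C': "C' \<in> SU3" "q \<in> part n C'" using part_cover by blast
    show "q \<in> part m C \<union> R"
    proof (cases "part n C' \<inter> part m C = {}")
      case True
      then show ?thesis using C' by (auto simp: R_def)
    next
      case False
      then obtain r where "r \<in> part n C'" "r \<in> part m C" by blast
      then show ?thesis using part_disjoint[OF C(1) C'(1)] C' by blast
    qed
  qed
  moreover have "part m C \<inter> R = {}" by (auto simp: R_def)
  ultimately have "R = {}" using conn part_open[of m C] C(2) unfolding connected_space_def by blast
  then have "part m C = topspace L" using \<open>topspace L \<subseteq> part m C \<union> R\<close> part_sub by blast
  then show ?thesis using that C by blast
qed

end

section \<open>The two homogeneous models\<close>

subsection \<open>The orbit of SO(3)\<close>

lemma torus_diag:
  assumes "norm a = 1" "norm b = 1" "norm c = 1" "a * b * c = 1"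
  shows "diag3 a b c \<in> torus"
proof -
  have "cnj z * z = 1" if "norm z = 1" for z
    using that complex_norm_square[of z] by (simp add: mult.commute)
  then have "conj_transpose (diag3 a b c) ** diag3 a b c = mat 1"
    unfolding mat3_eq_iff forall_3 mm_nth mat1_nth using assms by (simp add: diag3_nth)
  moreover have "det (diag3 a b c) = 1" using assms(4) by (simp add: det_3 diag3_nth)
  ultimately show ?thesis by (simp add: torus_def SU3_def diag3_nth)
qed

text \<open>If \<open>A = z * cnj A\<close> entrywise and \<open>c * c = cnj z\<close>, then \<open>c A\<close> is real. Its determinant \<open>c\<^sup>3\<close> is \<open>1\<close> or \<open>- 1\<close>; in
  either case \<open>e = c\<^sup>4\<close> is \<open>c\<close> up to sign and has cube \<open>1\<close>, so that the scalar matrix \<open>e\<close> lies in the torus.\<close>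

lemma orbit_SO3: "orbit SO3 = orbit (model_group None)"
proof
  have "SO3 \<subseteq> model_group None"
    by (auto simp: SO3_def model_group_def Reals_cnj_iff intro!: exI[of _ 1])
  then show "orbit SO3 \<subseteq> orbit (model_group None)" unfolding orbit_def by blast
  show "orbit (model_group None) \<subseteq> orbit SO3"
  proof
    fix f assume "f \<in> orbit (model_group None)"
    then obtain A where A: "A \<in> model_group None" "f = act A f_st" unfolding orbit_def by blast
    then obtain z where z: "A $ i $ j = z * cnj (A $ i $ j)" for i j unfolding model_group_def by auto
    have S: "A \<in> SU3" by (rule model_group_SU3[OF A(1)])
    obtain i j where ij: "A $ i $ j \<noteq> 0"
    proof -
      have "A $ 1 $ 1 \<noteq> 0 \<or> A $ 2 $ 1 \<noteq> 0 \<or> A $ 3 $ 1 \<noteq> 0"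
        using arg_cong[OF SU3_left[OF S], of "\<lambda>X. X $ 1 $ 1"] by (auto simp: mm_nth mat1_nth)
      then show ?thesis using that by blast
    qed
    have "norm (A $ i $ j) = norm z * norm (A $ i $ j)" using z[of i j] by (metis complex_mod_cnj norm_mult)
    then have nz: "norm z = 1" using ij by simp
    define c where "c = csqrt (cnj z)"
    have c2: "c * c = cnj z" unfolding c_def by (metis power2_csqrt power2_eq_square)
    have "norm c * norm c = 1" using nz by (simp add: c2 flip: norm_mult)
    then have nc: "norm c = 1" by (metis abs_norm_cancel abs_square_eq_1 power2_eq_square)
    then have cc: "cnj c * c = 1" using complex_norm_square[of c] by (simp add: mult.commute)
    have cA: "Im (c * A $ i $ j) = 0" for i j
    proof -
      have "cnj z * z = 1" using nz complex_norm_square[of z] by (simp add: mult.commute)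
      then have "cnj (A $ i $ j) = cnj z * A $ i $ j" using z[of i j] by (metis mult.assoc mult_1)
      then have "cnj (c * A $ i $ j) = (cnj c * c) * (c * A $ i $ j)" by (simp add: c2[symmetric] mult_ac)
      then have "cnj (c * A $ i $ j) = c * A $ i $ j" by (simp add: cc)
      then show ?thesis by (simp add: complex_eq_iff del: complex_cnj_mult)
    qed
    have "Im (c * c * c * det A) = 0"
    proof -
      have "c * c * c * det A = (c * A$1$1) * (c * A$2$2) * (c * A$3$3) + (c * A$1$2) * (c * A$2$3) * (c * A$3$1)
        + (c * A$1$3) * (c * A$2$1) * (c * A$3$2) - (c * A$1$1) * (c * A$2$3) * (c * A$3$2)
        - (c * A$1$2) * (c * A$2$1) * (c * A$3$3) - (c * A$1$3) * (c * A$2$2) * (c * A$3$1)"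
        unfolding det_3 by (simp add: algebra_simps)
      moreover have "Im (x * y * w) = 0" if "Im x = 0" "Im y = 0" "Im w = 0" for x y w using that by simp
      ultimately show ?thesis using cA by (simp only: minus_complex.simps plus_complex.simps)
    qed
    then have "c * c * c = 1 \<or> c * c * c = -1"
      using S by (intro unit_real) (simp_all add: SU3_def norm_mult nc)
    define e where "e = (c * c * c) * c"
    have e: "e = c \<or> e = - c" unfolding e_def using \<open>c * c * c = 1 \<or> c * c * c = -1\<close> by auto
    have e3: "e * e * e = 1"
    proof -
      have "e * e * e = (c * c * c) * (c * c * c) * (c * c * c) * (c * c * c)" by (simp add: e_def mult_ac)
      then show ?thesis using \<open>c * c * c = 1 \<or> c * c * c = -1\<close> by auto
    qed
    have T: "diag3 e e e \<in> torus"
      by (rule torus_diag) (use e nc e3 in auto)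
    have AT: "(A ** diag3 e e e) $ i $ j = e * A $ i $ j" for i j
      using exhaust_3[of j] by (auto simp: mm_nth diag3_nth)
    have eA: "Im (e * A $ i $ j) = 0" for i j
    proof -
      have "e * A $ i $ j = c * A $ i $ j \<or> e * A $ i $ j = - (c * A $ i $ j)" using e by auto
      then show ?thesis using cA[of i j] by (metis uminus_complex.simps(2) neg_equal_zero minus_zero)
    qed
    have "(A ** diag3 e e e) $ i $ j \<in> \<real>" for i j
      unfolding AT complex_is_Real_iff by (rule eA)
    then have "A ** diag3 e e e \<in> SO3"
      using SU3_mult[OF S torus_SU3[OF T]] by (simp add: SO3_def)
    moreover have "f = act (A ** diag3 e e e) f_st" by (simp add: A act_mult act_torus[OF T])
    ultimately show "f \<in> orbit SO3" unfolding orbit_def by blast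
  qed
qed

subsection \<open>The orbit of SU(2)\<close>

definition su2_mat :: "real \<Rightarrow> complex \<Rightarrow> mat3" where
  "su2_mat s z = vector [vector [- \<i> * of_real s, - cnj z, \<i> * of_real s],
     vector [z, 2 * \<i> * of_real s, - z], vector [\<i> * of_real s, cnj z, - \<i> * of_real s]]"

text \<open>The orthogonal projection to the complement of \<open>axis_vec 3\<close>, and the general element of the
  stabilizer of this vector.\<close>

definition su2_proj :: mat3 where
  "su2_proj = vector [vector [1/2, 0, -1/2], vector [0, 1, 0], vector [-1/2, 0, 1/2]]"

definition su2_group :: "complex \<Rightarrow> complex \<Rightarrow> mat3" where
  "su2_group k d = vector [vector [(1 + k) / 2, - cnj d, (1 - k) / 2],
     vector [d, cnj k, - d], vector [(1 - k) / 2, cnj d, (1 + k) / 2]]"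

lemma axis_vec_3: "axis_vec 3 $ 1 = 1" "axis_vec 3 $ 2 = 0" "axis_vec 3 $ 3 = 1"
  by (simp_all add: axis_vec_def numeral_mod_3)

lemma span_su2: "span {m1 + m2, - m4 + m5, m6 - sqrt 3 *\<^sub>R h2} = {su2_mat s z | s z. True}"
proof -
  have e: "a *\<^sub>R (m1 + m2) + b *\<^sub>R (- m4 + m5) + s *\<^sub>R (m6 - sqrt 3 *\<^sub>R h2) = su2_mat s (Complex a (- b))" for a b s
    unfolding mat3_eq_iff forall_3
    by (simp add: su2_mat_def basis_defs scaleR_conv_of_real[where 'a=complex] complex_eq_iff)
  have "x \<in> span {m1 + m2, - m4 + m5, m6 - sqrt 3 *\<^sub>R h2}
    \<longleftrightarrow> (\<exists>a b s. x = a *\<^sub>R (m1 + m2) + b *\<^sub>R (- m4 + m5) + s *\<^sub>R (m6 - sqrt 3 *\<^sub>R h2))" for x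
    by (simp add: span_insert diff_eq_eq add.commute add.left_commute algebra_simps)
  moreover have "\<exists>a b t. su2_mat s z = su2_mat t (Complex a (- b))" for s z
    by (intro exI[of _ "Re z"] exI[of _ "- Im z"] exI[of _ s]) simp
  ultimately show ?thesis unfolding e by blast
qed

lemma su2_group_SU3:
  assumes "(norm k)\<^sup>2 + 2 * (norm d)\<^sup>2 = 1"
  shows "su2_group k d \<in> SU3"
proof -
  have "of_real ((norm k)\<^sup>2 + 2 * (norm d)\<^sup>2) = (1::complex)" using assms by simp
  then have 1: "k * cnj k + 2 * (d * cnj d) = 1"
    using complex_norm_square[of k] complex_norm_square[of d] by simp
  then have k: "k * cnj k = 1 - 2 * (d * cnj d)" by (simp add: algebra_simps)
  have "conj_transpose (su2_group k d) ** su2_group k d = mat 1"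
    unfolding mat3_eq_iff forall_3 mm_nth mat1_nth using k
    by (simp add: su2_group_def field_simps) algebra
  moreover have "det (su2_group k d) = k * cnj k + 2 * (d * cnj d)"
    by (simp add: det_3 su2_group_def field_simps)
  ultimately show ?thesis using 1 by (simp add: SU3_def)
qed

lemma su2_group_fixes: "su2_group k d *v axis_vec 3 = axis_vec 3"
  by (simp add: c3_eq_iff mv_nth axis_vec_3 su2_group_def field_simps)

text \<open>The exponential series; on the complement of the fixed vector the square of \<open>su2_mat s z\<close> is a
  negative multiple of the identity.\<close>

lemma mexp_su2:
  assumes r: "r\<^sup>2 = 4 * s\<^sup>2 + 2 * (norm z)\<^sup>2" "r \<noteq> 0"
  shows "mexp (su2_mat s z) = su2_group (Complex (cos r) (- 2 * (sin r / r) * s)) (of_real (sin r / r) * z)"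
proof -
  let ?X = "su2_mat s z" and ?P = su2_proj
  have rz: "(complex_of_real r)\<^sup>2 = 4 * (of_real s)\<^sup>2 + 2 * (z * cnj z)"
    using arg_cong[OF r(1), of complex_of_real] complex_norm_square[of z] by simp
  have XX: "?X ** ?X = - (r\<^sup>2) *\<^sub>R ?P"
    unfolding mat3_eq_iff forall_3 mm_nth using rz
    by (simp add: su2_mat_def su2_proj_def scaleR_conv_of_real[where 'a=complex] power2_eq_square algebra_simps)
  have XP: "?X ** ?P = ?X"
    unfolding mat3_eq_iff forall_3 mm_nth by (simp add: su2_mat_def su2_proj_def)
  define T where "T n = (1 / fact n) *\<^sub>R ((\<lambda>Y. ?X ** Y) ^^ n) (mat 1)" for n
  have scale: "?X ** (a *\<^sub>R Y) = a *\<^sub>R (?X ** Y)" for a and Y :: mat3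
    using bounded_bilinear.scaleR_right[OF bounded_bilinear_mm] .
  have T: "T n = (if n = 0 then mat 1 - ?P else 0) + (cos_coeff n * r ^ n) *\<^sub>R ?P + (sin_coeff n * r ^ n / r) *\<^sub>R ?X" for n
  proof (induction n)
    case 0
    show ?case by (simp add: T_def)
  next
    case (Suc n)
    have "T (Suc n) = (1 / real (Suc n)) *\<^sub>R (?X ** T n)"
      by (simp add: T_def scale field_simps)
    also have "?X ** T n = (cos_coeff n * r ^ n) *\<^sub>R ?X + (sin_coeff n * r ^ n / r) *\<^sub>R (- (r\<^sup>2) *\<^sub>R ?P)"
      unfolding Suc.IH by (auto simp: mm_add mm_diff scale XX XP)
    also have "(1 / real (Suc n)) *\<^sub>R \<dots> = (cos_coeff (Suc n) * r ^ Suc n) *\<^sub>R ?P + (sin_coeff (Suc n) * r ^ Suc n / r) *\<^sub>R ?X"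
      using r(2) by (simp add: cos_coeff_Suc sin_coeff_Suc scaleR_add_right power2_eq_square field_simps del: of_nat_Suc)
    finally show ?case by simp
  qed
  have "(\<lambda>n. (cos_coeff n * r ^ n) *\<^sub>R ?P) sums (cos r *\<^sub>R ?P)"
    using bounded_linear.sums[OF bounded_linear_scaleR_left cos_converges[of r]] by simp
  moreover have "(\<lambda>n. (sin_coeff n * r ^ n / r) *\<^sub>R ?X) sums ((sin r / r) *\<^sub>R ?X)"
    using bounded_linear.sums[OF bounded_linear_scaleR_left sums_divide[OF sin_converges[of r]]] by simp
  moreover have "(\<lambda>n. if n = 0 then mat 1 - ?P else 0) sums (mat 1 - ?P)"
    using sums_single[of 0 "\<lambda>_. mat 1 - ?P"] by simp
  ultimately have "T sums ((mat 1 - ?P) + cos r *\<^sub>R ?P + (sin r / r) *\<^sub>R ?X)"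
    unfolding T[abs_def] by (intro sums_add)
  then have "mexp ?X = (mat 1 - ?P) + cos r *\<^sub>R ?P + (sin r / r) *\<^sub>R ?X"
    unfolding mexp_def T_def by (rule sums_unique[symmetric])
  also have "\<dots> = su2_group (Complex (cos r) (- 2 * (sin r / r) * s)) (of_real (sin r / r) * z)"
    unfolding mat3_eq_iff forall_3
    by (simp add: su2_group_def su2_proj_def su2_mat_def mat1_nth complex_eq_iff field_simps)
  finally show ?thesis .
qed

lemma mexp_0: "mexp 0 = mat 1"
proof -
  have "(1 / fact n) *\<^sub>R (((**) 0) ^^ n) (mat 1 :: mat3) = (if n = 0 then mat 1 else 0)" for n
    by (cases n) (simp_all add: mm_zero(1)[abs_def])
  then have "(\<lambda>n. (1 / fact n) *\<^sub>R (((**) 0) ^^ n) (mat 1 :: mat3)) = (\<lambda>n. if n = 0 then mat 1 else 0)" by (rule ext)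
  then show ?thesis
    unfolding mexp_def using sums_unique[OF sums_single[of 0 "\<lambda>_. mat 1 :: mat3"]] by simp
qed

lemma su2_group_1: "su2_group 1 0 = mat 1"
  unfolding mat3_eq_iff forall_3 by (simp add: su2_group_def mat1_nth)

lemma mexp_su2_in_group:
  "\<exists>k d. mexp (su2_mat s z) = su2_group k d \<and> (norm k)\<^sup>2 + 2 * (norm d)\<^sup>2 = 1"
proof -
  define r where "r = sqrt (4 * s\<^sup>2 + 2 * (norm z)\<^sup>2)"
  have r: "r\<^sup>2 = 4 * s\<^sup>2 + 2 * (norm z)\<^sup>2" by (simp add: r_def)
  show ?thesis
  proof (cases "r = 0")
    case True
    then have "4 * s\<^sup>2 + 2 * (norm z)\<^sup>2 = 0" using r by simp
    then have "s = 0" "z = 0" by (simp_all add: add_nonneg_eq_0_iff)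
    moreover have "su2_mat 0 0 = 0" unfolding mat3_eq_iff forall_3 by (simp add: su2_mat_def)
    ultimately have "mexp (su2_mat s z) = su2_group 1 0" by (simp add: mexp_0 su2_group_1)
    then show ?thesis by (intro exI[of _ 1] exI[of _ 0]) simp
  next
    case False
    define q where "q = sin r / r"
    have "(norm (Complex (cos r) (- 2 * q * s)))\<^sup>2 + 2 * (norm (of_real q * z))\<^sup>2
      = (cos r)\<^sup>2 + q\<^sup>2 * (4 * s\<^sup>2 + 2 * (norm z)\<^sup>2)"
      by (simp add: cmod_power2 norm_mult power_mult_distrib algebra_simps)
    also have "\<dots> = (cos r)\<^sup>2 + (sin r)\<^sup>2" using False unfolding r[symmetric] by (simp add: power_divide q_def)
    finally show ?thesis using mexp_su2[OF r False, folded q_def] by (metis sin_cos_squared_add2)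
  qed
qed

text \<open>The rotation angle is \<open>arccos (Re k)\<close>. Where its sine vanishes, \<open>su2_group k d\<close> is the identity or \<open>- 1\<close>
  on the complement of the fixed vector, and the exponents \<open>0\<close> and \<open>su2_mat (pi / 2) 0\<close> do.\<close>

lemma su2_group_is_mexp:
  assumes kd: "(norm k)\<^sup>2 + 2 * (norm d)\<^sup>2 = 1"
  shows "\<exists>s z. su2_group k d = mexp (su2_mat s z)"
proof -
  have k2: "(Re k)\<^sup>2 + (Im k)\<^sup>2 + 2 * (norm d)\<^sup>2 = 1" using kd by (simp add: cmod_power2)
  then have "(Re k)\<^sup>2 \<le> 1" by (smt (verit) zero_le_power2)
  then have k1: "-1 \<le> Re k" "Re k \<le> 1" using abs_square_le_1[of "Re k"] by auto
  define r where "r = arccos (Re k)"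
  have cr: "cos r = Re k" using k1 by (simp add: r_def)
  have sr: "(sin r)\<^sup>2 = (Im k)\<^sup>2 + 2 * (norm d)\<^sup>2"
    using sin_cos_squared_add[of r] k2 by (simp add: cr)
  show ?thesis
  proof (cases "sin r = 0")
    case True
    then have "Im k = 0" "d = 0" using sr by (simp_all add: add_nonneg_eq_0_iff)
    then have "(Re k)\<^sup>2 = 1" using k2 by simp
    then consider "k = 1" | "k = -1" using \<open>Im k = 0\<close> by (auto simp: power2_eq_1_iff complex_eq_iff)
    then show ?thesis
    proof cases
      case 1
      have "su2_mat 0 0 = 0" unfolding mat3_eq_iff forall_3 by (simp add: su2_mat_def)
      then have "su2_group k d = mexp (su2_mat 0 0)" by (simp add: 1 \<open>d = 0\<close> su2_group_1 mexp_0)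
      then show ?thesis by blast
    next
      case 2
      have "pi\<^sup>2 = 4 * (pi / 2)\<^sup>2 + 2 * (norm (0::complex))\<^sup>2" by (simp add: power2_eq_square)
      from mexp_su2[OF this] have "mexp (su2_mat (pi / 2) 0) = su2_group (Complex (-1) 0) 0" by simp
      also have "Complex (-1) 0 = k" by (simp add: 2 complex_eq_iff)
      finally show ?thesis using \<open>d = 0\<close> by metis
    qed
  next
    case False
    then have r0: "r \<noteq> 0" by auto
    define q where "q = sin r / r"
    have q: "q \<noteq> 0" using False r0 by (simp add: q_def)
    define s where "s = - Im k / (2 * q)"
    define z where "z = d / of_real q"
    have "4 * s\<^sup>2 + 2 * (norm z)\<^sup>2 = ((Im k)\<^sup>2 + 2 * (norm d)\<^sup>2) / q\<^sup>2"
      using q by (simp add: s_def z_def norm_divide power_divide power_mult_distrib field_simps)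
    also have "\<dots> = r\<^sup>2" unfolding sr[symmetric] using False r0 by (simp add: q_def power_divide)
    finally have r2: "r\<^sup>2 = 4 * s\<^sup>2 + 2 * (norm z)\<^sup>2" by simp
    have "Complex (cos r) (- 2 * (sin r / r) * s) = k" "of_real (sin r / r) * z = d"
      unfolding q_def[symmetric] using q by (simp_all add: complex_eq_iff cr s_def z_def)
    then show ?thesis using mexp_su2[OF r2 r0] by metis
  qed
qed

text \<open>The adjoint matrix preserves the same line, which gives relations between the columns in addition to
  those between the rows.\<close>

lemma model_group_3_entries:
  assumes A: "A \<in> SU3" and c: "A *v axis_vec 3 = c *s axis_vec 3"
  shows "A$1$1 + A$1$3 = c" "A$2$3 = - (A$2$1)" "A$3$1 = A$1$3" "A$3$3 = A$1$1" "A$3$2 = - (A$1$2)"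
proof -
  have G: "conj_transpose A \<in> model_group (Some 3)"
    by (rule model_group_ct) (use A c in \<open>auto simp: model_group_def\<close>)
  then obtain c' where c': "conj_transpose A *v axis_vec 3 = c' *s axis_vec 3" by (auto simp: model_group_def)
  have 1: "A$1$1 + A$1$3 = c" "A$2$1 + A$2$3 = 0" "A$3$1 + A$3$3 = c"
    using c by (simp_all add: c3_eq_iff mv_nth axis_vec_3)
  have 2: "cnj (A$1$1 + A$3$1) = c'" "cnj (A$1$2 + A$3$2) = 0" "cnj (A$1$3 + A$3$3) = c'"
    using c' by (simp_all add: c3_eq_iff mv_nth axis_vec_3)
  then have 3: "A$1$1 + A$3$1 = A$1$3 + A$3$3" "A$1$2 + A$3$2 = 0" by (metis complex_cnj_cnj, simp flip: complex_cnj_add)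
  show "A$1$1 + A$1$3 = c" by (rule 1)
  show "A$2$3 = - (A$2$1)" "A$3$2 = - (A$1$2)" using 1 3 by (simp_all add: eq_neg_iff_add_eq_0 add.commute)
  have "(A$1$1 + A$1$3) + (A$1$1 + A$3$1) = (A$3$1 + A$3$3) + (A$1$3 + A$3$3)" by (simp only: 1 3)
  then have "2 * A$1$1 = 2 * A$3$3" by (simp add: algebra_simps)
  then show "A$3$3 = A$1$1" by simp
  then show "A$3$1 = A$1$3" using 3 by simp
qed

text \<open>By \<open>model_group_3_entries\<close> and the cofactors, a matrix fixing the vector has the form \<open>su2_group k d\<close>,
  and every such matrix is a single exponential.\<close>

lemma SU2_eq: "SU2 = {A \<in> SU3. A *v axis_vec 3 = axis_vec 3}"
proof
  have "A \<in> SU3 \<and> A *v axis_vec 3 = axis_vec 3"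
    if "A \<in> connected_subgroup (span {m1 + m2, - m4 + m5, m6 - sqrt 3 *\<^sub>R h2})" for A
    using that
  proof induction
    case one
    then show ?case by (simp add: SU3_1)
  next
    case (mult A X)
    then obtain s z where X: "X = su2_mat s z" unfolding span_su2 by blast
    obtain k d where "mexp X = su2_group k d" "(norm k)\<^sup>2 + 2 * (norm d)\<^sup>2 = 1"
      unfolding X using mexp_su2_in_group by blast
    then show ?case using mult.IH
      by (simp add: SU3_mult su2_group_SU3 su2_group_fixes flip: matrix_vector_mul_assoc)
  qed
  then show "SU2 \<subseteq> {A \<in> SU3. A *v axis_vec 3 = axis_vec 3}" unfolding SU2_def by blast
  show "{A \<in> SU3. A *v axis_vec 3 = axis_vec 3} \<subseteq> SU2"
  proof safe
    fix A assume A: "A \<in> SU3" and e: "A *v axis_vec 3 = axis_vec 3"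
    note m = model_group_3_entries[OF A, of 1, simplified, OF e]
    note cof = SU3_cofactor[OF A]
    define k where "k = 2 * A$1$1 - 1"
    define d where "d = A$2$1"
    have a13: "A$1$3 = 1 - A$1$1" using m(1) by (simp add: eq_diff_eq add.commute)
    have a12: "A$1$2 = - cnj d"
    proof -
      have "A$1$2 = cnj (A$2$3 * A$3$1 - A$3$3 * A$2$1)" using cof(3)[of 1] by simp
      also have "A$2$3 * A$3$1 - A$3$3 * A$2$1 = - d * (A$1$1 + A$1$3)" by (simp add: m(2-5) d_def algebra_simps)
      finally show ?thesis by (simp add: m)
    qed
    have a22: "A$2$2 = cnj k"
    proof -
      have "A$2$2 = cnj (A$3$3 * A$1$1 - A$1$3 * A$3$1)" using cof(3)[of 2] by simp
      also have "A$3$3 * A$1$1 - A$1$3 * A$3$1 = k" by (simp add: m k_def a13 algebra_simps)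
      finally show ?thesis .
    qed
    have Ak: "A = su2_group k d"
      unfolding mat3_eq_iff forall_3 by (simp add: su2_group_def m a13 a12 a22 k_def d_def[symmetric])
    have "(conj_transpose A ** A) $ 2 $ 2 = 1" by (simp add: SU3_left[OF A] mat1_nth)
    then have "d * cnj d + k * cnj k + d * cnj d = 1" by (simp add: mm_nth m a12 a22)
    then have "complex_of_real ((norm k)\<^sup>2 + 2 * (norm d)\<^sup>2) = of_real 1"
      using complex_norm_square[of k] complex_norm_square[of d] by (simp add: algebra_simps)
    then have "(norm k)\<^sup>2 + 2 * (norm d)\<^sup>2 = 1" by (simp only: of_real_eq_iff)
    then obtain s z where "A = mexp (su2_mat s z)" using su2_group_is_mexp Ak by metis
    moreover have "su2_mat s z \<in> span {m1 + m2, - m4 + m5, m6 - sqrt 3 *\<^sub>R h2}" unfolding span_su2 by blast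
    ultimately show "A \<in> SU2"
      unfolding SU2_def using connected_subgroup.mult[OF connected_subgroup.one] by force
  qed
qed

text \<open>The scalar by which \<open>A\<close> acts on the line can be cancelled by the torus element
  \<open>diag(cnj c, c\<^sup>2, cnj c)\<close>.\<close>

lemma orbit_SU2: "orbit SU2 = orbit (model_group (Some 3))"
proof
  have "SU2 \<subseteq> model_group (Some 3)"
    unfolding SU2_eq by (auto simp: model_group_def intro!: exI[of _ 1])
  then show "orbit SU2 \<subseteq> orbit (model_group (Some 3))" unfolding orbit_def by blast
  show "orbit (model_group (Some 3)) \<subseteq> orbit SU2"
  proof
    fix f assume "f \<in> orbit (model_group (Some 3))"
    then obtain A c where A: "A \<in> SU3" "f = act A f_st" and c: "A *v axis_vec 3 = c *s axis_vec 3"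
      unfolding orbit_def model_group_def by auto
    have "hermitian (A *v axis_vec 3) (A *v axis_vec 3) = hermitian (axis_vec 3) (axis_vec 3)"
    proof -
      have o: "cnj (A$1$i) * A$1$j + cnj (A$2$i) * A$2$j + cnj (A$3$i) * A$3$j = (if i = j then 1 else 0)" for i j
        using arg_cong[OF SU3_left[OF A(1)], of "\<lambda>X. X $ i $ j"] by (simp add: mm_nth mat1_nth)
      have "hermitian (A *v axis_vec 3) (A *v axis_vec 3) =
        (cnj (A$1$1) * A$1$1 + cnj (A$2$1) * A$2$1 + cnj (A$3$1) * A$3$1)
        + (cnj (A$1$1) * A$1$3 + cnj (A$2$1) * A$2$3 + cnj (A$3$1) * A$3$3)
        + (cnj (A$1$3) * A$1$1 + cnj (A$2$3) * A$2$1 + cnj (A$3$3) * A$3$1)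
        + (cnj (A$1$3) * A$1$3 + cnj (A$2$3) * A$2$3 + cnj (A$3$3) * A$3$3)"
        by (simp add: hermitian_def mv_nth axis_vec_3 algebra_simps)
      then show ?thesis unfolding o by (simp add: hermitian_def axis_vec_3)
    qed
    then have "c * cnj c = 1" by (simp add: c hermitian_def axis_vec_3)
    then have "cnj c * c = 1" by (simp only: mult.commute)
    then have nc: "norm c = 1"
      by (metis complex_norm_square mult.commute norm_ge_zero of_real_1 of_real_eq_iff power2_eq_1_iff
          abs_of_nonneg abs_1 real_sqrt_abs real_sqrt_one)
    define T where "T = diag3 (cnj c) (c * c) (cnj c)"
    have "cnj c * (c * c) * cnj c = (cnj c * c) * (cnj c * c)" by (simp add: mult_ac)
    then have T: "T \<in> torus" unfolding T_def using nc \<open>cnj c * c = 1\<close>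
      by (intro torus_diag) (simp_all add: norm_mult)
    have "T *v axis_vec 3 = cnj c *s axis_vec 3"
      by (simp add: T_def c3_eq_iff mv_nth diag3_nth axis_vec_3)
    then have "(A ** T) *v axis_vec 3 = axis_vec 3"
      using \<open>cnj c * c = 1\<close> by (simp add: c vector_scalar_commute flip: matrix_vector_mul_assoc)
    then have "A ** T \<in> SU2" unfolding SU2_eq using SU3_mult[OF A(1) torus_SU3[OF T]] by simp
    moreover have "f = act (A ** T) f_st" by (simp add: A act_mult act_torus[OF T])
    ultimately show "f \<in> orbit SU2" unfolding orbit_def by blast
  qed
qed

subsection \<open>The orbits as graphs in the big cell\<close>

text \<open>In the coordinates of the big cell the orbit of \<open>SO(3)\<close> is \<open>\<real>\<^sup>3\<close>, and that of \<open>SU(2)\<close> consists of the points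
  \<open>(a, b, cnj a)\<close> with \<open>2 * Re b = \<bar>a\<bar>\<^sup>2\<close>. Both are graphs over \<open>\<real>\<^sup>3\<close>, of \<open>graph_map\<close>, with projection
  \<open>graph_coords\<close>.\<close>

definition graph_coords :: "3 option \<Rightarrow> complex^3 \<Rightarrow> real^3" where
  "graph_coords m z = (if m = None then (\<chi> i. Re (z $ i)) else vector [Re (z$1), Im (z$1), Im (z$2)])"

definition graph_map :: "3 option \<Rightarrow> real^3 \<Rightarrow> complex^3" where
  "graph_map m r = (if m = None then (\<chi> i. of_real (r $ i))
     else vector [of_real (r$1) + \<i> * of_real (r$2),
       of_real ((r$1 * r$1 + r$2 * r$2) / 2) + \<i> * of_real (r$3), of_real (r$1) - \<i> * of_real (r$2)])"

lemma linear_graph_coords: "bounded_linear (graph_coords m)"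
proof -
  have "linear (graph_coords m)"
    by (auto intro!: linearI simp: graph_coords_def vec_eq_iff forall_3)
  then show ?thesis by (simp add: linear_conv_bounded_linear)
qed

lemma graph_map_differentiable: "graph_map m differentiable (at r)"
proof -
  have e: "(\<lambda>r::real^3. of_real (r $ i) :: complex) differentiable (at r)" for i
    using bounded_linear_imp_differentiable[OF bounded_linear_compose[OF bounded_linear_of_real bounded_linear_vec_nth]] .
  have d: "(\<lambda>r. graph_map m r $ i) differentiable (at r)" for i
  proof (cases "m = None")
    case True
    then show ?thesis using e[of i] by (simp add: graph_map_def)
  next
    case False
    have "(\<lambda>r::real^3. of_real ((r$1 * r$1 + r$2 * r$2) / 2) + \<i> * of_real (r$3) :: complex) differentiable (at r)"
      "(\<lambda>r::real^3. of_real (r$1) + \<i> * of_real (r$2) :: complex) differentiable (at r)"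
      "(\<lambda>r::real^3. of_real (r$1) - \<i> * of_real (r$2) :: complex) differentiable (at r)"
      unfolding of_real_divide of_real_add of_real_mult divide_inverse
      by (intro differentiable_add differentiable_diff differentiable_mult e differentiable_const)+
    then show ?thesis using exhaust_3[of i] False by (auto simp: graph_map_def simp del: of_real_add of_real_divide of_real_mult)
  qed
  have "(graph_map m has_derivative (\<lambda>u. \<chi> i. D (\<lambda>r. graph_map m r $ i) r u)) (at r)"
    by (rule has_derivative_vecI) (simp add: D_has_derivative[OF d])
  then show ?thesis by (auto simp: differentiable_def)
qed

lemma model_group_graph:
  assumes m: "m \<in> {None, Some 3}" and A: "A \<in> model_group m" "A \<in> big_cell"
  shows "cell_coords A = graph_map m (graph_coords m (cell_coords A))"
proof -
  have nz: "A$1$1 \<noteq> 0" "A$3$3 \<noteq> 0" using A(2) by (auto simp: big_cell_def)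
  show ?thesis
  proof (cases "m = None")
    case True
    then obtain z where z: "A $ i $ j = z * cnj (A $ i $ j)" for i j using A(1) unfolding model_group_def by auto
    have z0: "z \<noteq> 0" using z[of 1 1] nz by auto
    have "A $ i $ j / A $ k $ l = cnj (A $ i $ j / A $ k $ l)" for i j k l
    proof -
      have "A $ i $ j / A $ k $ l = (z * cnj (A $ i $ j)) / (z * cnj (A $ k $ l))"
        using z[of i j] z[of k l] by simp
      then show ?thesis using z0 by simp
    qed
    then have "Im (A $ i $ j / A $ k $ l) = 0" for i j k l
      by (metis Reals_cnj_iff complex_is_Real_iff)
    then have "Im (cell_coords A $ i) = 0" for i
      using exhaust_3[of i] by (auto simp: cell_coords_nth simp del: complex_cnj_divide)
    then show ?thesis using True by (simp add: vec_eq_iff graph_map_def graph_coords_def complex_eq_iff)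
  next
    case False
    then have m3: "m = Some 3" using m by blast
    then obtain c where S: "A \<in> SU3" and c: "A *v axis_vec 3 = c *s axis_vec 3" using A(1) by (auto simp: model_group_def)
    note e = model_group_3_entries[OF S c]
    define a where "a = A$2$1 / A$1$1"
    define b where "b = A$3$1 / A$1$1"
    have co: "cell_coords A $ 1 = a" "cell_coords A $ 2 = b" "cell_coords A $ 3 = cnj a"
      by (simp_all add: cell_coords_nth a_def b_def e)
    have "(conj_transpose A ** A) $ 1 $ 3 = 0" by (simp add: SU3_left[OF S] mat1_nth)
    then have "cnj (A$1$1) * A$3$1 + A$1$1 * cnj (A$3$1) = A$2$1 * cnj (A$2$1)"
      by (simp add: mm_nth e algebra_simps)
    moreover have "A$2$1 = a * A$1$1" "A$3$1 = b * A$1$1" using nz by (simp_all add: a_def b_def)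
    ultimately have "(A$1$1 * cnj (A$1$1)) * (b + cnj b) = (A$1$1 * cnj (A$1$1)) * (a * cnj a)"
      by (simp add: algebra_simps)
    then have "b + cnj b = a * cnj a" using nz by simp
    then have "Re (b + cnj b) = Re (a * cnj a)" by simp
    then have "Re b = (Re a * Re a + Im a * Im a) / 2" by simp
    then show ?thesis using m3 by (simp add: c3_eq_iff co graph_map_def graph_coords_def complex_eq_iff)
  qed
qed

text \<open>Along a submanifold of the orbit of full dimension, the coordinates of the graph have an
  invertible derivative, so it covers a neighbourhood in the orbit.\<close>

lemma orbit_neighbourhood:
  assumes m: "m \<in> {None, Some 3}" and B: "SU3_diff W B" and x: "x \<in> W"
    and G: "\<And>y. y \<in> W \<Longrightarrow> B y \<in> model_group m" and inj: "inj (xi B (x :: real^3))"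
  shows "\<exists>U. openin flag_topology U \<and> act (B x) f_st \<in> U \<and>
    U \<inter> orbit (model_group m) \<subseteq> (\<lambda>y. act (B y) f_st) ` W"
proof -
  define R where "R = B x"
  have R: "R \<in> SU3" "R \<in> model_group m" using SU3_diff_D(2)[OF B x] G[OF x] by (auto simp: R_def)
  define H where "H y = conj_transpose R ** B y" for y
  have dH: "H differentiable (at y)" if "y \<in> W" for y
    unfolding H_def
    by (rule differentiable_bounded_linear[OF bounded_bilinear.bounded_linear_right[OF bounded_bilinear_mm] SU3_diff_D(3)[OF B that]])
  have H: "SU3_diff W H" unfolding SU3_diff_def
    using dH SU3_diff_D(1,2)[OF B] SU3_mult[OF SU3_ct[OF R(1)]] by (auto simp: H_def)
  have HG: "H y \<in> model_group m" if "y \<in> W" for y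
    unfolding H_def by (rule model_group_mult[OF model_group_ct[OF R(2)] G[OF that]])
  define V where "V = {y \<in> W. H y \<in> big_cell}"
  have cH: "continuous_on W (\<lambda>y. H y $ i $ i)" for i
    using differentiable_vec_nth[OF differentiable_vec_nth[OF dH]]
    by (intro continuous_at_imp_continuous_on ballI differentiable_imp_continuous_within)
  have V_eq: "V = (W \<inter> (\<lambda>y. H y $ 1 $ 1) -` (- {0})) \<inter> (W \<inter> (\<lambda>y. H y $ 3 $ 3) -` (- {0}))"
    by (auto simp: V_def big_cell_def)
  have oV: "open V" unfolding V_eq
    by (intro open_Int continuous_open_preimage[OF cH SU3_diff_D(1)[OF B]]) auto
  have VW: "V \<subseteq> W" by (auto simp: V_def)
  have xV: "x \<in> V" using x SU3_left[OF R(1)] by (simp add: V_def H_def R_def[symmetric] big_cell_def mat1_nth)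
  note HV = SU3_diff_subset[OF H oV VW]
  have big: "H y \<in> big_cell" if "y \<in> V" for y using that by (simp add: V_def)
  define z where "z y = cell_coords (H y)" for y
  define h where "h y = graph_coords m (z y)" for y
  note cd = cell_coords_derivative[OF HV _ big]
  have dz: "z differentiable (at y)" if "y \<in> V" for y unfolding z_def by (rule cd(1)[OF that that])
  have zh: "z y = graph_map m (h y)" if "y \<in> V" for y
    unfolding z_def h_def by (rule model_group_graph[OF m HG big]) (use that VW in auto)
  have dh: "h differentiable (at y)" if "y \<in> V" for y
    unfolding h_def by (rule differentiable_bounded_linear[OF linear_graph_coords dz[OF that]])
  have lin: "linear (D h x)" by (rule D_linear[OF dh[OF xV]])
  have "u = 0" if "D h x u = 0" for u
  proof -
    have "D z x u = D (\<lambda>y. graph_map m (h y)) x u" using D_cong[OF oV xV zh] by simp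
    also have "\<dots> = D (graph_map m) (h x) (D h x u)" by (rule D_chain[OF dh[OF xV] graph_map_differentiable])
    also have "\<dots> = 0" using that linear_0[OF D_linear[OF graph_map_differentiable]] by simp
    finally have "xi H x u = 0" using cd(2)[OF xV xV] by (simp add: z_def[abs_def])
    then have "xi B x u = 0"
      using xi_left_mult[OF SU3_ct[OF R(1)] SU3_diff_D(3)[OF B x]] by (simp add: H_def[abs_def])
    then show "u = 0" using inj linear_injective_0[OF linear_xi[OF B x]] by blast
  qed
  then have "inj (D h x)" using linear_injective_0[OF lin] by blast
  then obtain g' where g': "linear g'" "D h x \<circ> g' = id"
    using linear_injective_isomorphism[OF lin] by (auto simp: fun_eq_iff)
  have "continuous_on V h"
    using dh by (intro continuous_at_imp_continuous_on ballI differentiable_imp_continuous_within)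
  then have "h x \<in> interior (h ` V)"
    using sussmann_open_mapping[OF oV _ xV D_has_derivative[OF dh[OF xV]] _ g'(2) order_refl] g'(1) xV oV
    by (simp add: linear_conv_bounded_linear interior_open)
  then obtain O' where O': "open O'" "h x \<in> O'" "O' \<subseteq> h ` V" unfolding interior_def by blast
  define U where "U = {f \<in> cell R. cell_map R f \<in> graph_coords m -` O'}"
  have "open (graph_coords m -` O')"
    by (rule open_vimage[OF O'(1) linear_continuous_on[OF linear_graph_coords]])
  then have "openin flag_topology U" unfolding U_def by (rule openin_cell_preimage)
  have val: "act (B y) f_st \<in> cell R" "cell_map R (act (B y) f_st) = z y" if "y \<in> V" for y
  proof -
    have S: "B y \<in> SU3" using SU3_diff_D(2)[OF B] that VW by blast
    show "act (B y) f_st \<in> cell R" using cell_eval(1)[OF S, of R] big[OF that] by (simp add: H_def)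
    then show "cell_map R (act (B y) f_st) = z y" using cell_eval(2)[OF S] by (simp add: z_def H_def)
  qed
  have "act (B x) f_st \<in> U" using val[OF xV] O'(2) by (simp add: U_def h_def)
  moreover have "f \<in> (\<lambda>y. act (B y) f_st) ` W" if f: "f \<in> U" "f \<in> orbit (model_group m)" for f
  proof -
    obtain A where A: "A \<in> model_group m" "f = act A f_st" using f(2) by (auto simp: orbit_def)
    have S: "A \<in> SU3" by (rule model_group_SU3[OF A(1)])
    have fc: "f \<in> cell R" "graph_coords m (cell_map R f) \<in> O'" using f(1) by (auto simp: U_def)
    have bigA: "conj_transpose R ** A \<in> big_cell" and cmA: "cell_map R f = cell_coords (conj_transpose R ** A)"
      using fc(1) cell_eval[OF S, of R] A(2) by auto
    obtain y where y: "y \<in> V" "graph_coords m (cell_map R f) = h y" using fc(2) O'(3) by blast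
    have "cell_map R f = graph_map m (graph_coords m (cell_map R f))"
      unfolding cmA by (rule model_group_graph[OF m model_group_mult[OF model_group_ct[OF R(2)] A(1)] bigA])
    also have "\<dots> = cell_map R (act (B y) f_st)" using y zh[OF y(1)] val(2)[OF y(1)] by simp
    finally have "f = act (B y) f_st" by (rule cell_inj[OF R(1) fc(1) val(1)[OF y(1)]])
    then show ?thesis using y VW by blast
  qed
  ultimately show ?thesis using \<open>openin flag_topology U\<close> by blast
qed

subsection \<open>Normalization by the Weyl group\<close>

text \<open>All three versions of the second model are carried to the one whose orbit is that of \<open>SU(2)\<close>.\<close>

definition normal_model :: "3 option \<Rightarrow> 3 option" where
  "normal_model m = (if m = None then None else Some 3)"

definition permutation :: "3 option \<Rightarrow> mat3" where
  "permutation m = (if m = Some 1 then cyclic else if m = Some 2 then cyclic ** cyclic else mat 1)"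

lemma permutation: "permutation m \<in> weyl" "conj_transpose (permutation m) \<in> weyl" "permutation m \<in> SU3"
  using weyl_ct[of "permutation m"] by (auto simp: permutation_def weyl_def)

lemma cyclic_axis_vec: "cyclic *v axis_vec k = axis_vec (k + 1)"
  using exhaust_3[of k] by (auto simp: c3_eq_iff mv_nth cyclic_def axis_vec_def numeral_mod_3)

lemma permutation_axis_vec: "permutation (Some k) *v axis_vec 3 = axis_vec k"
proof -
  have 1: "cyclic *v axis_vec 3 = axis_vec 1" and 2: "cyclic *v axis_vec 1 = axis_vec 2"
    using cyclic_axis_vec[of 3] cyclic_axis_vec[of 1] by (simp_all add: numeral_mod_3)
  then have "(cyclic ** cyclic) *v axis_vec 3 = axis_vec 2"
    by (simp flip: matrix_vector_mul_assoc)
  then show ?thesis using 1 exhaust_3[of k] by (auto simp: permutation_def)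
qed

lemma model_group_permutation:
  assumes "A \<in> model_group m"
  shows "conj_transpose (permutation m) ** A ** permutation m \<in> model_group (normal_model m)"
proof (cases m)
  case None
  then show ?thesis using assms by (simp add: permutation_def normal_model_def)
next
  case (Some k)
  let ?w = "permutation m"
  obtain c where A: "A \<in> SU3" and c: "A *v axis_vec k = c *s axis_vec k"
    using assms by (auto simp: model_group_def Some)
  have e: "?w *v axis_vec 3 = axis_vec k" using permutation_axis_vec[of k] by (simp add: Some)
  have "conj_transpose ?w *v axis_vec k = axis_vec 3"
    unfolding e[symmetric] by (simp add: matrix_vector_mul_assoc SU3_left[OF permutation(3)])
  then have "(conj_transpose ?w ** A ** ?w) *v axis_vec 3 = c *s axis_vec 3"
    by (simp add: e c vector_scalar_commute flip: matrix_vector_mul_assoc)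
  moreover have "conj_transpose ?w ** A ** ?w \<in> SU3"
    by (intro SU3_mult SU3_ct A permutation(3))
  ultimately show ?thesis by (auto simp: model_group_def normal_model_def Some)
qed

context tg_lagrangian
begin

lemma image_open_in_orbit:
  assumes C: "C \<in> SU3" and part: "part m C = topspace L"
  defines "\<Phi> \<equiv> symmetry (conj_transpose (permutation m) ** conj_transpose C) (permutation m)"
  shows "openin (subtopology flag_topology (orbit (model_group (normal_model m)))) (\<Phi> ` \<iota> ` topspace L)"
proof (subst openin_subopen, intro ballI)
  let ?w = "permutation m" and ?N = "orbit (model_group (normal_model m))"
  have BS: "conj_transpose ?w ** conj_transpose C \<in> SU3" by (intro SU3_mult SU3_ct C permutation(3))
  fix f assume "f \<in> \<Phi> ` \<iota> ` topspace L"
  then obtain p where p: "p \<in> topspace L" "f = \<Phi> (\<iota> p)" by blast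
  then obtain c W B where c: "c \<in> \<A>" "p \<in> fst c" "snd c p \<in> W" and B: "adapted c W B m"
    "conj_transpose C ** B (snd c p) \<in> model_group m" unfolding part[symmetric] part_def by blast
  define x where "x = snd c p"
  define H where "H y = (conj_transpose ?w ** conj_transpose C) ** B y ** ?w" for y
  have d: "SU3_diff W B" and Wc: "W \<subseteq> chart_image c" and xW: "x \<in> W" using B(1) c by (auto simp: adapted_def x_def)
  have lift: "act (H y) f_st = \<Phi> (\<iota> (chart_inv c y))" if "y \<in> W" for y
  proof -
    have "\<iota> (chart_inv c y) = act (B y) f_st" using B(1) that by (simp add: adapted_def)
    then show ?thesis
      unfolding \<Phi>_def H_def using symmetry_act[OF BS permutation(1) SU3_diff_D(2)[OF d that]] by simp
  qed
  have H: "SU3_diff W H" unfolding SU3_diff_def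
  proof (intro conjI ballI)
    show "open W" by (rule SU3_diff_D(1)[OF d])
    fix y assume y: "y \<in> W"
    show "H y \<in> SU3" unfolding H_def by (intro SU3_mult BS permutation(3) SU3_diff_D(2)[OF d y])
    have "bounded_linear (\<lambda>X. (conj_transpose ?w ** conj_transpose C) ** X ** ?w)"
      by (rule bounded_linear_compose[OF bounded_bilinear.bounded_linear_left[OF bounded_bilinear_mm]
          bounded_bilinear.bounded_linear_right[OF bounded_bilinear_mm]])
    then show "H differentiable (at y)"
      unfolding H_def by (rule differentiable_bounded_linear[OF _ SU3_diff_D(3)[OF d y]])
  qed
  have HG: "H y \<in> model_group (normal_model m)" if y: "y \<in> W" for y
  proof -
    have S: "B x \<in> SU3" by (rule SU3_diff_D(2)[OF d xW])
    have "conj_transpose (B x) ** B y \<in> model_group m" using B(1) xW y by (simp add: adapted_def)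
    from model_group_mult[OF B(2)[folded x_def] this]
    have "conj_transpose C ** B y \<in> model_group m" by (simp add: SU3_cancel[OF S] flip: matrix_mul_assoc)
    from model_group_permutation[OF this] show ?thesis by (simp add: H_def matrix_mul_assoc)
  qed
  have nm: "normal_model m \<in> {None, Some 3}" by (simp add: normal_model_def)
  have inj: "inj (xi H x)"
  proof (subst linear_injective_0[OF linear_xi[OF H xW]], intro allI impI)
    fix u assume "xi H x u = 0"
    then have "coords (conj_transpose ?w ** mc B x u ** ?w) = 0"
      using xi_two_sided[OF BS SU3_diff_D(3)[OF d xW], of ?w u] by (simp add: H_def[abs_def])
    moreover have "coords (conj_transpose ?w ** mc B x u ** ?w) \<bullet> coords (conj_transpose ?w ** mc B x u ** ?w)
      = coords (mc B x u) \<bullet> coords (mc B x u)" using permutation(1)[of m] by (simp add: weyl_def)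
    ultimately have "xi B x u = 0" by (simp add: xi_def)
    then show "u = 0"
      using B(1) xW linear_injective_0[OF linear_xi[OF d xW]] by (simp add: adapted_def)
  qed
  obtain U where U: "openin flag_topology U" "act (H x) f_st \<in> U" "U \<inter> ?N \<subseteq> (\<lambda>y. act (H y) f_st) ` W"
    using orbit_neighbourhood[OF nm H xW HG inj] by blast
  have ip: "chart_inv c x = p" using is_chart_inverse(3)[OF chart[OF c(1)] c(2)] by (simp add: x_def)
  have f: "f = act (H x) f_st" using lift[OF xW] p(2) ip by simp
  have "U \<inter> ?N \<subseteq> \<Phi> ` \<iota> ` topspace L"
  proof
    fix g assume "g \<in> U \<inter> ?N"
    then obtain y where y: "y \<in> W" "g = act (H y) f_st" using U(3) by blast
    have "chart_inv c y \<in> topspace L"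
      using is_chart_inverse(1)[OF chart[OF c(1)], of y] Wc y(1) chart[OF c(1)] openin_subset
      by (fastforce simp: is_chart_def)
    then show "g \<in> \<Phi> ` \<iota> ` topspace L" using y lift by auto
  qed
  moreover have "f \<in> U \<inter> ?N" using U(2) f HG[OF xW] by (auto simp: orbit_def)
  moreover have "openin (subtopology flag_topology ?N) (U \<inter> ?N)"
    using U(1) by (auto simp: openin_subtopology)
  ultimately show "\<exists>T. openin (subtopology flag_topology ?N) T \<and> f \<in> T \<and> T \<subseteq> \<Phi> ` \<iota> ` topspace L" by blast
qed

end

theorem theorem5p1:
  fixes L :: "'l topology" and \<A> :: "('l, real^3) chart set" and \<iota> :: "'l \<Rightarrow> flag"
  assumes "Lagrangian L \<A> \<iota>"
    and "connected_space L"
    and "totally_geodesic \<A> flag_atlas flag_metric \<iota>"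
  shows "\<exists>N \<in> {orbit SO3, orbit SU2}. \<exists>U.
           openin (subtopology flag_topology N) U \<and> congruent_flags (\<iota> ` topspace L) U"
proof (cases "topspace L = {}")
  case True
  have "mat 1 \<in> weyl" "conj_transpose (mat 1) \<in> weyl" by (simp_all add: weyl_1)
  then have "congruent_flags (\<iota> ` topspace L) {}"
    unfolding congruent_flags_def True using symmetry_isometry[OF SU3_1] by blast
  then show ?thesis by (meson insertI1 openin_empty)
next
  case False
  interpret tg_lagrangian L \<A> \<iota> by unfold_locales (rule assms)+
  obtain m C where C: "C \<in> SU3" "part m C = topspace L" by (rule single_model[OF False]) blast
  let ?B = "conj_transpose (permutation m) ** conj_transpose C"
  have "?B \<in> SU3" by (intro SU3_mult SU3_ct C permutation(3))
  then have "congruent_flags (\<iota> ` topspace L) (symmetry ?B (permutation m) ` \<iota> ` topspace L)"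
    unfolding congruent_flags_def using symmetry_isometry[OF _ permutation(1,2)] by blast
  moreover have "orbit (model_group (normal_model m)) \<in> {orbit SO3, orbit SU2}"
    by (simp add: normal_model_def orbit_SO3 orbit_SU2)
  ultimately show ?thesis using image_open_in_orbit[OF C] by blast
qed

end
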